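(* Let $P$ be an orthogonal polygon with $n$ vertices in general position. Then $P$ has a local routing set of beacons of cardinality at most $\lfloor (n-4)/3 \rfloor$.
   Context: A polygon here is a closed region bounded by a simple closed polygonal curve; it is orthogonal if every edge is horizontal or vertical. General position: no two vertical edges lie on a common vertical line and no two horizontal edges lie on a common horizontal line. Attraction: for points $p$ (a robot) and $q$ (a beacon) in $P$, the attraction path of $p$ toward $q$ is the motion in which $p$ always moves so as to locally decrease its Euclidean distance to $q$ while staying in $P$: it moves in a straight line toward $q$ whenever it can; when it is on the boundary and cannot move straight toward $q$ inside $P$, it slides along the boundary in the direction that decreases its distance to $q$, if such a direction exists; otherwise it is stuck (e.g. at the point of an edge where the edge is perpendicular to the line to $q$, or at a convex vertex whose two edges both lead away from $q$). If the point is at a reflex vertex where both incident edges lead toward $q$ but the straight segment toward $q$ leaves $P$, the path is indeterminate and is not considered to reach $q$. We say $q$ attracts $p$ if the attraction path of $p$ toward $q$ reaches $q$. Beacon routing: a beacon routing from $p$ to $q$ is a sequence $b_1,\dots,b_k$ of points of $P$ such that $b_1$ attracts $p$, $b_{j+1}$ attracts $b_j$ for each $j$, and $q$ attracts $b_k$ (for $k=0$: $q$ attracts $p$). Its routing segments are the maximal portions of the resulting path during which the point is attracted by a single beacon (or by $q$). A routing set of beacons for $P$ is a finite set $B\subseteq P$ such that every two points $p,q\in P$ have a beacon routing whose intermediate beacons all lie in $B$. Vertical decomposition: from every reflex vertex of $P$ draw the maximal vertical chord of $P$ through it (these chords are the verticals); they decompose $P$ into $(n-2)/2$ axis-parallel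 rectangles. A routing segment is local if it is contained in the union of at most three rectangles of this decomposition; a routing set of beacons $B$ is local if every pair $p,q\in P$ has a beacon routing with intermediate beacons from $B$ all of whose routing segments are local. *)

theory Defs
  imports "HOL-Analysis.Analysis"
begin

type_synonym pt = "real \<times> real"

definition edge :: "pt list \<Rightarrow> nat \<Rightarrow> pt set" where
  "edge vs i = closed_segment (vs ! i) (vs ! (Suc i mod length vs))"

definition vert_edge :: "pt list \<Rightarrow> nat \<Rightarrow> bool" where
  "vert_edge vs i \<longleftrightarrow> fst (vs ! i) = fst (vs ! (Suc i mod length vs))"

definition horiz_edge :: "pt list \<Rightarrow> nat \<Rightarrow> bool" where
  "horiz_edge vs i \<longleftrightarrow> snd (vs ! i) = snd (vs ! (Suc i mod length vs))"

definition orthogonal_polygon :: "pt list \<Rightarrow> bool" where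
  "orthogonal_polygon vs \<longleftrightarrow>
     3 \<le> length vs \<and> distinct vs \<and>
     (\<forall>i < length vs. vert_edge vs i \<or> horiz_edge vs i) \<and>
     (\<forall>i < length vs. \<forall>j < length vs. i \<noteq> j \<longrightarrow>
        edge vs i \<inter> edge vs j \<subseteq>
          {vs ! i, vs ! (Suc i mod length vs)} \<inter> {vs ! j, vs ! (Suc j mod length vs)})"

definition general_position :: "pt list \<Rightarrow> bool" where
  "general_position vs \<longleftrightarrow>
     (\<forall>i < length vs. \<forall>j < length vs. i \<noteq> j \<and> vert_edge vs i \<and> vert_edge vs j
        \<longrightarrow> fst (vs ! i) \<noteq> fst (vs ! j)) \<and>
     (\<forall>i < length vs. \<forall>j < length vs. i \<noteq> j \<and> horiz_edge vs i \<and> horiz_edge vs j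
        \<longrightarrow> snd (vs ! i) \<noteq> snd (vs ! j))"

definition poly_boundary :: "pt list \<Rightarrow> pt set" where
  "poly_boundary vs = (\<Union>i < length vs. edge vs i)"

definition poly_region :: "pt list \<Rightarrow> pt set" where
  "poly_region vs = poly_boundary vs \<union> inside (poly_boundary vs)"

definition can_go_straight :: "pt set \<Rightarrow> pt \<Rightarrow> pt \<Rightarrow> bool" where
  "can_go_straight P q x \<longleftrightarrow> (\<exists>e>0. closed_segment x (x + e *\<^sub>R (q - x)) \<subseteq> P)"

definition slide_dir :: "pt set \<Rightarrow> pt \<Rightarrow> pt \<Rightarrow> pt \<Rightarrow> bool" where
  "slide_dir P q x d \<longleftrightarrow> d \<in> {(1,0), (-1,0), (0,1), (0,-1)} \<and>
     (\<exists>e>0. closed_segment x (x + e *\<^sub>R d) \<subseteq> frontier P) \<and> inner d (q - x) > 0"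

text \<open>One piece of an attraction path of a point toward \<open>q\<close>: either a straight move
  toward \<open>q\<close> inside \<open>P\<close>, or a slide along the boundary in the (unique) distance-decreasing
  direction, performed only while a straight move is impossible.  Non-uniqueness of the
  slide direction is the indeterminate case, which is excluded.\<close>
definition attraction_step :: "pt set \<Rightarrow> pt \<Rightarrow> pt \<Rightarrow> pt \<Rightarrow> bool" where
  "attraction_step P q a b \<longleftrightarrow> a \<noteq> b \<and>
     ((\<exists>s. 0 < s \<and> s \<le> 1 \<and> b = a + s *\<^sub>R (q - a) \<and> closed_segment a b \<subseteq> P) \<or>
      (\<exists>d t. t > 0 \<and> b = a + t *\<^sub>R d \<and> closed_segment a b \<subseteq> frontier P \<and>
         (\<forall>x \<in> closed_segment a b - {b}.
            \<not> can_go_straight P q x \<and> slide_dir P q x d \<and>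
            (\<forall>d'. slide_dir P q x d' \<longrightarrow> d' = d))))"

definition attraction_seq :: "pt set \<Rightarrow> pt \<Rightarrow> pt \<Rightarrow> pt list \<Rightarrow> bool" where
  "attraction_seq P q p xs \<longleftrightarrow> xs \<noteq> [] \<and> hd xs = p \<and> last xs = q \<and>
     (\<forall>i. Suc i < length xs \<longrightarrow> attraction_step P q (xs ! i) (xs ! Suc i))"

definition attracts :: "pt set \<Rightarrow> pt \<Rightarrow> pt \<Rightarrow> bool" where
  "attracts P q p \<longleftrightarrow> (\<exists>xs. attraction_seq P q p xs)"

definition path_points :: "pt list \<Rightarrow> pt set" where
  "path_points xs = set xs \<union> (\<Union>i \<in> {i. Suc i < length xs}. closed_segment (xs ! i) (xs ! Suc i))"

definition reflex_vertex :: "pt list \<Rightarrow> pt \<Rightarrow> bool" where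
  "reflex_vertex vs v \<longleftrightarrow> v \<in> set vs \<and>
     (\<exists>\<delta>>0. \<forall>e. 0 < e \<and> e < \<delta> \<longrightarrow>
        card {d \<in> {(1,1), (1,-1), (-1,1), (-1,-1)}. v + e *\<^sub>R d \<in> interior (poly_region vs)} = 3)"

definition vertical_chord :: "pt set \<Rightarrow> pt \<Rightarrow> pt set" where
  "vertical_chord P v = connected_component_set {x \<in> P. fst x = fst v} v"

definition decomp_cells :: "pt list \<Rightarrow> pt set set" where
  "decomp_cells vs = closure ` components
     (interior (poly_region vs) - \<Union> (vertical_chord (poly_region vs) ` {v. reflex_vertex vs v}))"

definition local_set :: "pt list \<Rightarrow> pt set \<Rightarrow> bool" where
  "local_set vs S \<longleftrightarrow> (\<exists>R. R \<subseteq> decomp_cells vs \<and> finite R \<and> card R \<le> 3 \<and> S \<subseteq> \<Union> R)"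

definition local_beacon_routing :: "pt list \<Rightarrow> pt set \<Rightarrow> pt \<Rightarrow> pt \<Rightarrow> bool" where
  "local_beacon_routing vs B p q \<longleftrightarrow>
     (\<exists>bs. set bs \<subseteq> B \<and>
        (let pts = p # bs @ [q] in
           \<forall>i. Suc i < length pts \<longrightarrow>
             (\<exists>xs. attraction_seq (poly_region vs) (pts ! Suc i) (pts ! i) xs \<and>
                   local_set vs (path_points xs))))"

definition local_routing_set :: "pt list \<Rightarrow> pt set \<Rightarrow> bool" where
  "local_routing_set vs B \<longleftrightarrow> finite B \<and> B \<subseteq> poly_region vs \<and>
     (\<forall>p \<in> poly_region vs. \<forall>q \<in> poly_region vs. local_beacon_routing vs B p q)"

end

theory Submission
  imports Defs
begin

text \<open>
  Every vertical edge \<open>e\<close> borders, on its interior side, one \<^emph>\<open>base\<close> cell; at each reflex end of \<open>e\<close> the chord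
  opens a \<^emph>\<open>door\<close> from the base cell to a \<^emph>\<open>narrow\<close> cell on the other side, whose whole side is that door.
  By the Jordan curve theorem each door separates the polygon, so cells and doors form a tree, and counting the
  two vertical sides of every cell yields at most \<open>(n - 4) / 2\<close> reflex ends.

  A beacon in a door serves both cells of the door. If both ends of \<open>e\<close> are reflex, a single beacon in the base cell,
  slightly beyond the level of one end, also serves all three cells; it behaves like a beacon in a door only
  for the narrow cell at that end. If just one end is reflex, the chord may even carry no beacon at all, because the
  union of its two cells is L-shaped. Two chords incident to the same cell are compatible if one of them carries
  beacons in all its doors, or if both beacons favour the common cell. Ignoring base cells of doubly reflex edges,
  chords form paths, and cutting these paths into blocks of at most three chords leads to a compatible choice with
  at most two beacons per three reflex ends.

  The only obstruction inside a pair of neighbouring cells is a robot standing on a reflex vertex at the far side of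
  a narrow cell; compatibility provides a beacon in the far door, which is visited first.
\<close>

section \<open>Selecting chords\<close>

text \<open>A block may spend two thirds of its weight, the weight of a chord being its number of
  reflex ends; two thirds of (n - 4) / 2 is the bound. Two doubly reflex chords that are followed by
  another chord cannot form a block of their own: one beacon for the former and two for the latter
  make 3 against a weight of 4. Hence blocks of three. Compatibility has two sources. At a reflex
  vertex on the far side of a narrow cell both boundary directions may approach the target while the
  straight move leaves the polygon, so the robot needs another beacon to start with. Moreover,
  beacons of two chords at a common cell must reach each other; if both favour that cell, a straight
  segment through it and two base cells does this, which exhausts the three rectangles that locality
  allows. Trees enter only through two-colourings: an edge is a bridge if some colouring of the
  vertices separates its ends and the ends of no other edge. This is what the Jordan curve theorem
  yields for a door, and it passes to subsets of edges and to links composed of two doors.\<close>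

text \<open>The colouring hypothesis says that every edge is a bridge, so the graph is a forest.
  Deleting an edge splits the vertices into two nonempty colour classes and each remaining edge
  stays within one class; induction applies to both.\<close>

lemma card_edges_less_card_vertices:
  fixes a b :: "'e \<Rightarrow> 'v"
  assumes "finite V" "V \<noteq> {}" "finite E" "a ` E \<subseteq> V" "b ` E \<subseteq> V"
    and "\<And>e. e \<in> E \<Longrightarrow> \<exists>\<kappa>::'v \<Rightarrow> bool. \<kappa> (a e) \<noteq> \<kappa> (b e) \<and> (\<forall>f\<in>E. f \<noteq> e \<longrightarrow> \<kappa> (a f) = \<kappa> (b f))"
  shows "card E < card V"
  using assms
proof (induction "card E" arbitrary: E V rule: less_induct)
  case less
  show ?case
  proof (cases "E = {}")
    case True
    then show ?thesis using less.prems by (simp add: card_gt_0_iff)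
  next
    case False
    then obtain e where e: "e \<in> E" by blast
    obtain \<kappa> :: "'v \<Rightarrow> bool" where chi: "\<kappa> (a e) \<noteq> \<kappa> (b e)"
      "\<And>f. f \<in> E \<Longrightarrow> f \<noteq> e \<Longrightarrow> \<kappa> (a f) = \<kappa> (b f)"
      using less.prems(6)[OF e] by blast
    define V1 where "V1 = {v\<in>V. \<kappa> v}"
    define V2 where "V2 = {v\<in>V. \<not> \<kappa> v}"
    define E1 where "E1 = {f\<in>E. f \<noteq> e \<and> \<kappa> (a f)}"
    define E2 where "E2 = {f\<in>E. f \<noteq> e \<and> \<not> \<kappa> (a f)}"
    have V: "V = V1 \<union> V2" "V1 \<inter> V2 = {}" unfolding V1_def V2_def by auto
    have E: "E = insert e (E1 \<union> E2)" "E1 \<inter> E2 = {}" "e \<notin> E1" "e \<notin> E2"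
      unfolding E1_def E2_def using e by auto
    have ae: "a e \<in> V" "b e \<in> V" using e less.prems by auto
    have fin: "finite V1" "finite V2" "finite E1" "finite E2"
      using less.prems unfolding V1_def V2_def E1_def E2_def by auto
    have ne: "V1 \<noteq> {}" "V2 \<noteq> {}" using ae chi(1) unfolding V1_def V2_def by auto
    have cE: "card E = Suc (card E1 + card E2)"
      using E fin by (metis Un_iff card_Un_disjoint card_insert_disjoint finite_UnI)
    have cV: "card V = card V1 + card V2" using V fin by (metis card_Un_disjoint)
    have "card E1 < card V1"
    proof (rule less.hyps)
      show "card E1 < card E" using cE by simp
      show "a ` E1 \<subseteq> V1" "b ` E1 \<subseteq> V1"
        using less.prems chi(2) unfolding E1_def V1_def by auto
      show "\<exists>\<kappa>::'v \<Rightarrow> bool. \<kappa> (a f) \<noteq> \<kappa> (b f) \<and> (\<forall>g\<in>E1. g \<noteq> f \<longrightarrow> \<kappa> (a g) = \<kappa> (b g))"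
        if "f \<in> E1" for f
      proof -
        have "f \<in> E" using that E1_def by auto
        from less.prems(6)[OF this] show ?thesis using E1_def by blast
      qed
    qed (use fin ne in auto)
    moreover have "card E2 < card V2"
    proof (rule less.hyps)
      show "card E2 < card E" using cE by simp
      show "a ` E2 \<subseteq> V2" "b ` E2 \<subseteq> V2"
        using less.prems chi(2) unfolding E2_def V2_def by auto
      show "\<exists>\<kappa>::'v \<Rightarrow> bool. \<kappa> (a f) \<noteq> \<kappa> (b f) \<and> (\<forall>g\<in>E2. g \<noteq> f \<longrightarrow> \<kappa> (a g) = \<kappa> (b g))"
        if "f \<in> E2" for f
      proof -
        have "f \<in> E" using that E2_def by auto
        from less.prems(6)[OF this] show ?thesis using E2_def by blast
      qed
    qed (use fin ne in auto)
    ultimately show ?thesis using cE cV by simp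
  qed
qed

text \<open>The choices for a chord: no beacon, a beacon in each of its doors, or one beacon in the
  base cell favouring the narrow cell \<open>v\<close>. Accordingly \<open>cost\<close> counts
  beacons, its flag telling whether both ends are reflex.\<close>

datatype 'v status = Skip | Full | Fav 'v

fun cost :: "bool \<Rightarrow> 'v status \<Rightarrow> nat" where
  "cost d Skip = 0"
| "cost d Full = (if d then 2 else 1)"
| "cost d (Fav v) = 1"

definition admissible :: "('e \<Rightarrow> 'v) \<Rightarrow> ('e \<Rightarrow> 'v) \<Rightarrow> ('e \<Rightarrow> bool) \<Rightarrow> 'e set \<Rightarrow> ('e \<Rightarrow> 'v status) \<Rightarrow> bool" where
  "admissible a b dbl I st \<longleftrightarrow>
     (\<forall>i\<in>I. (st i = Skip \<longrightarrow> \<not> dbl i) \<and> (\<forall>v. st i = Fav v \<longrightarrow> dbl i \<and> v \<in> {a i, b i})) \<and>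
     (\<forall>i\<in>I. \<forall>j\<in>I. \<forall>v. i \<noteq> j \<longrightarrow> v \<in> {a i, b i} \<longrightarrow> v \<in> {a j, b j} \<longrightarrow>
        st i = Full \<or> st j = Full \<or> (st i = Fav v \<and> st j = Fav v))"

text \<open>Double counting of incidences: if every vertex had degree at least two, there would be
  at least as many edges as vertices, contrary to the forest bound.\<close>

lemma exists_leaf:
  fixes a b :: "'e \<Rightarrow> 'v"
  assumes "finite I" "I \<noteq> {}"
    and ab: "\<And>i. i \<in> I \<Longrightarrow> a i \<noteq> b i"
    and cut: "\<And>e. e \<in> I \<Longrightarrow> \<exists>\<kappa>::'v \<Rightarrow> bool. \<kappa> (a e) \<noteq> \<kappa> (b e) \<and> (\<forall>f\<in>I. f \<noteq> e \<longrightarrow> \<kappa> (a f) = \<kappa> (b f))"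
  shows "\<exists>i\<in>I. \<exists>v\<in>{a i, b i}. \<forall>j\<in>I. v \<in> {a j, b j} \<longrightarrow> j = i"
proof (rule ccontr)
  assume neg: "\<not> ?thesis"
  define V where "V = a ` I \<union> b ` I"
  have fV: "finite V" "V \<noteq> {}" using assms V_def by auto
  have lt: "card I < card V"
    by (rule card_edges_less_card_vertices[OF fV assms(1) _ _ cut]) (auto simp: V_def)
  define D where "D v = {i\<in>I. v \<in> {a i, b i}}" for v
  have fD: "finite (D v)" for v using assms(1) D_def by auto
  have "2 \<le> card (D v)" if v: "v \<in> V" for v
  proof -
    obtain i where i: "i \<in> I" "v \<in> {a i, b i}" using v V_def by auto
    then obtain j where j: "j \<in> I" "v \<in> {a j, b j}" "j \<noteq> i" using neg by blast
    have "{i,j} \<subseteq> D v" using i j D_def by auto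
    then have "card {i,j} \<le> card (D v)" using fD card_mono by blast
    then show ?thesis using j by auto
  qed
  then have "2 * card V \<le> (\<Sum>v\<in>V. card (D v))"
    using sum_bounded_below[of V 2 "\<lambda>v. card (D v)"] by (simp add: mult.commute)
  also have "\<dots> = card (SIGMA v:V. D v)" using fV fD by (simp add: card_SigmaI)
  also have "(SIGMA v:V. D v) = (\<lambda>i. (a i, i)) ` I \<union> (\<lambda>i. (b i, i)) ` I"
    unfolding D_def V_def by auto
  also have "card \<dots> \<le> card ((\<lambda>i. (a i, i)) ` I) + card ((\<lambda>i. (b i, i)) ` I)"
    by (rule card_Un_le)
  also have "\<dots> \<le> card I + card I" using assms(1) by (intro add_mono card_image_le) auto
  finally show False using lt by simp
qed

text \<open>Items of \<open>N\<close> that touch \<open>J\<close> are \<open>Full\<close>, and a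
  \<open>Full\<close> item satisfies every compatibility condition, so the two assignments can be
  glued without interaction.\<close>

lemma admissible_extend:
  assumes adm: "admissible a b dbl J st" and new: "admissible a b dbl N st'"
    and full: "\<And>i j v. i \<in> N \<Longrightarrow> j \<in> J \<Longrightarrow> v \<in> {a i, b i} \<Longrightarrow> v \<in> {a j, b j} \<Longrightarrow> st' i = Full"
    and I: "I = J \<union> N" "J \<inter> N = {}" "finite I"
    and c1: "3 * (\<Sum>i\<in>J. cost (dbl i) (st i)) \<le> 2 * (\<Sum>i\<in>J. if dbl i then 2 else 1)"
    and c2: "3 * (\<Sum>i\<in>N. cost (dbl i) (st' i)) \<le> 2 * (\<Sum>i\<in>N. if dbl i then 2 else (1::nat))"
  shows "\<exists>st. admissible a b dbl I st \<and>
       3 * (\<Sum>i\<in>I. cost (dbl i) (st i)) \<le> 2 * (\<Sum>i\<in>I. if dbl i then 2 else (1::nat))"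
proof -
  define su where "su i = (if i \<in> N then st' i else st i)" for i
  have JN: "su i = st i" if "i \<in> J" for i using that I su_def by auto
  have NN: "su i = st' i" if "i \<in> N" for i using that su_def by auto
  have fJ: "finite J" "finite N" using I by auto
  have "admissible a b dbl I su"
    unfolding admissible_def
  proof (intro conjI ballI allI impI)
    fix i assume i: "i \<in> I"
    show "\<not> dbl i" if "su i = Skip"
      using that i adm new I JN NN unfolding admissible_def by (metis Un_iff)
    show "dbl i" if "su i = Fav v" for v
      using that i adm new I JN NN unfolding admissible_def by (metis Un_iff)
    show "v \<in> {a i, b i}" if "su i = Fav v" for v
      using that i adm new I JN NN unfolding admissible_def by (metis Un_iff)
  next
    fix i j v assume h: "i \<in> I" "j \<in> I" "i \<noteq> j" "v \<in> {a i, b i}" "v \<in> {a j, b j}"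
    consider "i \<in> J" "j \<in> J" | "i \<in> N" "j \<in> N" | "i \<in> J" "j \<in> N" | "i \<in> N" "j \<in> J"
      using h I by auto
    then show "su i = Full \<or> su j = Full \<or> su i = Fav v \<and> su j = Fav v"
    proof cases
      case 1
      with adm h have "st i = Full \<or> st j = Full \<or> st i = Fav v \<and> st j = Fav v"
        unfolding admissible_def by blast
      then show ?thesis using 1 JN by simp
    next
      case 2
      with new h have "st' i = Full \<or> st' j = Full \<or> st' i = Fav v \<and> st' j = Fav v"
        unfolding admissible_def by blast
      then show ?thesis using 2 NN by simp
    next
      case 3
      then show ?thesis using full[of j i v] h NN by simp
    next
      case 4
      then show ?thesis using full[of i j v] h NN by simp
    qed
  qed
  moreover have "(\<Sum>i\<in>I. cost (dbl i) (su i)) = (\<Sum>i\<in>J. cost (dbl i) (st i)) + (\<Sum>i\<in>N. cost (dbl i) (st' i))"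
    unfolding I(1) using fJ I(2) JN NN by (simp add: sum.union_disjoint)
  moreover have "(\<Sum>i\<in>I. if dbl i then 2 else (1::nat)) = (\<Sum>i\<in>J. if dbl i then 2 else 1) + (\<Sum>i\<in>N. if dbl i then 2 else 1)"
    unfolding I(1) using fJ I(2) by (simp add: sum.union_disjoint)
  ultimately show ?thesis using c1 c2 by (intro exI[of _ su]) simp
qed

text \<open>Starting at a leaf, remove a block of one to three consecutive items whose last item is \<^const>\<open>Full\<close>
  (unless the block exhausts its path), so that the block imposes nothing on the remaining items.\<close>

lemma exists_admissible:
  fixes a b :: "'e \<Rightarrow> 'v"
  assumes "finite I"
    and "\<And>i. i \<in> I \<Longrightarrow> a i \<noteq> b i"
    and "\<And>e. e \<in> I \<Longrightarrow> \<exists>\<kappa>::'v \<Rightarrow> bool. \<kappa> (a e) \<noteq> \<kappa> (b e) \<and> (\<forall>f\<in>I. f \<noteq> e \<longrightarrow> \<kappa> (a f) = \<kappa> (b f))"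
    and "\<And>v i j k. i \<in> I \<Longrightarrow> j \<in> I \<Longrightarrow> k \<in> I \<Longrightarrow> v \<in> {a i, b i} \<Longrightarrow> v \<in> {a j, b j} \<Longrightarrow> v \<in> {a k, b k} \<Longrightarrow>
           i = j \<or> i = k \<or> j = k"
  shows "\<exists>st. admissible a b dbl I st \<and>
       3 * (\<Sum>i\<in>I. cost (dbl i) (st i)) \<le> 2 * (\<Sum>i\<in>I. if dbl i then 2 else (1::nat))"
  using assms
proof (induction "card I" arbitrary: I rule: less_induct)
  case less
  show ?case
  proof (cases "I = {}")
    case True
    then show ?thesis by (simp add: admissible_def)
  next
    case False
    note deg = less.prems(4)
    have IH: "\<exists>st. admissible a b dbl (I - N) st \<and>
       3 * (\<Sum>i\<in>I-N. cost (dbl i) (st i)) \<le> 2 * (\<Sum>i\<in>I-N. if dbl i then 2 else (1::nat))"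
      if "N \<subseteq> I" "N \<noteq> {}" for N
    proof (rule less.hyps)
      show "card (I - N) < card I" using that less.prems(1) by (intro psubset_card_mono) auto
      show "\<exists>\<kappa>::'v \<Rightarrow> bool. \<kappa> (a e) \<noteq> \<kappa> (b e) \<and> (\<forall>f\<in>I-N. f \<noteq> e \<longrightarrow> \<kappa> (a f) = \<kappa> (b f))"
        if "e \<in> I - N" for e using less.prems(3)[of e] that by blast
      show "i = j \<or> i = k \<or> j = k" if "i \<in> I - N" "j \<in> I - N" "k \<in> I - N" "v \<in> {a i, b i}" "v \<in> {a j, b j}" "v \<in> {a k, b k}" for v i j k
        using deg[of i j k v] that by blast
    qed (use less.prems(1,2) in auto)
    have ext: ?thesis if ep: "N \<subseteq> I" "N \<noteq> {}" "admissible a b dbl N st'"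
      "3 * (\<Sum>i\<in>N. cost (dbl i) (st' i)) \<le> 2 * (\<Sum>i\<in>N. if dbl i then 2 else (1::nat))"
      "\<And>i j v. i \<in> N \<Longrightarrow> j \<in> I - N \<Longrightarrow> v \<in> {a i, b i} \<Longrightarrow> v \<in> {a j, b j} \<Longrightarrow> st' i = Full" for N st'
    proof -
      obtain st where st: "admissible a b dbl (I - N) st"
       "3 * (\<Sum>i\<in>I-N. cost (dbl i) (st i)) \<le> 2 * (\<Sum>i\<in>I-N. if dbl i then 2 else (1::nat))"
        using IH[OF ep(1,2)] by blast
      show ?thesis
        by (rule admissible_extend[OF st(1) ep(3) _ _ _ less.prems(1) st(2) ep(4)])
           (use ep in auto)
    qed
    obtain i v where i: "i \<in> I" "v \<in> {a i, b i}" and leaf: "\<And>j. j \<in> I \<Longrightarrow> v \<in> {a j, b j} \<Longrightarrow> j = i"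
      using exists_leaf[OF less.prems(1) False less.prems(2,3)] by metis
    \<comment> \<open>The path is followed away from the leaf: \<open>w\<close> is the far end of
      \<open>i\<close>, and below \<open>u\<close> is the far end of the next item
      \<open>j\<close>.\<close>
    define w where "w = (if v = a i then b i else a i)"
    have iw: "{a i, b i} = {v, w}" using i(2) w_def by auto
    show ?thesis
    proof (cases "\<exists>j\<in>I. j \<noteq> i \<and> w \<in> {a j, b j}")
      case False
      \<comment> \<open>A path of a single item costs 0 against weight 1, or 1 against weight
        2.\<close>
      define st' where "st' = (\<lambda>x. if x = i \<and> \<not> dbl i then Skip else Fav w)"
      have cond: "st' k = Full" if "k \<in> {i}" "j \<in> I - {i}" "u \<in> {a k, b k}" "u \<in> {a j, b j}" for k j u
      proof -
        have "u \<in> {v,w}" using that iw by auto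
        then show ?thesis using that leaf[of j] False by auto
      qed
      show ?thesis
        by (rule ext[of "{i}" st']) (use i iw cond in \<open>auto simp: st'_def admissible_def\<close>)
    next
      case True
      then obtain j where j: "j \<in> I" "j \<noteq> i" "w \<in> {a j, b j}" by blast
      define u where "u = (if w = a j then b j else a j)"
      have ju: "{a j, b j} = {w, u}" using j(3) u_def by auto
      have vj: "v \<notin> {a j, b j}" using leaf j by auto
      have third: "k = i \<or> k = j" if "k \<in> I" "w \<in> {a k, b k}" for k
        using deg[of i j k w] i(1) j that iw by auto
      show ?thesis
      proof (cases "dbl i \<and> dbl j")
        case nd: False
        \<comment> \<open>If exactly one of the two items is double, the cost is 2 against weight 3,
          which is tight; if none is, it is 1 against 2.\<close>
        define st' where "st' = (\<lambda>x. if x = j then Full else if dbl i then Fav w else Skip)"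
        have cond: "st' k = Full" if "k \<in> {i,j}" "l \<in> I - {i,j}" "x \<in> {a k, b k}" "x \<in> {a l, b l}" for k l x
        proof (cases "k = j")
          case False
          then have "x \<in> {v,w}" using that iw by auto
          then show ?thesis using that leaf[of l] third[of l] by auto
        qed (simp add: st'_def)
        have adm: "admissible a b dbl {i,j} st'" using i j iw unfolding st'_def admissible_def by auto
        show ?thesis
          proof (rule ext[of "{i,j}" st', OF _ _ adm])
            show "st' n = Full" if "n \<in> {i,j}" "l \<in> I - {i,j}" "x \<in> {a n, b n}" "x \<in> {a l, b l}" for n l x
              by (rule cond[OF that])
          qed (use i j nd in \<open>auto simp: st'_def\<close>)
      next
        case dd: True
        show ?thesis
        proof (cases "\<exists>k\<in>I. k \<noteq> j \<and> u \<in> {a k, b k}")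
          case False
          \<comment> \<open>The path ends after two double items, so nothing forces a
            \<open>Full\<close> item: cost 2 against weight 4.\<close>
          define st' where "st' = (\<lambda>x::'e. Fav w)"
          have cond: "st' k = Full" if "k \<in> {i,j}" "l \<in> I - {i,j}" "x \<in> {a k, b k}" "x \<in> {a l, b l}" for k l x
          proof -
            have "x \<in> {v,w,u}" using that iw ju by auto
            then show ?thesis using that leaf[of l] third[of l] False by auto
          qed
          have xw: "x = w" if "x \<in> {a i, b i}" "x \<in> {a j, b j}" for x using that iw vj by auto
          have wij: "w \<in> {a i, b i}" "w \<in> {a j, b j}" using iw ju by auto
          have "\<forall>x\<in>{i,j}. dbl x \<and> w \<in> {a x, b x}" using dd wij by blast
          moreover have "\<forall>x\<in>{i,j}. \<forall>y\<in>{i,j}. \<forall>z. x \<noteq> y \<longrightarrow> z \<in> {a x, b x} \<longrightarrow> z \<in> {a y, b y} \<longrightarrow> z = w"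
            using xw by blast
          ultimately have adm: "admissible a b dbl {i,j} st'"
            unfolding st'_def admissible_def by blast
          show ?thesis
            proof (rule ext[of "{i,j}" st', OF _ _ adm])
            show "st' n = Full" if "n \<in> {i,j}" "l \<in> I - {i,j}" "x \<in> {a n, b n}" "x \<in> {a l, b l}" for n l x
              by (rule cond[OF that])
          qed (use i j dd in \<open>auto simp: st'_def\<close>)
        next
          case True
          then obtain k where k: "k \<in> I" "k \<noteq> j" "u \<in> {a k, b k}" by blast
          have uw: "u \<noteq> w" using less.prems(2)[OF j(1)] ju by auto
          have ki: "k \<noteq> i"
          proof
            assume "k = i"
            then have "u = v" using k(3) iw uw by auto
            then show False using vj ju by auto
          qed
          have third': "l = j \<or> l = k" if "l \<in> I" "u \<in> {a l, b l}" for l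
            using deg[of j k l u] j(1) k that ju by auto
          \<comment> \<open>Two double items favour their common cell and the third item seals the
            block off: cost 4 against weight 6, or 3 against 5 if \<open>k\<close> is
            simple.\<close>
          define st' where "st' = (\<lambda>x. if x = k then Full else Fav w)"
          have cond: "st' n = Full" if "n \<in> {i,j,k}" "l \<in> I - {i,j,k}" "x \<in> {a n, b n}" "x \<in> {a l, b l}" for n l x
          proof (cases "n = k")
            case False
            then have "x \<in> {v,w,u}" using that iw ju by auto
            then show ?thesis using that leaf[of l] third[of l] third'[of l] by auto
          qed (simp add: st'_def)
          have xw: "x = w" if "x \<in> {a i, b i}" "x \<in> {a j, b j}" for x using that iw vj by auto
          have wij: "w \<in> {a i, b i}" "w \<in> {a j, b j}" using iw ju by auto
          have S: "st' k = Full" "\<And>x. x \<noteq> k \<Longrightarrow> st' x = Fav w" unfolding st'_def by auto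
          have adm: "admissible a b dbl {i,j,k} st'"
            unfolding admissible_def
          proof (intro conjI ballI allI impI)
            fix x assume x: "x \<in> {i,j,k}"
            show "\<not> dbl x" if "st' x = Skip" using that S by (cases "x = k") auto
            show "dbl x" if "st' x = Fav z" for z using that S dd x by (cases "x = k") auto
            show "z \<in> {a x, b x}" if "st' x = Fav z" for z
            proof -
              have "x = i \<or> x = j" "z = w" using that S x by (cases "x = k"; auto)+
              then show ?thesis using wij by blast
            qed
          next
            fix x y z assume h: "x \<in> {i,j,k}" "y \<in> {i,j,k}" "x \<noteq> y" "z \<in> {a x, b x}" "z \<in> {a y, b y}"
            show "st' x = Full \<or> st' y = Full \<or> st' x = Fav z \<and> st' y = Fav z"
            proof (cases "x = k \<or> y = k")
              case False
              then have "(x = i \<and> y = j) \<or> (x = j \<and> y = i)" using h(1-3) by blast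
              then have "z = w" using xw h(4,5) by blast
              then show ?thesis using S False by blast
            qed (use S in blast)
          qed
          show ?thesis
            proof (rule ext[of "{i,j,k}" st', OF _ _ adm])
            show "st' n = Full" if "n \<in> {i,j,k}" "l \<in> I - {i,j,k}" "x \<in> {a n, b n}" "x \<in> {a l, b l}" for n l x
              by (rule cond[OF that])
          qed (use i j k ki dd in \<open>auto simp: st'_def\<close>)
        qed
      qed
    qed
  qed
qed

section \<open>Attraction through a door\<close>

definition attracts_within :: "pt set \<Rightarrow> pt \<Rightarrow> pt \<Rightarrow> pt set \<Rightarrow> bool" where
  "attracts_within P q p S \<longleftrightarrow> (\<exists>xs. attraction_seq P q p xs \<and> path_points xs \<subseteq> S)"

lemma attracts_within_refl: "q \<in> S \<Longrightarrow> attracts_within P q q S"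
  unfolding attracts_within_def attraction_seq_def path_points_def by (intro exI[of _ "[q]"]) auto

lemma attracts_within_step:
  assumes "attraction_step P q a b" "closed_segment a b \<subseteq> S" "attracts_within P q b S"
  shows "attracts_within P q a S"
proof -
  obtain xs where xs: "attraction_seq P q b xs" "path_points xs \<subseteq> S"
    using assms(3) attracts_within_def by blast
  then have ne: "xs \<noteq> []" "xs ! 0 = b" by (auto simp: attraction_seq_def hd_conv_nth)
  have "attraction_seq P q a (a # xs)"
    using xs(1) assms(1) ne unfolding attraction_seq_def
    by (auto simp: nth_Cons split: nat.split)
  moreover have "path_points (a # xs) \<subseteq> S"
  proof
    fix z assume "z \<in> path_points (a # xs)"
    then consider "z = a" | "z \<in> set xs" | i where "Suc i < length (a # xs)" "z \<in> closed_segment ((a # xs) ! i) ((a # xs) ! Suc i)"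
      unfolding path_points_def by auto
    then show "z \<in> S"
    proof cases
      case 1 then show ?thesis using assms(2) by auto
    next
      case 2 then show ?thesis using xs(2) path_points_def by auto
    next
      case (3 i)
      show ?thesis
      proof (cases i)
        case 0
        then show ?thesis using 3 ne assms(2) by auto
      next
        case (Suc j)
        then have "z \<in> path_points xs" using 3 unfolding path_points_def by auto
        then show ?thesis using xs(2) by auto
      qed
    qed
  qed
  ultimately show ?thesis unfolding attracts_within_def by blast
qed

text \<open>Lets a straight motion be interrupted at the point where it meets a wall or passes from
  one box to the next; the degenerate case of no motion is included.\<close>

lemma attracts_within_straight_then:
  assumes h: "h \<in> closed_segment p q" and "closed_segment p h \<subseteq> P" "closed_segment p h \<subseteq> S"
    and "attracts_within P q h S"
  shows "attracts_within P q p S"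
proof (cases "h = p")
  case False
  obtain s where s: "0 \<le> s" "s \<le> 1" "h = (1 - s) *\<^sub>R p + s *\<^sub>R q"
    using h by (auto simp: in_segment)
  then have "h = p + s *\<^sub>R (q - p)" by (simp add: algebra_simps)
  moreover from this have "0 < s" using s False by (cases "s = 0") auto
  ultimately have "attraction_step P q p h"
    unfolding attraction_step_def using assms(2) False s(2) by blast
  then show ?thesis using attracts_within_step assms(3,4) by blast
qed (use assms in auto)

lemma attracts_within_straight:
  assumes "closed_segment p q \<subseteq> P" "closed_segment p q \<subseteq> S"
  shows "attracts_within P q p S"
  using attracts_within_straight_then[of q p q P S] assms attracts_within_refl[of q S P] ends_in_segment(2)[of p q] by blast

text \<open>Here \<open>d\<close> is the direction of the slide and \<open>n\<close> the normal
  pointing out of the polygon. Since the target lies on the \<open>n\<close> side,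
  \<open>wall\<close> rules out the straight move and the direction \<open>n\<close> alike, which
  makes \<open>d\<close> the only admissible direction. The endpoint \<open>v\<close> is exempt,
  because there the wall may end at a reflex vertex.\<close>

lemma attracts_within_slide:
  assumes cl: "closed P"
    and dn: "d \<in> {(1,0), (-1,0), (0,1), (0,-1)}" "n \<in> {(1,0), (-1,0), (0,1), (0,-1)}" "inner d n = 0"
    and v: "v = h + t *\<^sub>R d" "0 \<le> t"
    and fr: "closed_segment h v \<subseteq> frontier P"
    and wall: "\<And>x. x \<in> closed_segment h v \<Longrightarrow> x \<noteq> v \<Longrightarrow>
          \<exists>\<epsilon>>0. \<forall>z. dist x z < \<epsilon> \<longrightarrow> 0 < inner n (z - x) \<longrightarrow> z \<notin> P"
    and q: "0 < inner n (q - h)" "0 \<le> inner d (q - v)"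
    and S: "closed_segment h v \<subseteq> S" "attracts_within P q v S"
  shows "attracts_within P q h S"
proof (cases "h = v")
  case False
  have t: "0 < t" using v False by (cases "t = 0") auto
  have dd: "inner d d = 1" using dn(1) by auto
  have pt: "\<exists>u. 0 \<le> u \<and> u < t \<and> x = h + u *\<^sub>R d" if xh: "x \<in> closed_segment h v" "x \<noteq> v" for x
  proof -
    obtain s where s: "0 \<le> s" "s \<le> 1" "x = (1 - s) *\<^sub>R h + s *\<^sub>R v"
      using xh(1) unfolding in_segment by blast
    then have "x = h + (s * t) *\<^sub>R d" using v by (simp add: algebra_simps)
    moreover have "s < 1" using s that(2) by (cases "s = 1") auto
    ultimately show ?thesis using s t by (intro exI[of _ "s * t"]) auto
  qed
  have "attraction_step P q h v"
    unfolding attraction_step_def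
  proof (intro conjI disjI2 exI[of _ d] exI[of _ t] ballI allI impI)
    show "h \<noteq> v" "0 < t" "v = h + t *\<^sub>R d" "closed_segment h v \<subseteq> frontier P" using False t v fr by auto
  next
    fix x assume "x \<in> closed_segment h v - {v}"
    then have x: "x \<in> closed_segment h v" "x \<noteq> v" by auto
    then obtain u where u: "0 \<le> u" "u < t" "x = h + u *\<^sub>R d" using pt by blast
    obtain \<epsilon> where eps: "\<epsilon> > 0" "\<And>z. dist x z < \<epsilon> \<Longrightarrow> 0 < inner n (z - x) \<Longrightarrow> z \<notin> P"
      using wall[OF x] by blast
    have nd: "inner n d = 0" using dn(3) by (simp add: inner_commute)
    have nq: "0 < inner n (q - x)"
      using q(1) nd unfolding u(3) by (simp add: inner_diff_right inner_add_right)
    have "inner d (q - x) = inner d (q - v) + (t - u)"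
      unfolding u(3) v(1) using dd by (simp add: inner_diff_right inner_add_right algebra_simps)
    then have dq: "0 < inner d (q - x)" using q(2) u by simp
    show "\<not> can_go_straight P q x"
    proof
      assume "can_go_straight P q x"
      then obtain e where e: "e > 0" "closed_segment x (x + e *\<^sub>R (q - x)) \<subseteq> P"
        unfolding can_go_straight_def by blast
      have qx: "norm (q - x) > 0" using nq by auto
      \<comment> \<open>Shortens the alleged straight move until its endpoint is within \<epsilon>
        of \<open>x\<close> and hence subject to \<open>wall\<close>.\<close>
      define g where "g = min 1 (\<epsilon> / (2 * e * norm (q - x)))"
      have g: "0 < g" "g \<le> 1" using e(1) eps(1) qx unfolding g_def by auto
      define z where "z = x + (g * e) *\<^sub>R (q - x)"
      have "z = (1 - g) *\<^sub>R x + g *\<^sub>R (x + e *\<^sub>R (q - x))" unfolding z_def by (simp add: algebra_simps)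
      then have "z \<in> closed_segment x (x + e *\<^sub>R (q - x))" unfolding in_segment using g by (intro exI[of _ g]) simp
      then have "z \<in> P" using e by auto
      have "g * (e * norm (q - x)) \<le> \<epsilon> / (2 * e * norm (q - x)) * (e * norm (q - x))"
        unfolding g_def using e(1) qx by (intro mult_right_mono) auto
      also have "\<dots> = \<epsilon> / 2" using e(1) qx by (simp add: field_simps)
      finally have "dist x z < \<epsilon>" unfolding z_def dist_norm using e(1) g eps(1)
        by (simp add: abs_mult mult.assoc)
      moreover have "0 < inner n (z - x)" unfolding z_def using g e nq by simp
      ultimately show False using eps(2) \<open>z \<in> P\<close> by blast
    qed
    show "slide_dir P q x d"
      unfolding slide_dir_def
    proof (intro conjI exI[of _ "t - u"])
      have "x + (t - u) *\<^sub>R d = v" unfolding u(3) v(1) by (simp add: algebra_simps)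
      then show "closed_segment x (x + (t - u) *\<^sub>R d) \<subseteq> frontier P"
        using fr x(1) by (metis closed_segment_subset convex_closed_segment ends_in_segment(2) subset_trans)
    qed (use dn dq u in auto)
    fix d' assume d': "slide_dir P q x d'"
    then have i: "inner d' (q - x) > 0" and "d' \<in> {(1,0), (-1,0), (0,1), (0,-1)}" unfolding slide_dir_def by auto
    \<comment> \<open>Both negatives increase the distance to \<open>q\<close>, so only
      \<open>n\<close> remains to be excluded.\<close>
    then have "d' = d \<or> d' = - d \<or> d' = n \<or> d' = - n" using dn by (auto simp: inner_prod_def)
    moreover have "d' \<noteq> - d" "d' \<noteq> - n" using i dq nq by auto
    moreover have "d' \<noteq> n"
    proof
      assume "d' = n"
      then obtain e where e: "e > 0" "closed_segment x (x + e *\<^sub>R n) \<subseteq> frontier P" using d' slide_dir_def by auto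
      have nn: "norm n = 1" "inner n n = 1" using dn(2) by auto
      define g where "g = min 1 (\<epsilon> / (2 * e))"
      have g: "0 < g" "g \<le> 1" using e(1) eps(1) unfolding g_def by auto
      define z where "z = x + (g * e) *\<^sub>R n"
      have "z = (1 - g) *\<^sub>R x + g *\<^sub>R (x + e *\<^sub>R n)" unfolding z_def by (simp add: algebra_simps)
      then have "z \<in> closed_segment x (x + e *\<^sub>R n)" unfolding in_segment using g by (intro exI[of _ g]) simp
      then have "z \<in> P" using e cl frontier_subset_closed by blast
      have "g * e \<le> \<epsilon> / (2 * e) * e" unfolding g_def using e(1) by (intro mult_right_mono) auto
      then have "dist x z < \<epsilon>" unfolding z_def dist_norm using e(1) g eps(1) nn by (simp add: abs_mult)
      moreover have "0 < inner n (z - x)" unfolding z_def using g e nn by simp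
      ultimately show False using eps(2) \<open>z \<in> P\<close> by blast
    qed
    ultimately show "d' = d" by blast
  qed
  then show ?thesis using attracts_within_step S by blast
qed (use S in auto)

lemma convex_comb_bounds:
  fixes A B L M :: real
  assumes "0 \<le> t" "t \<le> 1"
  shows "A \<le> M \<Longrightarrow> B \<le> M \<Longrightarrow> (1 - t) * A + t * B \<le> M" "L \<le> A \<Longrightarrow> L \<le> B \<Longrightarrow> L \<le> (1 - t) * A + t * B"
  using assms convex_bound_le[of A M B "1 - t" t] convex_bound_le[of "-A" "-L" "-B" "1 - t" t]
  by (auto simp: algebra_simps)

text \<open>The signs \<open>s\<close> and \<open>r\<close> reflect the axes, so that one argument
  serves all four orientations of a reflex vertex \<open>v\<close>.\<close>

definition box_at :: "pt \<Rightarrow> real \<Rightarrow> real \<Rightarrow> real \<Rightarrow> real \<Rightarrow> real \<Rightarrow> real \<Rightarrow> pt set" where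
  "box_at v s r u1 u2 w1 w2 =
     {z. u1 \<le> s * (fst z - fst v) \<and> s * (fst z - fst v) \<le> u2 \<and>
         w1 \<le> r * (snd z - snd v) \<and> r * (snd z - snd v) \<le> w2}"

lemma closed_segment_subset_box_at:
  assumes "p \<in> box_at v s r u1 u2 w1 w2" "q \<in> box_at v s r u1 u2 w1 w2"
  shows "closed_segment p q \<subseteq> box_at v s r u1 u2 w1 w2"
proof
  fix z assume "z \<in> closed_segment p q"
  then obtain t where t: "0 \<le> t" "t \<le> 1" "z = (1 - t) *\<^sub>R p + t *\<^sub>R q" by (auto simp: in_segment)
  have 1: "s * (fst z - fst v) = (1 - t) * (s * (fst p - fst v)) + t * (s * (fst q - fst v))"
    unfolding t(3) by (simp add: algebra_simps)
  have 2: "r * (snd z - snd v) = (1 - t) * (r * (snd p - snd v)) + t * (r * (snd q - snd v))"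
    unfolding t(3) by (simp add: algebra_simps)
  show "z \<in> box_at v s r u1 u2 w1 w2"
    using assms unfolding box_at_def mem_Collect_eq 1 2
    by (auto intro!: convex_comb_bounds[OF t(1,2)])
qed

lemma segment_crosses:
  fixes p q :: pt and f :: "pt \<Rightarrow> real"
  assumes f: "\<And>t. f ((1 - t) *\<^sub>R p + t *\<^sub>R q) = (1 - t) * f p + t * f q"
    and "f p \<le> 0" "0 \<le> f q"
  shows "\<exists>h\<in>closed_segment p q. f h = 0"
proof (cases "f p = 0")
  case True then show ?thesis by (intro bexI[of _ p]) auto
next
  case False
  define t where "t = - f p / (f q - f p)"
  have "0 \<le> t" "t \<le> 1" using assms(2,3) False unfolding t_def by (auto simp: field_simps)
  moreover have "(1 - t) * f p + t * f q = 0" using assms(2,3) False unfolding t_def by (simp add: field_simps)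
  ultimately show ?thesis using f[of t] by (intro bexI[of _ "(1 - t) *\<^sub>R p + t *\<^sub>R q"]) (auto simp: in_segment)
qed

lemma segment_const:
  fixes x p q :: "real \<times> real"
  assumes "x \<in> closed_segment p q"
  shows "fst p = c \<Longrightarrow> fst q = c \<Longrightarrow> fst x = c" "snd p = c \<Longrightarrow> snd q = c \<Longrightarrow> snd x = c"
proof -
  obtain t where t: "x = (1 - t) *\<^sub>R p + t *\<^sub>R q" using assms unfolding in_segment by blast
  show "fst p = c \<Longrightarrow> fst q = c \<Longrightarrow> fst x = c" "snd p = c \<Longrightarrow> snd q = c \<Longrightarrow> snd x = c"
    unfolding t by (simp_all add: algebra_simps)
qed

lemma segment_coordinate_between:
  assumes "h \<in> closed_segment p q" "r \<in> {1, -1::real}"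
  shows "L \<le> r * (fst p - c) \<Longrightarrow> L \<le> r * (fst q - c) \<Longrightarrow> L \<le> r * (fst h - c)"
    "r * (fst p - c) \<le> M \<Longrightarrow> r * (fst q - c) \<le> M \<Longrightarrow> r * (fst h - c) \<le> M"
    "L \<le> r * (snd p - c) \<Longrightarrow> L \<le> r * (snd q - c) \<Longrightarrow> L \<le> r * (snd h - c)"
    "r * (snd p - c) \<le> M \<Longrightarrow> r * (snd q - c) \<le> M \<Longrightarrow> r * (snd h - c) \<le> M"
proof -
  obtain t where t: "0 \<le> t" "t \<le> 1" "h = (1 - t) *\<^sub>R p + t *\<^sub>R q" using assms by (auto simp: in_segment)
  have 1: "r * (fst h - c) = (1 - t) * (r * (fst p - c)) + t * (r * (fst q - c))"
    unfolding t(3) by (simp add: algebra_simps)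
  have 2: "r * (snd h - c) = (1 - t) * (r * (snd p - c)) + t * (r * (snd q - c))"
    unfolding t(3) by (simp add: algebra_simps)
  show "L \<le> r * (fst p - c) \<Longrightarrow> L \<le> r * (fst q - c) \<Longrightarrow> L \<le> r * (fst h - c)"
    "r * (fst p - c) \<le> M \<Longrightarrow> r * (fst q - c) \<le> M \<Longrightarrow> r * (fst h - c) \<le> M"
    "L \<le> r * (snd p - c) \<Longrightarrow> L \<le> r * (snd q - c) \<Longrightarrow> L \<le> r * (snd h - c)"
    "r * (snd p - c) \<le> M \<Longrightarrow> r * (snd q - c) \<le> M \<Longrightarrow> r * (snd h - c) \<le> M"
    unfolding 1 2 by (auto intro!: convex_comb_bounds[OF t(1,2)])
qed

text \<open>In the coordinates \<open>u = s (x - v\<^sub>x)\<close>, \<open>w = r (y - v\<^sub>y)\<close> the base box lies in \<open>u \<ge> 0\<close>, the narrow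
  box in \<open>u \<le> 0, w \<ge> 0\<close>, and the door between them is \<open>u = 0, 0 \<le> w \<le> wt\<close>.\<close>

lemma narrow_to_base:
  assumes sr: "s \<in> {1, -1::real}" "r \<in> {1, -1::real}"
    and cl: "closed P"
    and W: "box_at v s r 0 u2 w1 wt \<subseteq> P" and N: "box_at v s r u1 0 0 wt \<subseteq> P"
    and sz: "u1 \<le> 0" "0 \<le> u2" "w1 \<le> 0" "0 \<le> wt"
    and p: "p \<in> box_at v s r u1 0 0 wt" and q: "q \<in> box_at v s r 0 u2 w1 wt"
    and fr: "\<And>x. snd x = snd v \<Longrightarrow> s * (fst p - fst v) \<le> s * (fst x - fst v) \<Longrightarrow> s * (fst x - fst v) \<le> 0 \<Longrightarrow>
       x \<in> frontier P"
    and wall: "\<And>x. snd x = snd v \<Longrightarrow> s * (fst p - fst v) \<le> s * (fst x - fst v) \<Longrightarrow> s * (fst x - fst v) < 0 \<Longrightarrow>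
       x = p \<or> s * (fst p - fst v) < s * (fst x - fst v) \<Longrightarrow>
       \<exists>\<epsilon>>0. \<forall>z. dist x z < \<epsilon> \<longrightarrow> 0 < - r * (snd z - snd x) \<longrightarrow> z \<notin> P"
  shows "attracts_within P q p (box_at v s r 0 u2 w1 wt \<union> box_at v s r u1 0 0 wt)"
    (is "attracts_within P q p (?W \<union> ?N)")
proof (cases "fst p = fst v")
  case True
  then have "p \<in> ?W" using p sz by (auto simp: box_at_def)
  then have "closed_segment p q \<subseteq> ?W" using q by (rule closed_segment_subset_box_at)
  then show ?thesis using W by (intro attracts_within_straight) auto
next
  case pne: False
  have pu: "s * (fst p - fst v) < 0" and qu: "0 \<le> s * (fst q - fst v)"
    and pw: "0 \<le> r * (snd p - snd v)" "r * (snd p - snd v) \<le> wt"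
    and qw: "w1 \<le> r * (snd q - snd v)" "r * (snd q - snd v) \<le> wt"
    and pu1: "u1 \<le> s * (fst p - fst v)"
    using p q pne sr by (auto simp: box_at_def)
  obtain h where h: "h \<in> closed_segment p q" "s * (fst h - fst v) = 0"
    using segment_crosses[of "\<lambda>z. s * (fst z - fst v)" p q] pu qu by (auto simp: algebra_simps)
  have hw: "w1 \<le> r * (snd h - snd v)" "r * (snd h - snd v) \<le> wt"
    using segment_coordinate_between(3)[OF h(1) sr(2), of w1 "snd v"]
      segment_coordinate_between(4)[OF h(1) sr(2), of "snd v" wt] pw qw sz by linarith+
  have hW: "h \<in> ?W" using h hw sz by (auto simp: box_at_def)
  have vW: "v \<in> ?W" "v \<in> ?N" using sz by (auto simp: box_at_def)
  show ?thesis
  proof (cases "0 \<le> r * (snd h - snd v)")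
    case True
    then have hN: "h \<in> ?N" using h hw sz by (auto simp: box_at_def)
    have 1: "closed_segment p h \<subseteq> ?N" by (rule closed_segment_subset_box_at[OF p hN])
    have 2: "closed_segment h q \<subseteq> ?W" by (rule closed_segment_subset_box_at[OF hW q])
    have "attracts_within P q h (?W \<union> ?N)" using 2 W by (intro attracts_within_straight) auto
    then show ?thesis by (intro attracts_within_straight_then[OF h(1)]) (use 1 N in auto)
  next
    case False
    \<comment> \<open>The line to \<open>q\<close> misses the door and first meets the floor of the
      narrow box at \<open>k\<close>; from there the robot slides to \<open>v\<close>.\<close>
    obtain k where k: "k \<in> closed_segment p h" "- (r * (snd k - snd v)) = 0"
      using segment_crosses[of "\<lambda>z. - (r * (snd z - snd v))" p h] pw False by (auto simp: algebra_simps)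
    have kv: "snd k = snd v" using k sr by auto
    have ku: "s * (fst p - fst v) \<le> s * (fst k - fst v)" "s * (fst k - fst v) \<le> 0"
      using segment_coordinate_between(1)[OF k(1) sr(1), of "s * (fst p - fst v)" "fst v"]
       segment_coordinate_between(2)[OF k(1) sr(1), of "fst v" 0] h(2) pu by auto
    have kq: "k \<in> closed_segment p q"
      using k(1) subset_closed_segment[of p h p q] h(1) by auto
    have qneg: "r * (snd q - snd v) < 0"
      using segment_coordinate_between(3)[OF h(1) sr(2), of 0 "snd v"] pw False by linarith
    have kN: "k \<in> ?N" using kv ku pu1 sz by (auto simp: box_at_def)
    have 1: "closed_segment p k \<subseteq> ?N" by (rule closed_segment_subset_box_at[OF p kN])
    have 2: "closed_segment v q \<subseteq> ?W" by (rule closed_segment_subset_box_at[OF vW(1) q])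
    have 3: "closed_segment k v \<subseteq> ?N" by (rule closed_segment_subset_box_at[OF kN vW(2)])
    \<comment> \<open>\<open>wall\<close> is granted at \<open>p\<close> itself and strictly closer
      to \<open>v\<close>. A floor point with the abscissa of \<open>p\<close> must therefore be
      \<open>p\<close>, which holds because the segment from \<open>p\<close> to \<open>h\<close> is
      not vertical.\<close>
    have pk: "p = k" if "s * (fst p - fst v) = s * (fst k - fst v)"
    proof -
      obtain t where t: "0 \<le> t" "t \<le> 1" "k = (1 - t) *\<^sub>R p + t *\<^sub>R h" using k(1) by (auto simp: in_segment)
      define A where "A = s * (fst p - fst v)"
      have "s * (fst k - fst v) = (1 - t) * A + t * (s * (fst h - fst v))"
        unfolding t(3) A_def by (simp add: algebra_simps)
      then have "A = (1 - t) * A" using that h(2) unfolding A_def by (metis add.right_neutral mult_zero_right)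
      then have "t * A = 0" by (simp add: algebra_simps)
      then have "t = 0" using pu A_def by auto
      then show ?thesis using t by simp
    qed
    have vq: "attracts_within P q v (?W \<union> ?N)" using 2 W by (intro attracts_within_straight) auto
    have "attracts_within P q k (?W \<union> ?N)"
    proof (rule attracts_within_slide[where d="(s,0)" and n="(0,-r)" and t="- (s * (fst k - fst v))", OF cl _ _ _ _ _ _ _ _ _ _ vq])
      show "v = k + (- (s * (fst k - fst v))) *\<^sub>R (s, 0)" using sr kv by (auto simp: prod_eq_iff)
      show "closed_segment k v \<subseteq> frontier P"
      proof
        fix x assume x: "x \<in> closed_segment k v"
        have "snd x = snd v" by (rule segment_const(2)[OF x kv refl])
        moreover have "s * (fst p - fst v) \<le> s * (fst x - fst v)" "s * (fst x - fst v) \<le> 0"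
          using segment_coordinate_between(1)[OF x sr(1), of _ "fst v"]
          segment_coordinate_between(2)[OF x sr(1), of "fst v" 0] ku by auto
        ultimately show "x \<in> frontier P" using fr by blast
      qed
      fix x assume x: "x \<in> closed_segment k v" "x \<noteq> v"
      have xs: "snd x = snd v" by (rule segment_const(2)[OF x(1) kv refl])
      have xu: "s * (fst k - fst v) \<le> s * (fst x - fst v)" "s * (fst x - fst v) \<le> 0"
        using segment_coordinate_between(1)[OF x(1) sr(1), of _ "fst v"]
          segment_coordinate_between(2)[OF x(1) sr(1), of "fst v" 0] ku by auto
      have "s * (fst x - fst v) \<noteq> 0" using x(2) xs sr by (auto simp: prod_eq_iff)
      moreover have "x = p \<or> s * (fst p - fst v) < s * (fst x - fst v)"
      proof (cases "s * (fst p - fst v) < s * (fst k - fst v)")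
        case False
        then have "p = k" using pk ku by linarith
        then show ?thesis using xu xs kv sr by (auto simp: prod_eq_iff)
      qed (use xu in auto)
      moreover have "s * (fst p - fst v) \<le> s * (fst x - fst v)" using xu(1) ku(1) by linarith
      ultimately have "\<exists>\<epsilon>>0. \<forall>z. dist x z < \<epsilon> \<longrightarrow> 0 < - r * (snd z - snd x) \<longrightarrow> z \<notin> P"
        using xu(2) by (intro wall[OF xs]) linarith+
      then show "\<exists>\<epsilon>>0. \<forall>z. dist x z < \<epsilon> \<longrightarrow> 0 < inner (0,-r) (z - x) \<longrightarrow> z \<notin> P" by (simp add: inner_prod_def)
    next
      show "closed_segment k v \<subseteq> ?W \<union> ?N" using 3 by auto
    qed (use sr ku qu qneg kv in \<open>auto simp: inner_prod_def\<close>)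
    then show ?thesis by (intro attracts_within_straight_then[OF kq]) (use 1 N in auto)
  qed
qed

text \<open>Now the wall is the vertical edge next to the door: the line to \<open>q\<close> crosses
  the door or hits the wall at \<open>h\<close>, and then the robot slides up to \<open>v\<close>.
  The conditions \<open>fr\<close> and \<open>wall\<close> are asked only between an actual hitting
  point and \<open>v\<close>, since the side of the base box may extend beyond the other end of the
  wall.\<close>

lemma base_to_narrow:
  assumes sr: "s \<in> {1, -1::real}" "r \<in> {1, -1::real}"
    and cl: "closed P"
    and W: "box_at v s r 0 u2 w1 wt \<subseteq> P" and N: "box_at v s r u1 0 0 wt \<subseteq> P"
    and sz: "u1 \<le> 0" "0 \<le> u2" "w1 \<le> 0" "0 \<le> wt"
    and p: "p \<in> box_at v s r 0 u2 w1 wt" and q: "q \<in> box_at v s r u1 0 0 wt"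
    and fr: "\<And>h x. h \<in> closed_segment p q \<Longrightarrow> fst h = fst v \<Longrightarrow> w1 \<le> r * (snd h - snd v) \<Longrightarrow>
       fst x = fst v \<Longrightarrow> r * (snd h - snd v) \<le> r * (snd x - snd v) \<Longrightarrow> r * (snd x - snd v) \<le> 0 \<Longrightarrow> x \<in> frontier P"
    and wall: "\<And>h x. h \<in> closed_segment p q \<Longrightarrow> fst h = fst v \<Longrightarrow> w1 \<le> r * (snd h - snd v) \<Longrightarrow>
       fst x = fst v \<Longrightarrow> r * (snd h - snd v) \<le> r * (snd x - snd v) \<Longrightarrow> r * (snd x - snd v) < 0 \<Longrightarrow>
       \<exists>\<epsilon>>0. \<forall>z. dist x z < \<epsilon> \<longrightarrow> 0 < - s * (fst z - fst x) \<longrightarrow> z \<notin> P"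
  shows "attracts_within P q p (box_at v s r 0 u2 w1 wt \<union> box_at v s r u1 0 0 wt)"
    (is "attracts_within P q p (?W \<union> ?N)")
proof (cases "fst q = fst v")
  case True
  then have "q \<in> ?W" using q sz by (auto simp: box_at_def)
  then have "closed_segment p q \<subseteq> ?W" by (rule closed_segment_subset_box_at[OF p])
  then show ?thesis using W by (intro attracts_within_straight) auto
next
  case qne: False
  have pu: "0 \<le> s * (fst p - fst v)" and qu: "s * (fst q - fst v) < 0"
    and pw: "w1 \<le> r * (snd p - snd v)" "r * (snd p - snd v) \<le> wt"
    and qw: "0 \<le> r * (snd q - snd v)" "r * (snd q - snd v) \<le> wt"
    using p q qne sr by (auto simp: box_at_def)
  obtain h where h: "h \<in> closed_segment p q" "- (s * (fst h - fst v)) = 0"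
    using segment_crosses[of "\<lambda>z. - (s * (fst z - fst v))" p q] pu qu by (auto simp: algebra_simps)
  have hv: "fst h = fst v" using h sr by auto
  have hw: "w1 \<le> r * (snd h - snd v)" "r * (snd h - snd v) \<le> wt"
    using segment_coordinate_between(3)[OF h(1) sr(2), of w1 "snd v"]
      segment_coordinate_between(4)[OF h(1) sr(2), of "snd v" wt] pw qw sz by linarith+
  have hW: "h \<in> ?W" using h hw sz by (auto simp: box_at_def)
  have vW: "v \<in> ?W" "v \<in> ?N" using sz by (auto simp: box_at_def)
  have 1: "closed_segment p h \<subseteq> ?W" by (rule closed_segment_subset_box_at[OF p hW])
  have "attracts_within P q h (?W \<union> ?N)"
  proof (cases "0 \<le> r * (snd h - snd v)")
    case True
    then have hN: "h \<in> ?N" using h hw sz by (auto simp: box_at_def)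
    have 2: "closed_segment h q \<subseteq> ?N" by (rule closed_segment_subset_box_at[OF hN q])
    then show ?thesis using N by (intro attracts_within_straight) auto
  next
    case False
    have 2: "closed_segment v q \<subseteq> ?N" by (rule closed_segment_subset_box_at[OF vW(2) q])
    have 3: "closed_segment h v \<subseteq> ?W" by (rule closed_segment_subset_box_at[OF hW vW(1)])
    have vq: "attracts_within P q v (?W \<union> ?N)" using 2 N by (intro attracts_within_straight) auto
    have ww: "\<exists>\<epsilon>>0. \<forall>z. dist x z < \<epsilon> \<longrightarrow> 0 < - s * (fst z - fst x) \<longrightarrow> z \<notin> P"
      if x: "x \<in> closed_segment h v" "x \<noteq> v" for x
    proof -
      have xs: "fst x = fst v" by (rule segment_const(1)[OF x(1) hv refl])
      have xu: "r * (snd h - snd v) \<le> r * (snd x - snd v)" "r * (snd x - snd v) \<le> 0"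
        using segment_coordinate_between(3)[OF x(1) sr(2), of _ "snd v"]
          segment_coordinate_between(4)[OF x(1) sr(2), of "snd v" 0] False by auto
      have "r * (snd x - snd v) \<noteq> 0" using x(2) xs sr by (auto simp: prod_eq_iff)
      then show ?thesis using wall[OF h(1) hv hw(1) xs xu(1)] xu(2) by (metis order_less_le)
    qed
    have notint: "closed_segment h v \<subseteq> frontier P"
    proof
      fix x assume x: "x \<in> closed_segment h v"
      have "fst x = fst v" by (rule segment_const(1)[OF x hv refl])
      moreover have "r * (snd h - snd v) \<le> r * (snd x - snd v)" "r * (snd x - snd v) \<le> 0"
        using segment_coordinate_between(3)[OF x(1) sr(2), of _ "snd v"]
          segment_coordinate_between(4)[OF x(1) sr(2), of "snd v" 0] False by auto
      ultimately show "x \<in> frontier P" using fr[OF h(1) hv hw(1)] by blast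
    qed
    show ?thesis
    proof (rule attracts_within_slide[where d="(0,r)" and n="(-s,0)" and t="- (r * (snd h - snd v))", OF cl _ _ _ _ _ _ _ _ _ _ vq])
      show "v = h + (- (r * (snd h - snd v))) *\<^sub>R (0, r)" using sr hv by (auto simp: prod_eq_iff)
      show "closed_segment h v \<subseteq> frontier P" by (rule notint)
      show "\<exists>\<epsilon>>0. \<forall>z. dist x z < \<epsilon> \<longrightarrow> 0 < inner (-s,0) (z - x) \<longrightarrow> z \<notin> P"
        if "x \<in> closed_segment h v" "x \<noteq> v" for x
        using ww[OF that] by (simp add: inner_prod_def)
      show "closed_segment h v \<subseteq> ?W \<union> ?N" using 3 by auto
    qed (use sr False qu qw hv in \<open>auto simp: inner_prod_def\<close>)
  qed
  then show ?thesis by (intro attracts_within_straight_then[OF h(1)]) (use 1 W in auto)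
qed

section \<open>The boundary as a Jordan curve\<close>

text \<open>Jordan's theorem concerns curves of complex numbers; this linear isomorphism carries it
  to pairs of reals.\<close>

definition cpx :: "real \<times> real \<Rightarrow> complex" where "cpx z = Complex (fst z) (snd z)"

lemma linear_cpx: "linear cpx"
  unfolding cpx_def by (intro linearI) (auto simp: complex_eq_iff)

lemma inj_cpx: "inj cpx"
  unfolding cpx_def by (auto simp: inj_on_def prod_eq_iff)

lemma surj_cpx: "surj cpx"
  by (rule surjI[of _ "\<lambda>w. (Re w, Im w)"]) (simp add: cpx_def)

lemma continuous_on_cpx: "continuous_on S cpx"
  using linear_cpx linear_continuous_on linear_conv_bounded_linear by blast

lemma cpx_inverse: "(Re (cpx z), Im (cpx z)) = z"
  by (simp add: cpx_def)

text \<open>A linear isomorphism maps components of the complement onto components and preserves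
  their boundedness.\<close>

lemma inside_cpx: "inside (cpx ` S) = cpx ` inside S"
proof -
  let ?g = "\<lambda>w. (Re w, Im w)"
  have cg: "continuous_on T ?g" for T by (intro continuous_intros)
  have compl: "- (cpx ` S) = cpx ` (- S)" using inj_cpx surj_cpx by (metis bij_def bij_image_Compl_eq)
  have comp: "connected_component_set (- (cpx ` S)) (cpx x) = cpx ` connected_component_set (- S) x"
    if x: "x \<notin> S" for x
  proof
    let ?D = "connected_component_set (- (cpx ` S)) (cpx x)" and ?C = "connected_component_set (- S) x"
    have xD: "cpx x \<in> ?D" using x inj_cpx by (simp add: inj_image_mem_iff)
    have "connected (?g ` ?D)" by (rule connected_continuous_image[OF cg]) simp
    moreover have "x \<in> ?g ` ?D" using imageI[OF xD, of ?g] by (simp add: cpx_inverse)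
    moreover have "?g ` ?D \<subseteq> - S"
    proof
      fix y assume "y \<in> ?g ` ?D"
      then obtain w where w: "w \<in> ?D" "y = ?g w" by blast
      then have "w \<in> cpx ` (- S)" using connected_component_subset compl by blast
      then show "y \<in> - S" using w(2) cpx_inverse by auto
    qed
    ultimately have "?g ` ?D \<subseteq> ?C" by (intro connected_component_maximal)
    then show "?D \<subseteq> cpx ` ?C" by (force simp: cpx_def image_iff complex_eq_iff)
    have "connected (cpx ` ?C)" by (rule connected_continuous_image[OF continuous_on_cpx]) simp
    moreover have "cpx ` ?C \<subseteq> - (cpx ` S)" using compl connected_component_subset by blast
    moreover have "cpx x \<in> cpx ` ?C" using x by auto
    ultimately show "cpx ` ?C \<subseteq> ?D" by (intro connected_component_maximal)
  qed
  have bdd: "bounded (cpx ` T) \<longleftrightarrow> bounded T" for T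
  proof
    assume "bounded (cpx ` T)"
    moreover have "bounded_linear ?g" by (intro bounded_linear_Pair bounded_linear_Re bounded_linear_Im)
    ultimately have "bounded (?g ` cpx ` T)" by (rule bounded_linear_image)
    then show "bounded T" by (simp add: image_image cpx_inverse)
  next
    assume "bounded T" then show "bounded (cpx ` T)" using linear_cpx bounded_linear_image linear_conv_bounded_linear by blast
  qed
  show ?thesis
  proof
    show "cpx ` inside S \<subseteq> inside (cpx ` S)"
      unfolding inside_def using comp bdd inj_cpx by (auto dest: injD)
    show "inside (cpx ` S) \<subseteq> cpx ` inside S"
    proof
      fix w assume w: "w \<in> inside (cpx ` S)"
      obtain x where x: "w = cpx x" using surj_cpx by (metis surjD)
      have "x \<notin> S" using w x unfolding inside_def by auto
      then show "w \<in> cpx ` inside S" using w x comp bdd unfolding inside_def by auto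
    qed
  qed
qed

lemma outside_cpx: "outside (cpx ` S) = cpx ` outside S"
proof -
  have "outside (cpx ` S) = - (cpx ` S) - inside (cpx ` S)" unfolding outside_inside by auto
  moreover have "outside S = - (S \<union> inside S)" unfolding outside_inside by auto
  ultimately show ?thesis
    using inside_cpx[of S] bij_image_Compl_eq[of cpx "S \<union> inside S"] inj_cpx surj_cpx
    by (auto simp: bij_def image_Un)
qed

lemma closure_cpx: "closure (cpx ` S) = cpx ` closure S"
  using closure_injective_linear_image[OF linear_cpx inj_cpx] by metis

lemma frontier_cpx: "frontier (cpx ` S) = cpx ` frontier S"
proof -
  have "- (cpx ` S) = cpx ` (- S)" using inj_cpx surj_cpx by (metis bij_def bij_image_Compl_eq)
  then show ?thesis unfolding frontier_closures closure_cpx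
    by (simp add: closure_cpx image_Int[OF inj_cpx])
qed

lemma Jordan_inside_outside_plane:
  fixes g :: "real \<Rightarrow> real \<times> real"
  assumes "simple_path g" "pathfinish g = pathstart g"
  shows "inside (path_image g) \<noteq> {}" "connected (inside (path_image g))" "bounded (inside (path_image g))"
    "frontier (inside (path_image g)) = path_image g" "frontier (outside (path_image g)) = path_image g"
proof -
  let ?c = "cpx \<circ> g"
  have sp: "simple_path ?c" using simple_path_linear_image_eq[OF linear_cpx inj_cpx] assms(1) by metis
  have cl: "pathfinish ?c = pathstart ?c" using assms(2) by (simp add: pathfinish_compose pathstart_compose)
  have im: "path_image ?c = cpx ` path_image g" by (rule path_image_compose)
  note J = Jordan_inside_outside[OF sp cl, unfolded im inside_cpx outside_cpx frontier_cpx]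
  show "inside (path_image g) \<noteq> {}" using J by auto
  have c: "connected (cpx ` inside (path_image g))" and b: "bounded (cpx ` inside (path_image g))" using J by auto
  have "continuous_on (cpx ` inside (path_image g)) (\<lambda>w. (Re w, Im w))" by (intro continuous_intros)
  from connected_continuous_image[OF this c] show "connected (inside (path_image g))"
    by (simp add: image_image cpx_inverse)
  have "bounded_linear (\<lambda>w. (Re w, Im w))" by (intro bounded_linear_Pair bounded_linear_Re bounded_linear_Im)
  from bounded_linear_image[OF b this] show "bounded (inside (path_image g))"
    by (simp add: image_image cpx_inverse)
  show "frontier (inside (path_image g)) = path_image g" "frontier (outside (path_image g)) = path_image g"
    using J inj_cpx by (auto simp: inj_image_eq_iff)
qed

text \<open>The ends of the chord split the curve into two arcs, and each arc closes up with the
  chord to a Jordan curve. The insides of these two curves are the parts; the chord lies on both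
  frontiers, hence in both closures.\<close>

lemma chord_separates:
  fixes g :: "real \<Rightarrow> real \<times> real"
  assumes g: "simple_path g" "pathfinish g = pathstart g"
    and ab: "a \<in> path_image g" "b \<in> path_image g" "a \<noteq> b"
    and seg: "open_segment a b \<subseteq> inside (path_image g)"
  shows "\<exists>A B. open A \<and> open B \<and> A \<inter> B = {} \<and> A \<union> B = inside (path_image g) - open_segment a b \<and>
     open_segment a b \<subseteq> closure A \<and> open_segment a b \<subseteq> closure B"
proof -
  obtain u d where ud: "arc u" "arc d" "pathstart u = a" "pathfinish u = b" "pathstart d = b" "pathfinish d = a"
      "path_image u \<inter> path_image d = {a,b}" "path_image u \<union> path_image d = path_image g"
    using exists_double_arc[OF g ab] by metis
  \<comment> \<open>The theta-curve lemma used below expects all three arcs to run from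
    \<open>a\<close> to \<open>b\<close>.\<close>
  define e where "e = reversepath d"
  have e: "arc e" "pathstart e = a" "pathfinish e = b" "path_image e = path_image d"
    using ud by (auto simp: e_def arc_reversepath)
  let ?s = "closed_segment a b"
  have disj: "inside (path_image g) \<inter> path_image g = {}" by (simp add: inside_no_overlap)
  have oc: "?s = open_segment a b \<union> {a,b}" by (rule closed_segment_eq_open)
  have us: "path_image u \<inter> ?s = {a,b}" and ds: "path_image d \<inter> ?s = {a,b}"
    using seg disj ud ab(3) oc pathstart_in_path_image[of u] pathfinish_in_path_image[of u] by blast+
  have nos: "open_segment a b \<noteq> {}" using ab(3) by simp
  have sep: "inside (cpx ` (path_image u \<union> ?s)) \<inter> inside (cpx ` (path_image d \<union> ?s)) = {} \<and>
     inside (cpx ` (path_image u \<union> ?s)) \<union> inside (cpx ` (path_image d \<union> ?s)) \<union> (cpx ` ?s - {cpx a, cpx b})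
       = inside (cpx ` path_image g)"
  proof -
    have im: "cpx ` (S \<inter> T) = cpx ` S \<inter> cpx ` T" for S T by (rule image_Int[OF inj_cpx])
    have gim: "cpx ` path_image g = cpx ` path_image u \<union> cpx ` path_image d" using ud(8) by blast
    have ss: "path_image (cpx \<circ> linepath a b) = cpx ` ?s" by (simp add: path_image_compose)
    show ?thesis
    proof (rule split_inside_simple_closed_curve[of "cpx \<circ> u" "cpx a" "cpx b" "cpx \<circ> e" "cpx \<circ> linepath a b"])
      show "simple_path (cpx \<circ> u)" "simple_path (cpx \<circ> e)" "simple_path (cpx \<circ> linepath a b)"
        using ud e ab(3) simple_path_linear_image_eq[OF linear_cpx inj_cpx] by (auto simp: arc_imp_simple_path arc_linepath)
      show "cpx a \<noteq> cpx b" using ab(3) inj_cpx by (simp add: inj_eq)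
      show "path_image (cpx \<circ> u) \<inter> path_image (cpx \<circ> e) = {cpx a, cpx b}"
        using ud(7) e(4) im[of "path_image u" "path_image d"] by (simp add: path_image_compose)
      show "path_image (cpx \<circ> u) \<inter> path_image (cpx \<circ> linepath a b) = {cpx a, cpx b}"
        using us im[of "path_image u" ?s] by (simp add: path_image_compose)
      show "path_image (cpx \<circ> e) \<inter> path_image (cpx \<circ> linepath a b) = {cpx a, cpx b}"
        using ds e(4) im[of "path_image d" ?s] by (simp add: path_image_compose)
      have "cpx ` ?s \<inter> cpx ` inside (path_image g) \<noteq> {}" using seg nos oc by blast
      then show "path_image (cpx \<circ> linepath a b) \<inter> inside (path_image (cpx \<circ> u) \<union> path_image (cpx \<circ> e)) \<noteq> {}"
        using ud(8) e(4) by (simp add: path_image_compose inside_cpx flip: image_Un)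
    qed (use ud e gim in \<open>simp_all add: pathstart_compose pathfinish_compose path_image_compose ss image_Un\<close>)
  qed
  let ?A = "inside (path_image u \<union> ?s)" and ?B = "inside (path_image d \<union> ?s)"
  have spu: "simple_path (u +++ linepath b a)"
    using ud ab(3) us by (intro simple_path_join_loop) (auto simp: arc_linepath closed_segment_commute)
  have spd: "simple_path (d +++ linepath a b)"
    using ud ab(3) ds by (intro simple_path_join_loop) (auto simp: arc_linepath)
  have fA: "frontier ?A = path_image u \<union> ?s"
    using Jordan_inside_outside_plane(4)[OF spu] ud by (simp add: path_image_join closed_segment_commute)
  have fB: "frontier ?B = path_image d \<union> ?s"
    using Jordan_inside_outside_plane(4)[OF spd] ud by (simp add: path_image_join)
  have cl: "closed (path_image u \<union> ?s)" "closed (path_image d \<union> ?s)"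
    using ud by (auto simp: closed_arc_image)
  have "cpx ` (?A \<inter> ?B) = {}" using sep unfolding inside_cpx by (simp add: image_Int[OF inj_cpx])
  then have AB: "?A \<inter> ?B = {}" by simp
  have "cpx ` (?A \<union> ?B \<union> open_segment a b) = cpx ` inside (path_image g)"
  proof -
    have "cpx ` ?s - {cpx a, cpx b} = cpx ` open_segment a b"
      unfolding open_segment_def using image_set_diff[OF inj_cpx, of ?s "{a,b}"] by simp
    then show ?thesis using sep unfolding inside_cpx by (simp add: image_Un)
  qed
  then have un: "?A \<union> ?B \<union> open_segment a b = inside (path_image g)"
    using inj_cpx by (simp add: inj_image_eq_iff)
  have "?A \<inter> ?s = {}" "?B \<inter> ?s = {}" using inside_no_overlap by blast+
  then have "?A \<union> ?B = inside (path_image g) - open_segment a b" using un oc by blast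
  moreover have "open_segment a b \<subseteq> closure ?A" "open_segment a b \<subseteq> closure ?B"
    using fA fB oc unfolding frontier_def by blast+
  moreover have "open ?A" "open ?B" using cl by (simp_all add: open_inside)
  ultimately show ?thesis using AB by (metis (no_types, lifting))
qed

text \<open>Edges are appended one by one. A new edge meets the earlier ones only in its first
  vertex; \<open>k < length vs\<close> keeps the closing edge out, whose second end would be the
  starting point.\<close>

lemma polygon_partial_arc:
  assumes op: "orthogonal_polygon vs" and k: "1 \<le> k" "k < length vs"
  shows "\<exists>g. arc g \<and> pathstart g = vs ! 0 \<and> pathfinish g = vs ! k \<and> path_image g = (\<Union>i<k. edge vs i)"
  using k
proof (induction k rule: nat_induct_at_least)
  case base
  have "distinct vs" "0 < length vs" "1 < length vs" using op by (auto simp: orthogonal_polygon_def)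
  then have "vs ! 0 \<noteq> vs ! 1" using nth_eq_iff_index_eq by fastforce
  then show ?case
    using base by (intro exI[of _ "linepath (vs ! 0) (vs ! 1)"]) (auto simp: arc_linepath edge_def lessThan_Suc)
next
  case (Suc k)
  then obtain g where g: "arc g" "pathstart g = vs ! 0" "pathfinish g = vs ! k" "path_image g = (\<Union>i<k. edge vs i)"
    by auto
  have dv: "distinct vs" using op by (auto simp: orthogonal_polygon_def)
  then have ne: "vs ! k \<noteq> vs ! Suc k" using Suc.prems by (simp add: nth_eq_iff_index_eq)
  have ek: "edge vs k = closed_segment (vs ! k) (vs ! Suc k)" using Suc by (simp add: edge_def)
  have int: "path_image g \<inter> closed_segment (vs ! k) (vs ! Suc k) \<subseteq> {vs ! k}"
  proof
    fix z assume "z \<in> path_image g \<inter> closed_segment (vs ! k) (vs ! Suc k)"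
    then obtain i where i: "i < k" "z \<in> edge vs i" "z \<in> edge vs k" using g(4) ek by auto
    have "i < length vs" "k < length vs" "i \<noteq> k" using i(1) Suc.prems by auto
    then have "edge vs i \<inter> edge vs k \<subseteq> {vs ! i, vs ! (Suc i mod length vs)} \<inter> {vs ! k, vs ! (Suc k mod length vs)}"
      using op unfolding orthogonal_polygon_def by blast
    then have "z \<in> {vs ! i, vs ! (Suc i mod length vs)} \<inter> {vs ! k, vs ! (Suc k mod length vs)}"
      using i by blast
    then show "z \<in> {vs ! k}" using i(1) Suc.prems dv
      by (auto simp: nth_eq_iff_index_eq)
  qed
  show ?case
  proof (intro exI[of _ "g +++ linepath (vs ! k) (vs ! Suc k)"] conjI)
    show "arc (g +++ linepath (vs ! k) (vs ! Suc k))"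
      by (rule arc_join) (use g ne int in \<open>auto simp: arc_linepath\<close>)
    show "path_image (g +++ linepath (vs ! k) (vs ! Suc k)) = (\<Union>i<Suc k. edge vs i)"
      using g ek by (auto simp: path_image_join lessThan_Suc)
  qed (use g in auto)
qed

lemma polygon_boundary_simple_path:
  assumes op: "orthogonal_polygon vs"
  shows "\<exists>g. simple_path g \<and> pathfinish g = pathstart g \<and> path_image g = poly_boundary vs"
proof -
  define n where "n = length vs"
  have n: "3 \<le> n" using op by (simp add: n_def orthogonal_polygon_def)
  have n1: "1 \<le> n - 1" "n - 1 < length vs" using n by (auto simp: n_def)
  obtain g where g: "arc g" "pathstart g = vs ! 0" "pathfinish g = vs ! (n - 1)" "path_image g = (\<Union>i<n-1. edge vs i)"
    using polygon_partial_arc[OF op n1] by blast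
  have "distinct vs" using op by (auto simp: orthogonal_polygon_def)
  then have ne: "vs ! (n - 1) \<noteq> vs ! 0" using n n1 nth_eq_iff_index_eq[of vs "n - 1" 0] by (metis le_zero_eq less_nat_zero_code not_gr_zero not_one_le_zero)
  have mod0: "Suc (n - 1) mod n = 0" using n by simp
  have el: "edge vs (n - 1) = closed_segment (vs ! (n - 1)) (vs ! 0)" using mod0 by (simp add: edge_def n_def)
  have int: "path_image g \<inter> closed_segment (vs ! (n - 1)) (vs ! 0) \<subseteq> {vs ! 0, vs ! (n - 1)}"
  proof
    fix z assume "z \<in> path_image g \<inter> closed_segment (vs ! (n - 1)) (vs ! 0)"
    then obtain i where i: "i < n - 1" "z \<in> edge vs i" "z \<in> edge vs (n - 1)" using g(4) el by auto
    have "i < n" "n - 1 < n" "i \<noteq> n - 1" using i n by auto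
    then have "edge vs i \<inter> edge vs (n - 1) \<subseteq> {vs ! i, vs ! (Suc i mod n)} \<inter> {vs ! (n - 1), vs ! (Suc (n - 1) mod n)}"
      using op unfolding orthogonal_polygon_def n_def by blast
    then show "z \<in> {vs ! 0, vs ! (n - 1)}" using i mod0 by auto
  qed
  show ?thesis
  proof (intro exI[of _ "g +++ linepath (vs ! (n - 1)) (vs ! 0)"] conjI)
    show "simple_path (g +++ linepath (vs ! (n - 1)) (vs ! 0))"
      by (rule simple_path_join_loop) (use g ne int in \<open>auto simp: arc_linepath\<close>)
    have "{..<n} = insert (n - 1) {..<n-1}" using n by auto
    then show "path_image (g +++ linepath (vs ! (n - 1)) (vs ! 0)) = poly_boundary vs"
      using g el by (auto simp: path_image_join poly_boundary_def n_def)
  qed (use g in auto)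
qed

section \<open>Local structure of the boundary\<close>

datatype seg = Seg (pos: real) (lo: real) (hi: real)

definition tip :: "seg \<Rightarrow> real \<Rightarrow> real" where
  "tip e r = (if r > 0 then hi e else lo e)"

lemma tip_simps [simp]: "tip e 1 = hi e" "tip e (-1) = lo e" by (simp_all add: tip_def)

text \<open>A vertical edge is \<open>Seg x y\<^sub>1 y\<^sub>2\<close>, a horizontal edge \<open>Seg y x\<^sub>1 x\<^sub>2\<close>, with the interval in increasing order. Signs \<open>\<plusminus>1\<close> stand for right/left and up/down throughout.\<close>

locale rectilinear =
  fixes VE HE :: "seg set" and bd :: "pt set"
  assumes finV: "finite VE" and finH: "finite HE"
    and V_less: "e \<in> VE \<Longrightarrow> lo e < hi e" and H_less: "h \<in> HE \<Longrightarrow> lo h < hi h"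
    and V_unique: "e \<in> VE \<Longrightarrow> f \<in> VE \<Longrightarrow> pos e = pos f \<Longrightarrow> e = f"
    and H_unique: "h \<in> HE \<Longrightarrow> k \<in> HE \<Longrightarrow> pos h = pos k \<Longrightarrow> h = k"
    and VH: "e \<in> VE \<Longrightarrow> y = lo e \<or> y = hi e \<Longrightarrow> \<exists>h\<in>HE. pos h = y \<and> (pos e = lo h \<or> pos e = hi h)"
    and HV: "h \<in> HE \<Longrightarrow> c = lo h \<or> c = hi h \<Longrightarrow> \<exists>e\<in>VE. pos e = c \<and> (pos h = lo e \<or> pos h = hi e)"
    and crossing: "e \<in> VE \<Longrightarrow> h \<in> HE \<Longrightarrow> lo h \<le> pos e \<Longrightarrow> pos e \<le> hi h \<Longrightarrow> lo e \<le> pos h \<Longrightarrow> pos h \<le> hi e \<Longrightarrow>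
       (pos e = lo h \<or> pos e = hi h) \<and> (pos h = lo e \<or> pos h = hi e)"
    and bd_iff: "z \<in> bd \<longleftrightarrow> (\<exists>e\<in>VE. fst z = pos e \<and> lo e \<le> snd z \<and> snd z \<le> hi e) \<or>
                            (\<exists>h\<in>HE. snd z = pos h \<and> lo h \<le> fst z \<and> fst z \<le> hi h)"
    and closed_bd: "closed bd"
    and inn_ne: "inside bd \<noteq> {}" and inn_conn: "connected (inside bd)" and inn_bdd: "bounded (inside bd)"
    and fr_inn: "frontier (inside bd) = bd" and fr_out: "frontier (outside bd) = bd"
    and separates: "a \<in> bd \<Longrightarrow> b \<in> bd \<Longrightarrow> a \<noteq> b \<Longrightarrow> open_segment a b \<subseteq> inside bd \<Longrightarrow>
      \<exists>A B. open A \<and> open B \<and> A \<inter> B = {} \<and> A \<union> B = inside bd - open_segment a b \<and>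
       open_segment a b \<subseteq> closure A \<and> open_segment a b \<subseteq> closure B"
begin

abbreviation "inn \<equiv> inside bd"
abbreviation "out \<equiv> outside bd"

definition P where "P = bd \<union> inn"

lemma open_inn: "open inn" using closed_bd open_inside by blast

lemma inn_bd: "z \<in> inn \<Longrightarrow> z \<notin> bd" using inside_no_overlap[of bd] by blast

lemma out_bd: "z \<in> out \<Longrightarrow> z \<notin> bd" using outside_no_overlap[of bd] by blast

lemma inn_out: "z \<in> inn \<Longrightarrow> z \<notin> out" using inside_Int_outside[of bd] by blast

lemma out_P: "z \<in> out \<Longrightarrow> z \<notin> P" unfolding P_def using inn_out out_bd by blast

lemma closure_inn: "closure inn = P"
  using closure_Un_frontier[of inn] fr_inn P_def by auto

lemma closed_P: "closed P" using closure_inn closed_closure by metis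

text \<open>\<open>P\<close> is the complement of the outside, and every boundary point is a limit
  of outside points.\<close>

lemma interior_P: "interior P = inn"
proof -
  have "P = - out" unfolding P_def using inside_Un_outside[of bd] inside_Int_outside[of bd] outside_no_overlap[of bd] by blast
  then have "interior P = - closure out" by (simp add: interior_complement)
  also have "closure out = out \<union> bd" using closure_Un_frontier[of out] fr_out by simp
  finally show ?thesis using inside_Un_outside[of bd] inside_Int_outside[of bd] inside_no_overlap[of bd] by blast
qed

lemma frontier_P: "frontier P = bd"
  unfolding frontier_def interior_P closure_closed[OF closed_P] using P_def inn_bd by auto

text \<open>The standard way to locate a region: once a connected set avoids the boundary, a single
  point decides its side.\<close>

lemma connected_dichotomy:
  assumes "connected S" "S \<inter> bd = {}"
  shows "S \<subseteq> inn \<or> S \<subseteq> out"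
proof -
  have "S \<subseteq> inn \<union> out" using assms inside_Un_outside[of bd] by blast
  moreover have "open out" using closed_bd open_outside by blast
  ultimately show ?thesis
    using connectedD[OF assms(1) open_inn, of out] inside_Int_outside[of bd] by blast
qed

lemma exists_gap: "\<exists>\<delta>>0. (\<forall>e\<in>VE. \<forall>f\<in>VE. pos e \<noteq> pos f \<longrightarrow> \<delta> \<le> \<bar>pos e - pos f\<bar>) \<and>
     (\<forall>h\<in>HE. \<forall>k\<in>HE. pos h \<noteq> pos k \<longrightarrow> \<delta> \<le> \<bar>pos h - pos k\<bar>)"
proof -
  have fin: "\<exists>\<delta>>0. \<forall>x\<in>A. \<forall>y\<in>A. x \<noteq> y \<longrightarrow> \<delta> \<le> \<bar>x - y\<bar>" if "finite A" for A :: "real set"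
  proof -
    \<comment> \<open>The extra 1 keeps the minimum meaningful when there are fewer than two
      values.\<close>
    define D where "D = insert 1 ((\<lambda>(x,y). \<bar>x - y\<bar>) ` {(x,y) \<in> A \<times> A. x \<noteq> y})"
    have "finite {(x,y) \<in> A \<times> A. x \<noteq> y}" using that by (auto intro: finite_subset[of _ "A \<times> A"])
    then have D: "finite D" "D \<noteq> {}" unfolding D_def by auto
    have pos: "0 < d" if "d \<in> D" for d using that unfolding D_def by auto
    show ?thesis
    proof (intro exI[of _ "Min D"] conjI ballI impI)
      show "0 < Min D" using D pos by (metis Min_in)
      fix x y assume "x \<in> A" "y \<in> A" "x \<noteq> y"
      then have "\<bar>x - y\<bar> \<in> D" unfolding D_def by force
      then show "Min D \<le> \<bar>x - y\<bar>" using D by simp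
    qed
  qed
  obtain d1 where d1: "d1 > 0" "\<forall>x\<in>pos ` VE. \<forall>y\<in>pos ` VE. x \<noteq> y \<longrightarrow> d1 \<le> \<bar>x - y\<bar>"
    using fin[of "pos ` VE"] finV by blast
  obtain d2 where d2: "d2 > 0" "\<forall>x\<in>pos ` HE. \<forall>y\<in>pos ` HE. x \<noteq> y \<longrightarrow> d2 \<le> \<bar>x - y\<bar>"
    using fin[of "pos ` HE"] finH by blast
  show ?thesis using d1 d2 by (intro exI[of _ "min d1 d2"]) fastforce
qed

text \<open>A uniform width for local neighbourhoods: distinct lines carrying parallel edges are at
  least this far apart.\<close>

definition gap where
  "gap = (SOME \<delta>. \<delta> > 0 \<and> (\<forall>e\<in>VE. \<forall>f\<in>VE. pos e \<noteq> pos f \<longrightarrow> \<delta> \<le> \<bar>pos e - pos f\<bar>) \<and>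
     (\<forall>h\<in>HE. \<forall>k\<in>HE. pos h \<noteq> pos k \<longrightarrow> \<delta> \<le> \<bar>pos h - pos k\<bar>))"

lemma gap_pos: "gap > 0"
  and V_gap: "e \<in> VE \<Longrightarrow> f \<in> VE \<Longrightarrow> \<bar>pos e - pos f\<bar> < gap \<Longrightarrow> pos e = pos f"
  and H_gap: "h \<in> HE \<Longrightarrow> k \<in> HE \<Longrightarrow> \<bar>pos h - pos k\<bar> < gap \<Longrightarrow> pos h = pos k"
proof -
  have "gap > 0 \<and> (\<forall>e\<in>VE. \<forall>f\<in>VE. pos e \<noteq> pos f \<longrightarrow> gap \<le> \<bar>pos e - pos f\<bar>) \<and>
     (\<forall>h\<in>HE. \<forall>k\<in>HE. pos h \<noteq> pos k \<longrightarrow> gap \<le> \<bar>pos h - pos k\<bar>)"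
    unfolding gap_def by (rule someI_ex) (use exists_gap in blast)
  then show "gap > 0" "e \<in> VE \<Longrightarrow> f \<in> VE \<Longrightarrow> \<bar>pos e - pos f\<bar> < gap \<Longrightarrow> pos e = pos f"
    "h \<in> HE \<Longrightarrow> k \<in> HE \<Longrightarrow> \<bar>pos h - pos k\<bar> < gap \<Longrightarrow> pos h = pos k" by (auto simp: not_le[symmetric])
qed

text \<open>Both ends of a vertical edge are at levels of horizontal edges, so its length is a
  distance between two such lines.\<close>

lemma V_length: assumes "e \<in> VE" shows "gap \<le> hi e - lo e"
proof (rule ccontr)
  assume "\<not> ?thesis"
  moreover obtain h k where "h \<in> HE" "pos h = lo e" "k \<in> HE" "pos k = hi e"
    using VH[OF assms] by metis
  ultimately have "lo e = hi e" using H_gap[of h k] V_less[OF assms] by auto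
  then show False using V_less[OF assms] by simp
qed

lemma H_length: assumes "h \<in> HE" shows "gap \<le> hi h - lo h"
proof (rule ccontr)
  assume "\<not> ?thesis"
  moreover obtain e f where "e \<in> VE" "pos e = lo h" "f \<in> VE" "pos f = hi h"
    using HV[OF assms] by metis
  ultimately have "lo h = hi h" using V_gap[of e f] H_less[OF assms] by auto
  then show False using H_less[OF assms] by simp
qed

definition stripV where
  "stripV e s = {z. 0 < s * (fst z - pos e) \<and> s * (fst z - pos e) < gap \<and> lo e < snd z \<and> snd z < hi e}"
definition stripH where
  "stripH h s = {z. 0 < s * (snd z - pos h) \<and> s * (snd z - pos h) < gap \<and> lo h < fst z \<and> fst z < hi h}"

lemma convex_affine_ineqs:
  "convex {z::pt. a < s * (fst z - b)}" "convex {z::pt. s * (fst z - b) < a}"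
  "convex {z::pt. a < s * (snd z - b)}" "convex {z::pt. s * (snd z - b) < a}"
  "convex {z::pt. a < fst z}" "convex {z::pt. fst z < a}" "convex {z::pt. a < snd z}" "convex {z::pt. snd z < a}"
proof -
  have 1: "{z::pt. a < s * (fst z - b)} = {z. inner (s,0) z > a + s * b}" "{z::pt. s * (fst z - b) < a} = {z. inner (s,0) z < a + s * b}"
    "{z::pt. a < s * (snd z - b)} = {z. inner (0,s) z > a + s * b}" "{z::pt. s * (snd z - b) < a} = {z. inner (0,s) z < a + s * b}"
    "{z::pt. a < fst z} = {z. inner (1,0) z > a}" "{z::pt. fst z < a} = {z. inner (1,0) z < a}"
    "{z::pt. a < snd z} = {z. inner (0,1) z > a}" "{z::pt. snd z < a} = {z. inner (0,1) z < a}"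
    by (auto simp: inner_prod_def algebra_simps)
  show "convex {z::pt. a < s * (fst z - b)}" "convex {z::pt. s * (fst z - b) < a}"
  "convex {z::pt. a < s * (snd z - b)}" "convex {z::pt. s * (snd z - b) < a}"
  "convex {z::pt. a < fst z}" "convex {z::pt. fst z < a}" "convex {z::pt. a < snd z}" "convex {z::pt. snd z < a}"
    unfolding 1 by (rule convex_halfspace_gt convex_halfspace_lt)+
qed

lemma convex_conj: "convex {z. A z} \<Longrightarrow> convex {z. B z} \<Longrightarrow> convex {z. A z \<and> B z}"
  using convex_Int[of "{z. A z}" "{z. B z}"] by (simp add: Collect_conj_eq)

lemma connected_stripV: "connected (stripV e s)" unfolding stripV_def
  by (intro convex_connected convex_conj convex_affine_ineqs)

lemma connected_stripH: "connected (stripH e s)" unfolding stripH_def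
  by (intro convex_connected convex_conj convex_affine_ineqs)

text \<open>Another vertical edge is at least \<open>gap\<close> away. A horizontal edge in the
  strip has its ends on lines of vertical edges, so it cannot stop short of \<open>e\<close> within
  the strip; reaching the line of \<open>e\<close>, it would meet the interior of
  \<open>e\<close>.\<close>

lemma stripV_bd:
  assumes e: "e \<in> VE" and s: "s = 1 \<or> s = -1"
  shows "stripV e s \<inter> bd = {}"
proof (rule ccontr)
  assume "stripV e s \<inter> bd \<noteq> {}"
  then obtain z where z: "z \<in> stripV e s" "z \<in> bd" by blast
  have d: "\<bar>fst z - pos e\<bar> < gap" "fst z \<noteq> pos e" "lo e < snd z" "snd z < hi e"
    and sg: "0 < s * (fst z - pos e)" using z(1) s unfolding stripV_def by auto
  from z(2) consider (v) f where "f \<in> VE" "fst z = pos f" | (h) h where "h \<in> HE" "snd z = pos h" "lo h \<le> fst z" "fst z \<le> hi h"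
    unfolding bd_iff by blast
  then show False
  proof cases
    case v
    then show False using V_gap[of f e] e d by auto
  next
    case h
    obtain f g where fg: "f \<in> VE" "pos f = lo h" "g \<in> VE" "pos g = hi h" using HV[OF h(1)] by metis
    have "\<not> pos e < lo h"
    proof
      assume a: "pos e < lo h"
      then have "\<bar>pos f - pos e\<bar> < gap" using fg(2) h(3) d(1) by linarith
      then show False using V_gap[OF fg(1) e] fg(2) a by simp
    qed
    moreover have "\<not> hi h < pos e"
    proof
      assume a: "hi h < pos e"
      then have "\<bar>pos g - pos e\<bar> < gap" using fg(4) h(4) d(1) by linarith
      then show False using V_gap[OF fg(3) e] fg(4) a by simp
    qed
    ultimately have "lo h \<le> pos e" "pos e \<le> hi h" by auto
    then have "pos h = lo e \<or> pos h = hi e" using crossing[OF e h(1)] h(2) d by auto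
    then show False using h(2) d by auto
  qed
qed

lemma stripH_bd:
  assumes e: "e \<in> HE" and s: "s = 1 \<or> s = -1"
  shows "stripH e s \<inter> bd = {}"
proof (rule ccontr)
  assume "stripH e s \<inter> bd \<noteq> {}"
  then obtain z where z: "z \<in> stripH e s" "z \<in> bd" by blast
  have d: "\<bar>snd z - pos e\<bar> < gap" "snd z \<noteq> pos e" "lo e < fst z" "fst z < hi e"
    and sg: "0 < s * (snd z - pos e)" using z(1) s unfolding stripH_def by auto
  from z(2) consider (v) f where "f \<in> HE" "snd z = pos f" | (h) h where "h \<in> VE" "fst z = pos h" "lo h \<le> snd z" "snd z \<le> hi h"
    unfolding bd_iff by blast
  then show False
  proof cases
    case v
    then show False using H_gap[of f e] e d by auto
  next
    case h
    obtain f g where fg: "f \<in> HE" "pos f = lo h" "g \<in> HE" "pos g = hi h" using VH[OF h(1)] by metis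
    have "\<not> pos e < lo h"
    proof
      assume a: "pos e < lo h"
      then have "\<bar>pos f - pos e\<bar> < gap" using fg(2) h(3) d(1) by linarith
      then show False using H_gap[OF fg(1) e] fg(2) a by simp
    qed
    moreover have "\<not> hi h < pos e"
    proof
      assume a: "hi h < pos e"
      then have "\<bar>pos g - pos e\<bar> < gap" using fg(4) h(4) d(1) by linarith
      then show False using H_gap[OF fg(3) e] fg(4) a by simp
    qed
    ultimately have "lo h \<le> pos e" "pos e \<le> hi h" by auto
    then have "pos h = lo e \<or> pos h = hi e" using crossing[OF h(1) e] h(2) d by auto
    then show False using h(2) d by auto
  qed
qed

lemma near_frontier:
  assumes "x \<in> bd" "\<epsilon> > 0"
  shows "\<exists>z\<in>inn. dist x z < \<epsilon>" "\<exists>z\<in>out. dist x z < \<epsilon>"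
proof -
  have "x \<in> closure inn" "x \<in> closure out" using assms(1) fr_inn fr_out unfolding frontier_def by auto
  then show "\<exists>z\<in>inn. dist x z < \<epsilon>" "\<exists>z\<in>out. dist x z < \<epsilon>"
    unfolding closure_approachable using assms(2) by (metis dist_commute)+
qed

lemma dist_coords: "dist (x::pt) z < \<epsilon> \<Longrightarrow> \<bar>fst z - fst x\<bar> < \<epsilon> \<and> \<bar>snd z - snd x\<bar> < \<epsilon>"
  using dist_fst_le[of x z] dist_snd_le[of x z] by (auto simp: dist_real_def)

text \<open>The midpoint of the edge is a limit of inside and of outside points, and near it
  everything off the boundary lies in one of the two strips.\<close>

lemma stripV_sides:
  assumes e: "e \<in> VE"
  shows "(stripV e 1 \<subseteq> inn \<and> stripV e (-1) \<subseteq> out) \<or> (stripV e 1 \<subseteq> out \<and> stripV e (-1) \<subseteq> inn)"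
proof -
  define x where "x = (pos e, (lo e + hi e) / 2)"
  have l: "lo e < hi e" using V_less[OF e] .
  have x: "x \<in> bd" unfolding bd_iff x_def using e l by auto
  define \<epsilon> where "\<epsilon> = min gap ((hi e - lo e) / 2)"
  have eps: "\<epsilon> > 0" using l gap_pos unfolding \<epsilon>_def by auto
  have near: "z \<in> stripV e 1 \<or> z \<in> stripV e (-1)" if "dist x z < \<epsilon>" "z \<notin> bd" for z
  proof -
    have c: "\<bar>fst z - pos e\<bar> < gap" "lo e < snd z" "snd z < hi e"
      using dist_coords[OF that(1)] unfolding x_def \<epsilon>_def by (auto simp: abs_if field_simps split: if_splits)
    moreover have "fst z \<noteq> pos e" using that(2) e c unfolding bd_iff by force
    ultimately show ?thesis unfolding stripV_def by auto
  qed
  have d: "stripV e s \<subseteq> inn \<or> stripV e s \<subseteq> out" if "s = 1 \<or> s = -1" for s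
    using connected_dichotomy[OF connected_stripV stripV_bd[OF e that]] .
  obtain zi zo where z: "zi \<in> inn" "dist x zi < \<epsilon>" "zo \<in> out" "dist x zo < \<epsilon>"
    using near_frontier[OF x eps] by blast
  then have "zi \<in> stripV e 1 \<or> zi \<in> stripV e (-1)" "zo \<in> stripV e 1 \<or> zo \<in> stripV e (-1)"
    using near inn_bd out_bd by blast+
  then show ?thesis using d[of 1] d[of "-1"] z(1,3) inn_out by blast
qed

lemma stripH_sides:
  assumes e: "e \<in> HE"
  shows "(stripH e 1 \<subseteq> inn \<and> stripH e (-1) \<subseteq> out) \<or> (stripH e 1 \<subseteq> out \<and> stripH e (-1) \<subseteq> inn)"
proof -
  define x where "x = ((lo e + hi e) / 2, pos e)"
  have l: "lo e < hi e" using H_less[OF e] .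
  have x: "x \<in> bd" unfolding bd_iff x_def using e l by auto
  define \<epsilon> where "\<epsilon> = min gap ((hi e - lo e) / 2)"
  have eps: "\<epsilon> > 0" using l gap_pos unfolding \<epsilon>_def by auto
  have near: "z \<in> stripH e 1 \<or> z \<in> stripH e (-1)" if "dist x z < \<epsilon>" "z \<notin> bd" for z
  proof -
    have c: "\<bar>snd z - pos e\<bar> < gap" "lo e < fst z" "fst z < hi e"
      using dist_coords[OF that(1)] unfolding x_def \<epsilon>_def by (auto simp: abs_if field_simps split: if_splits)
    moreover have "snd z \<noteq> pos e" using that(2) e c unfolding bd_iff by force
    ultimately show ?thesis unfolding stripH_def by auto
  qed
  have d: "stripH e s \<subseteq> inn \<or> stripH e s \<subseteq> out" if "s = 1 \<or> s = -1" for s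
    using connected_dichotomy[OF connected_stripH stripH_bd[OF e that]] .
  obtain zi zo where z: "zi \<in> inn" "dist x zi < \<epsilon>" "zo \<in> out" "dist x zo < \<epsilon>"
    using near_frontier[OF x eps] by blast
  then have "zi \<in> stripH e 1 \<or> zi \<in> stripH e (-1)" "zo \<in> stripH e 1 \<or> zo \<in> stripH e (-1)"
    using near inn_bd out_bd by blast+
  then show ?thesis using d[of 1] d[of "-1"] z(1,3) inn_out by blast
qed

text \<open>The side of \<open>e\<close> on which the interior of the polygon lies. By
  \<open>stripV_sides\<close> the value -1 is a genuine answer as well, not just a default.\<close>

definition sd where "sd e = (if stripV e 1 \<subseteq> inn then 1 else -1::real)"

lemma sd_cases: "sd e = 1 \<or> sd e = -1" by (simp add: sd_def)

lemma stripV_nonempty: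
  assumes "e \<in> VE" "s = 1 \<or> s = -1" shows "(pos e + s * (gap / 2), (lo e + hi e) / 2) \<in> stripV e s"
  using V_less[OF assms(1)] gap_pos assms(2) unfolding stripV_def by auto

lemma sd_inn: assumes "e \<in> VE" shows "stripV e (sd e) \<subseteq> inn"
  using stripV_sides[OF assms] unfolding sd_def by auto

lemma sd_out: assumes "e \<in> VE" shows "stripV e (- sd e) \<subseteq> out"
proof (cases "stripV e 1 \<subseteq> inn")
  case True
  then have "\<not> stripV e 1 \<subseteq> out" using stripV_nonempty[OF assms, of 1] inn_out by blast
  then show ?thesis using stripV_sides[OF assms] True unfolding sd_def by auto
qed (use stripV_sides[OF assms] in \<open>auto simp: sd_def\<close>)

lemma sd_eqI: assumes "e \<in> VE" "s = 1 \<or> s = -1" "z \<in> stripV e s" "z \<in> inn" shows "sd e = s"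
proof (rule ccontr)
  assume "sd e \<noteq> s"
  then have "- sd e = s" using assms(2) sd_cases[of e] by auto
  then show False using sd_out[OF assms(1)] assms(3,4) inn_out by blast
qed

text \<open>The horizontal edge at end \<open>r\<close> leaves toward the exterior side of
  \<open>e\<close>, as its end in direction \<open>sd e\<close> is the common vertex. Agreement with
  the count of interior quadrants is the content of \<open>reflex_vertices\<close>.\<close>

definition reflex where
  "reflex e r \<longleftrightarrow> e \<in> VE \<and> (r = 1 \<or> r = -1) \<and> (\<exists>h\<in>HE. pos h = tip e r \<and> tip h (sd e) = pos e)"

text \<open>Half squares at an end of \<open>e\<close>: \<open>halfV\<close> lies beyond the end and
  never meets the boundary, while \<open>halfH\<close> avoids it on the side away from the
  horizontal edge.\<close>

definition halfV where
  "halfV e r = {z. -gap < fst z - pos e \<and> fst z - pos e < gap \<and> 0 < r * (snd z - tip e r) \<and> r * (snd z - tip e r) < gap}"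
definition halfH where
  "halfH e r s = {z. 0 < s * (fst z - pos e) \<and> s * (fst z - pos e) < gap \<and> - gap < snd z - tip e r \<and> snd z - tip e r < gap}"

lemma end_edge:
  assumes "e \<in> VE" "r = 1 \<or> r = -1"
  obtains h s where "h \<in> HE" "pos h = tip e r" "s = 1 \<or> s = -1" "tip h (-s) = pos e"
proof -
  have "tip e r = lo e \<or> tip e r = hi e" by (simp add: tip_def)
  then obtain h where h: "h \<in> HE" "pos h = tip e r" "pos e = lo h \<or> pos e = hi h" using VH[OF assms(1)] by blast
  then show thesis using that[of h 1] that[of h "-1"] by auto
qed

text \<open>Around an end of a vertical edge whose horizontal edge leaves in direction \<open>s\<close>, everything outside the
  quadrant spanned by the two edges lies on the same side of the boundary.\<close>

lemma corner:
  assumes e: "e \<in> VE" and r: "r = 1 \<or> r = -1" and h: "h \<in> HE" "pos h = tip e r"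
    and s: "s = 1 \<or> s = -1" "tip h (-s) = pos e"
  shows "(s = sd e \<longrightarrow> halfV e r \<subseteq> out \<and> halfH e r (-s) \<subseteq> out) \<and>
         (s = - sd e \<longrightarrow> halfV e r \<subseteq> inn \<and> halfH e r (-s) \<subseteq> inn)"
proof -
  have lh: "gap \<le> hi h - lo h" "gap \<le> hi e - lo e" using H_length h(1) V_length e by auto
  have V: "halfV e r \<inter> bd = {}"
  proof (rule ccontr)
    assume "halfV e r \<inter> bd \<noteq> {}"
    then obtain z where z: "z \<in> halfV e r" "z \<in> bd" by blast
    then have d: "\<bar>fst z - pos e\<bar> < gap" "\<bar>snd z - tip e r\<bar> < gap" "0 < r * (snd z - tip e r)"
      unfolding halfV_def using r by auto
    from z(2) consider f where "f \<in> VE" "fst z = pos f" "lo f \<le> snd z" "snd z \<le> hi f" | k where "k \<in> HE" "snd z = pos k"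
      unfolding bd_iff by blast
    then show False
    proof cases
      case 1
      then have "f = e" using V_gap[of f e] V_unique[of f e] e d by auto
      then show False using 1 d r by auto
    next
      case 2
      then have "pos k = tip e r" using H_gap[of k h] h d by auto
      then show False using 2 d by auto
    qed
  qed
  have H: "halfH e r (-s) \<inter> bd = {}"
  proof (rule ccontr)
    assume "halfH e r (-s) \<inter> bd \<noteq> {}"
    then obtain z where z: "z \<in> halfH e r (-s)" "z \<in> bd" by blast
    then have d: "\<bar>fst z - pos e\<bar> < gap" "\<bar>snd z - tip e r\<bar> < gap" "0 < - s * (fst z - pos e)"
      unfolding halfH_def using s by auto
    from z(2) consider f where "f \<in> VE" "fst z = pos f" | k where "k \<in> HE" "snd z = pos k" "lo k \<le> fst z" "fst z \<le> hi k"
      unfolding bd_iff by blast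
    then show False
    proof cases
      case 1
      then have "pos f = pos e" using V_gap[of f e] e d by auto
      then show False using 1 d by auto
    next
      case 2
      then have "k = h" using H_gap[of k h] H_unique[of k h] h d by auto
      then show False using 2 d s by auto
    qed
  qed
  have cV: "connected (halfV e r)" unfolding halfV_def
    using convex_affine_ineqs(1)[of "-gap" 1 "pos e"] convex_affine_ineqs(2)[of 1 "pos e" gap]
    by (intro convex_connected convex_conj convex_affine_ineqs) auto
  have cH: "connected (halfH e r (-s))" unfolding halfH_def
    using convex_affine_ineqs(3)[of "-gap" 1 "tip e r"] convex_affine_ineqs(4)[of 1 "tip e r" gap]
    by (intro convex_connected convex_conj convex_affine_ineqs) auto
  have dV: "halfV e r \<subseteq> inn \<or> halfV e r \<subseteq> out" using connected_dichotomy[OF cV V] .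
  have dH: "halfH e r (-s) \<subseteq> inn \<or> halfH e r (-s) \<subseteq> out" using connected_dichotomy[OF cH H] .
  \<comment> \<open>\<open>p\<close> lies in both half squares and forces them to the same side;
    \<open>q\<close> ties them to the strip of \<open>e\<close>, whose side is known.\<close>
  define p where "p = (pos e - s * (gap/2), tip e r + r * (gap/2))"
  define q where "q = (pos e - s * (gap/2), tip e r - r * (gap/2))"
  have p: "p \<in> halfV e r" "p \<in> halfH e r (-s)" "q \<in> halfH e r (-s)" "q \<in> stripV e (-s)"
    using gap_pos r s(1) lh unfolding p_def q_def halfV_def halfH_def stripV_def by auto
  have "s = sd e \<Longrightarrow> q \<in> out" "s = - sd e \<Longrightarrow> q \<in> inn" using p(4) sd_inn[OF e] sd_out[OF e] by auto
  then show ?thesis using dV dH p inn_out by blast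
qed

lemma reflex_corner:
  assumes "reflex e r"
  shows "halfV e r \<subseteq> inn" "halfH e r (sd e) \<subseteq> inn"
proof -
  obtain h where h: "h \<in> HE" "pos h = tip e r" "tip h (sd e) = pos e" and e: "e \<in> VE" "r = 1 \<or> r = -1"
    using assms reflex_def by auto
  show "halfV e r \<subseteq> inn" "halfH e r (sd e) \<subseteq> inn"
    using corner[OF e h(1,2), of "- sd e"] sd_cases[of e] h(3) by auto
qed

lemma convex_corner:
  assumes "e \<in> VE" "r = 1 \<or> r = -1" "\<not> reflex e r"
  shows "halfV e r \<subseteq> out" "halfH e r (- sd e) \<subseteq> out" "\<exists>h\<in>HE. pos h = tip e r \<and> tip h (- sd e) = pos e"
proof -
  obtain h s where h: "h \<in> HE" "pos h = tip e r" "s = 1 \<or> s = -1" "tip h (-s) = pos e"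
    using end_edge[OF assms(1,2)] by metis
  have "s = sd e" using h assms sd_cases[of e] unfolding reflex_def by auto
  then show "halfV e r \<subseteq> out" "halfH e r (- sd e) \<subseteq> out" "\<exists>h\<in>HE. pos h = tip e r \<and> tip h (- sd e) = pos e"
    using corner[OF assms(1,2) h] h by auto
qed

end

section \<open>Cells of the vertical decomposition\<close>

lemma finite_argmin:
  fixes f :: "'a \<Rightarrow> real"
  assumes "finite S" "S \<noteq> {}"
  shows "\<exists>x\<in>S. \<forall>y\<in>S. f x \<le> f y"
  using assms by (metis (no_types, lifting) arg_min_if_finite(1) arg_min_least)

datatype cell = Cell (west: real) (east: real) (south: real) (north: real)

definition X :: "cell \<Rightarrow> real \<Rightarrow> real" where "X C s = (if s > 0 then east C else west C)"
definition Y :: "cell \<Rightarrow> real \<Rightarrow> real" where "Y C r = (if r > 0 then north C else south C)"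

lemma cell_eqI: "X C 1 = X D 1 \<Longrightarrow> X C (-1) = X D (-1) \<Longrightarrow> Y C 1 = Y D 1 \<Longrightarrow> Y C (-1) = Y D (-1) \<Longrightarrow> C = D"
  by (simp add: X_def Y_def cell.expand)

lemma XY_simps [simp]:
  "X (Cell a b c d) 1 = b" "X (Cell a b c d) (-1) = a" "Y (Cell a b c d) 1 = d" "Y (Cell a b c d) (-1) = c"
  by (simp_all add: X_def Y_def)

definition orect :: "cell \<Rightarrow> pt set" where
  "orect C = {z. X C (-1) < fst z \<and> fst z < X C 1 \<and> Y C (-1) < snd z \<and> snd z < Y C 1}"
definition crect :: "cell \<Rightarrow> pt set" where
  "crect C = {z. X C (-1) \<le> fst z \<and> fst z \<le> X C 1 \<and> Y C (-1) \<le> snd z \<and> snd z \<le> Y C 1}"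

context rectilinear
begin

text \<open>A description of the decomposition rectangles by edges alone. Floor and ceiling are
  covered by single edges, whereas the edge on the line of a vertical side only has to touch its
  closed height range: the side may be a chord starting at an end of that edge.\<close>

definition cell :: "cell \<Rightarrow> bool" where
  "cell C \<longleftrightarrow> X C (-1) < X C 1 \<and> Y C (-1) < Y C 1 \<and> orect C \<subseteq> inn \<and>
     (\<forall>r\<in>{1,-1}. \<exists>h\<in>HE. pos h = Y C r \<and> lo h \<le> X C (-1) \<and> X C 1 \<le> hi h) \<and>
     (\<forall>s\<in>{1,-1}. \<exists>e\<in>VE. pos e = X C s \<and> lo e \<le> Y C 1 \<and> Y C (-1) \<le> hi e)"

lemma cell_less: assumes "cell C" shows "X C (-1) < X C 1" "Y C (-1) < Y C 1"
  using assms by (auto simp: cell_def)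

lemma cell_orect: "cell C \<Longrightarrow> orect C \<subseteq> inn" by (simp add: cell_def)

lemma cell_horizontal:
  assumes "cell C" "r = 1 \<or> r = -1"
  obtains h where "h \<in> HE" "pos h = Y C r" "lo h \<le> X C (-1)" "X C 1 \<le> hi h"
  using assms unfolding cell_def by blast

lemma cell_vertical:
  assumes "cell C" "s = 1 \<or> s = -1"
  obtains e where "e \<in> VE" "pos e = X C s" "lo e \<le> Y C 1" "Y C (-1) \<le> hi e"
  using assms unfolding cell_def by blast

lemma connected_orect: "connected (orect C)"
  unfolding orect_def by (intro convex_connected convex_conj convex_affine_ineqs)

text \<open>A vertical ray from \<open>z\<close> that met no horizontal edge would avoid the
  boundary altogether, because no vertical edge has its abscissa, and would stay in the bounded
  interior.\<close>

lemma horizontal_hit: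
  assumes z: "z \<in> inn" and nv: "\<And>e. e \<in> VE \<Longrightarrow> pos e \<noteq> fst z" and r: "r = 1 \<or> r = -1"
  obtains h where "h \<in> HE" "lo h \<le> fst z" "fst z \<le> hi h" "0 < r * (pos h - snd z)"
    "\<And>k. k \<in> HE \<Longrightarrow> lo k \<le> fst z \<Longrightarrow> fst z \<le> hi k \<Longrightarrow> 0 < r * (pos k - snd z) \<Longrightarrow> r * (pos h - snd z) \<le> r * (pos k - snd z)"
proof -
  define S where "S = {h\<in>HE. lo h \<le> fst z \<and> fst z \<le> hi h \<and> 0 < r * (pos h - snd z)}"
  have "S \<noteq> {}"
  proof
    assume S: "S = {}"
    define R where "R = (\<lambda>t. (fst z, snd z + r * t)) ` {0..}"
    have "connected R" unfolding R_def
      by (rule connected_continuous_image) (auto intro!: continuous_intros)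
    moreover have "R \<inter> bd = {}"
    proof (rule ccontr)
      assume "R \<inter> bd \<noteq> {}"
      then obtain t where t: "t \<ge> 0" "(fst z, snd z + r * t) \<in> bd" unfolding R_def by auto
      then obtain h where h: "h \<in> HE" "snd z + r * t = pos h" "lo h \<le> fst z" "fst z \<le> hi h"
        using nv unfolding bd_iff by (metis fst_conv snd_conv)
      have "0 \<le> r * (pos h - snd z)" using h(2) t(1) r by auto
      moreover have "pos h \<noteq> snd z" using h inn_bd[OF z] unfolding bd_iff by auto
      ultimately show False using S h r unfolding S_def by force
    qed
    ultimately have "R \<subseteq> inn \<or> R \<subseteq> out" by (rule connected_dichotomy)
    moreover have "z \<in> R" unfolding R_def by (auto intro!: image_eqI[of _ _ 0])
    ultimately have Ri: "R \<subseteq> inn" using z inn_out by blast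
    obtain M where M: "\<And>w. w \<in> inn \<Longrightarrow> norm w \<le> M" using inn_bdd unfolding bounded_iff by blast
    \<comment> \<open>Far enough for the ordinate to exceed \<open>M\<close> in absolute value in
      either direction.\<close>
    define t where "t = \<bar>snd z\<bar> + \<bar>M\<bar> + 1"
    have "(fst z, snd z + r * t) \<in> R" unfolding R_def by (rule imageI) (simp add: t_def)
    then have "(fst z, snd z + r * t) \<in> inn" using Ri by blast
    then have "norm (fst z, snd z + r * t) \<le> M" by (rule M)
    moreover have "\<bar>snd z + r * t\<bar> \<le> norm (fst z, snd z + r * t)" using norm_snd_le[of "snd z + r * t" "fst z"] by simp
    moreover have "\<bar>snd z + r * t\<bar> > M" using r unfolding t_def by auto
    ultimately show False by linarith
  qed
  moreover have "finite S" unfolding S_def using finH by auto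
  ultimately obtain h where "h \<in> S" "\<forall>k\<in>S. r * (pos h - snd z) \<le> r * (pos k - snd z)"
    using finite_argmin[of S "\<lambda>h. r * (pos h - snd z)"] by blast
  then show thesis using that[of h] unfolding S_def by auto
qed

text \<open>Floor and ceiling are the next horizontal edges below and above \<open>z\<close>; the
  sides are the nearest vertical edges that touch this height range. Ends of floor and ceiling carry
  such edges, so candidates exist and floor and ceiling span the full width.\<close>

lemma cell_exists:
  assumes z: "z \<in> inn" and nv: "\<And>e. e \<in> VE \<Longrightarrow> pos e \<noteq> fst z"
  obtains C where "cell C" "z \<in> orect C"
proof -
  obtain ht where ht: "ht \<in> HE" "lo ht \<le> fst z" "fst z \<le> hi ht" "snd z < pos ht"
    "\<And>k. k \<in> HE \<Longrightarrow> lo k \<le> fst z \<Longrightarrow> fst z \<le> hi k \<Longrightarrow> snd z < pos k \<Longrightarrow> pos ht \<le> pos k"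
    using horizontal_hit[OF z nv, of 1] by auto
  obtain hb where hb: "hb \<in> HE" "lo hb \<le> fst z" "fst z \<le> hi hb" "pos hb < snd z"
    "\<And>k. k \<in> HE \<Longrightarrow> lo k \<le> fst z \<Longrightarrow> fst z \<le> hi k \<Longrightarrow> pos k < snd z \<Longrightarrow> pos k \<le> pos hb"
    using horizontal_hit[OF z nv, of "-1"] by auto
  have endp: "\<exists>e\<in>VE. pos e = tip h s \<and> 0 < s * (pos e - fst z) \<and> lo e \<le> pos ht \<and> pos hb \<le> hi e"
    if s: "s = 1 \<or> s = -1" and h: "h \<in> HE" "lo h \<le> fst z" "fst z \<le> hi h" "pos hb \<le> pos h" "pos h \<le> pos ht" for h s
  proof -
    have "tip h s = lo h \<or> tip h s = hi h" by (simp add: tip_def)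
    then obtain e where e: "e \<in> VE" "pos e = tip h s" "pos h = lo e \<or> pos h = hi e" using HV[OF h(1)] by blast
    then have "lo e \<le> pos ht" "pos hb \<le> hi e" using V_less[OF e(1)] h by auto
    moreover have "0 < s * (pos e - fst z)" using nv[OF e(1)] e(2) s h by auto
    ultimately show ?thesis using e by blast
  qed
  have side: "\<exists>e\<in>VE. 0 < s * (pos e - fst z) \<and> lo e \<le> pos ht \<and> pos hb \<le> hi e \<and>
     (\<forall>f\<in>VE. 0 < s * (pos f - fst z) \<and> lo f \<le> pos ht \<and> pos hb \<le> hi f \<longrightarrow> s * (pos e - fst z) \<le> s * (pos f - fst z))"
    if s: "s = 1 \<or> s = -1" for s
  proof -
    define S where "S = {e\<in>VE. 0 < s * (pos e - fst z) \<and> lo e \<le> pos ht \<and> pos hb \<le> hi e}"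
    have "finite S" "S \<noteq> {}" using finV endp[OF s ht(1-3)] ht hb unfolding S_def by auto
    then obtain e where "e \<in> S" "\<forall>f\<in>S. s * (pos e - fst z) \<le> s * (pos f - fst z)"
      using finite_argmin[of S "\<lambda>e. s * (pos e - fst z)"] by blast
    then show ?thesis unfolding S_def by blast
  qed
  obtain er where er: "er \<in> VE" "fst z < pos er" "lo er \<le> pos ht" "pos hb \<le> hi er"
    "\<And>f. f \<in> VE \<Longrightarrow> fst z < pos f \<Longrightarrow> lo f \<le> pos ht \<Longrightarrow> pos hb \<le> hi f \<Longrightarrow> pos er \<le> pos f"
    using side[of 1] by auto
  obtain el where el: "el \<in> VE" "pos el < fst z" "lo el \<le> pos ht" "pos hb \<le> hi el"
    "\<And>f. f \<in> VE \<Longrightarrow> pos f < fst z \<Longrightarrow> lo f \<le> pos ht \<Longrightarrow> pos hb \<le> hi f \<Longrightarrow> pos f \<le> pos el"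
    using side[of "-1"] by auto
  define C where "C = Cell (pos el) (pos er) (pos hb) (pos ht)"
  have zC: "z \<in> orect C" using el er ht hb unfolding orect_def C_def by auto
  have cov: "lo h \<le> pos el" "pos er \<le> hi h"
    if h: "h \<in> HE" "lo h \<le> fst z" "fst z \<le> hi h" "pos hb \<le> pos h" "pos h \<le> pos ht" for h
  proof -
    obtain e where "e \<in> VE" "pos e = lo h" "pos e < fst z" "lo e \<le> pos ht" "pos hb \<le> hi e" using endp[of "-1" h] h by auto
    then show "lo h \<le> pos el" using el(5)[of e] by simp
    obtain e where "e \<in> VE" "pos e = hi h" "fst z < pos e" "lo e \<le> pos ht" "pos hb \<le> hi e" using endp[of 1 h] h by auto
    then show "pos er \<le> hi h" using er(5)[of e] by simp
  qed
  have "orect C \<inter> bd = {}"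
  proof (rule ccontr)
    assume "orect C \<inter> bd \<noteq> {}"
    then obtain w where w: "pos el < fst w" "fst w < pos er" "pos hb < snd w" "snd w < pos ht" "w \<in> bd"
      unfolding orect_def C_def by auto
    from w(5) consider e where "e \<in> VE" "fst w = pos e" "lo e \<le> snd w" "snd w \<le> hi e"
      | h where "h \<in> HE" "snd w = pos h" "lo h \<le> fst w" "fst w \<le> hi h" unfolding bd_iff by blast
    then show False
    proof cases
      case 1
      then have "lo e \<le> pos ht" "pos hb \<le> hi e" using w by auto
      then show False using nv[OF 1(1)] el(5)[OF 1(1)] er(5)[OF 1(1)] 1(2) w by linarith
    next
      \<comment> \<open>A horizontal edge through the open rectangle cannot end inside it, since its
        end would carry a closer vertical edge. It thus passes over the abscissa of \<open>z\<close>
        between floor and ceiling, contradicting their choice.\<close>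
      case 2
      obtain f g where fg: "f \<in> VE" "pos f = lo h" "pos h = lo f \<or> pos h = hi f"
        "g \<in> VE" "pos g = hi h" "pos h = lo g \<or> pos h = hi g" using HV[OF 2(1)] by metis
      have f: "lo f \<le> pos ht" "pos hb \<le> hi f" "lo g \<le> pos ht" "pos hb \<le> hi g"
        using fg V_less[OF fg(1)] V_less[OF fg(4)] w 2(2) by auto
      have "lo h \<le> fst z" using er(5)[OF fg(1) _ f(1,2)] fg(2) 2 w by linarith
      moreover have "fst z \<le> hi h" using el(5)[OF fg(4) _ f(3,4)] fg(5) 2 w by linarith
      ultimately have "snd z = pos h" using ht(5)[OF 2(1)] hb(5)[OF 2(1)] 2(2) w by linarith
      then have "z \<in> bd" unfolding bd_iff using 2(1) \<open>lo h \<le> fst z\<close> \<open>fst z \<le> hi h\<close> by blast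
      then show False using inn_bd[OF z] by blast
    qed
  qed
  then have "orect C \<subseteq> inn" using connected_dichotomy[OF connected_orect] zC z inn_out by blast
  moreover have "\<exists>h\<in>HE. pos h = Y C r \<and> lo h \<le> X C (-1) \<and> X C 1 \<le> hi h" if "r \<in> {1,-1}" for r
    using that cov[OF ht(1-3)] cov[OF hb(1-3)] ht hb unfolding C_def by auto
  moreover have "\<exists>e\<in>VE. pos e = X C s \<and> lo e \<le> Y C 1 \<and> Y C (-1) \<le> hi e" if "s \<in> {1,-1}" for s
    using that el er unfolding C_def by auto
  ultimately have "cell C" unfolding cell_def using el er ht hb by (auto simp: C_def)
  then show thesis using that zC by blast
qed

lemma orect_Y_le:
  assumes C: "cell C" and D: "cell D" and z: "z \<in> orect C" "z \<in> orect D" and r: "r = 1 \<or> r = -1"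
  shows "r * Y D r \<le> r * Y C r"
proof (rule ccontr)
  assume n: "\<not> ?thesis"
  obtain h where h: "h \<in> HE" "pos h = Y C r" "lo h \<le> X C (-1)" "X C 1 \<le> hi h" using cell_horizontal[OF C r] .
  have "(fst z, Y C r) \<in> bd" unfolding bd_iff using h z by (intro disjI2 bexI[of _ h]) (auto simp: orect_def)
  moreover have "(fst z, Y C r) \<in> orect D" using z n r unfolding orect_def by auto
  ultimately show False using cell_orect[OF D] inn_bd by blast
qed

text \<open>A common point forces equal floors and ceilings. If then a side of one cell ran through
  the other, the vertical edge on its line could not enter the open rectangle, so it would end in
  the interior of a floor or ceiling edge, which \<open>crossing\<close> forbids.\<close>

lemma orect_disjoint:
  assumes C: "cell C" and D: "cell D" and z: "z \<in> orect C" "z \<in> orect D"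
  shows "C = D"
proof -
  have Y: "Y C 1 = Y D 1" "Y C (-1) = Y D (-1)"
    using orect_Y_le[OF C D z, of 1] orect_Y_le[OF D C z(2,1), of 1] orect_Y_le[OF C D z, of "-1"] orect_Y_le[OF D C z(2,1), of "-1"]
    by auto
  have le: "s * X A s \<le> s * X B s"
    if A: "cell A" and B: "cell B" and z: "z \<in> orect A" "z \<in> orect B" and Y: "Y A 1 = Y B 1" "Y A (-1) = Y B (-1)"
      and s: "s = 1 \<or> s = -1" for A B s
  proof (rule ccontr)
    assume n: "\<not> ?thesis"
    obtain e where e: "e \<in> VE" "pos e = X B s" "lo e \<le> Y B 1" "Y B (-1) \<le> hi e" using cell_vertical[OF B s] .
    have x: "X A (-1) < pos e" "pos e < X A 1" using n s e(2) z unfolding orect_def by auto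
    have nohit: "\<not> (Y A (-1) < y \<and> y < Y A 1 \<and> lo e \<le> y \<and> y \<le> hi e)" for y
    proof
      assume y: "Y A (-1) < y \<and> y < Y A 1 \<and> lo e \<le> y \<and> y \<le> hi e"
      then have "(pos e, y) \<in> orect A" "(pos e, y) \<in> bd" using x e(1) unfolding orect_def bd_iff by auto
      then show False using cell_orect[OF A] inn_bd by blast
    qed
    have le: "lo e < hi e" "Y A (-1) < Y A 1" using V_less[OF e(1)] cell_less[OF A] by auto
    have "lo e = Y A 1 \<or> hi e = Y A (-1)"
    proof (rule ccontr)
      assume "\<not> ?thesis"
      then have "lo e < Y A 1" "Y A (-1) < hi e" using e Y by auto
      then have "max (lo e) (Y A (-1)) < min (hi e) (Y A 1)" using le by auto
      then obtain y where "max (lo e) (Y A (-1)) < y" "y < min (hi e) (Y A 1)" using dense by blast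
      then show False using nohit[of y] by auto
    qed
    then obtain r where r: "r = 1 \<or> r = -1" "lo e \<le> Y A r" "Y A r \<le> hi e" using le by fastforce
    obtain h where h: "h \<in> HE" "pos h = Y A r" "lo h \<le> X A (-1)" "X A 1 \<le> hi h" using cell_horizontal[OF A r(1)] .
    then show False using crossing[OF e(1) h(1)] x r by auto
  qed
  show ?thesis
    using le[OF C D z Y, of 1] le[OF D C z(2,1) Y(1)[symmetric] Y(2)[symmetric], of 1]
      le[OF C D z Y, of "-1"] le[OF D C z(2,1) Y(1)[symmetric] Y(2)[symmetric], of "-1"] Y
    by (intro cell_eqI) auto
qed

text \<open>Role \<open>0\<close> is that of the base cell of \<open>e\<close>, role \<open>r = \<plusminus>1\<close> that of the narrow cell at the reflex end \<open>r\<close>.\<close>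

definition role :: "cell \<Rightarrow> seg \<Rightarrow> real \<Rightarrow> bool" where
  "role C e r \<longleftrightarrow> cell C \<and> e \<in> VE \<and>
     (if r = 0 then X C (- sd e) = pos e \<and> Y C (-1) \<le> lo e \<and> hi e \<le> Y C 1
      else reflex e r \<and> X C (sd e) = pos e \<and> Y C (- r) = tip e r)"

lemma reflex_sign: "reflex e r \<Longrightarrow> r = 1 \<or> r = -1" by (simp add: reflex_def)

lemma reflex_VE: "reflex e r \<Longrightarrow> e \<in> VE" by (simp add: reflex_def)

lemma base_point:
  assumes "cell C" "e \<in> VE" "X C (- sd e) = pos e" "lo e < y" "y < hi e" "Y C (-1) \<le> lo e" "hi e \<le> Y C 1"
    "0 < t" "t < X C 1 - X C (-1)"
  shows "(pos e + sd e * t, y) \<in> orect C"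
  using assms sd_cases[of e] unfolding orect_def by auto

text \<open>The edge on the line of a side cannot pass through floor or ceiling, so it either fits
  into the side or touches it with one end only. A point of the cell close to the edge tells where
  the interior lies: in the first case this gives the base role, in the second the end is reflex and
  the cell narrow.\<close>

lemma side_role:
  assumes C: "cell C" and s: "s = 1 \<or> s = -1"
  obtains e r where "role C e r" "r = 0 \<or> r = 1 \<or> r = -1" "X C s = pos e" "sd e = (if r = 0 then - s else s)"
proof -
  obtain e where e: "e \<in> VE" "pos e = X C s" "lo e \<le> Y C 1" "Y C (-1) \<le> hi e" using cell_vertical[OF C s] .
  obtain ht where ht: "ht \<in> HE" "pos ht = Y C 1" "lo ht \<le> X C (-1)" "X C 1 \<le> hi ht" using cell_horizontal[OF C, of 1] by auto
  obtain hb where hb: "hb \<in> HE" "pos hb = Y C (-1)" "lo hb \<le> X C (-1)" "X C 1 \<le> hi hb" using cell_horizontal[OF C, of "-1"] by auto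
  note l = cell_less[OF C] V_less[OF e(1)]
  have x: "X C (-1) \<le> pos e" "pos e \<le> X C 1" using e(2) s l by auto
  have ct: "lo e \<le> Y C 1 \<Longrightarrow> Y C 1 \<le> hi e \<Longrightarrow> Y C 1 = lo e \<or> Y C 1 = hi e"
    using crossing[OF e(1) ht(1)] ht x by auto
  have cb: "lo e \<le> Y C (-1) \<Longrightarrow> Y C (-1) \<le> hi e \<Longrightarrow> Y C (-1) = lo e \<or> Y C (-1) = hi e"
    using crossing[OF e(1) hb(1)] hb x by auto
  have "(Y C (-1) \<le> lo e \<and> hi e \<le> Y C 1) \<or> Y C (-1) = hi e \<or> Y C 1 = lo e"
    by (cases "Y C 1 \<le> hi e"; cases "lo e \<le> Y C (-1)") (use ct cb e(3,4) l in auto)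
  then have "(Y C (-1) \<le> lo e \<and> hi e \<le> Y C 1) \<or> (\<exists>r. (r = 1 \<or> r = -1) \<and> Y C (-r) = tip e r)"
    using exI[of "\<lambda>r. (r = 1 \<or> r = -1) \<and> Y C (-r) = tip e r" 1] exI[of "\<lambda>r. (r = 1 \<or> r = -1) \<and> Y C (-r) = tip e r" "-1"]
    by auto
  then consider (base) "Y C (-1) \<le> lo e" "hi e \<le> Y C 1" | (nar) r where "r = 1 \<or> r = -1" "Y C (-r) = tip e r" by blast
  then show thesis
  proof cases
    case base
    define t where "t = min gap (X C 1 - X C (-1)) / 2"
    have t: "0 < t" "t < gap" "t < X C 1 - X C (-1)" using gap_pos l unfolding t_def by auto
    define z where "z = (pos e - s * t, (lo e + hi e) / 2)"
    have "z \<in> orect C" using t s e(2) base l unfolding z_def orect_def by auto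
    then have "z \<in> inn" using cell_orect[OF C] by blast
    moreover have "z \<in> stripV e (-s)" using t s l unfolding z_def stripV_def by auto
    ultimately have sde: "sd e = - s" using sd_eqI[OF e(1), of "-s" z] s by auto
    then have "role C e 0" unfolding role_def using C e base by simp
    then show thesis by (rule that) (use e(2) sde in auto)
  next
    case nar
    obtain h k where h: "h \<in> HE" "pos h = tip e r" "k = 1 \<or> k = -1" "tip h (-k) = pos e"
      using end_edge[OF e(1) nar(1)] by metis
    have mr: "- r = 1 \<or> - r = -1" using nar(1) by auto
    obtain h' where h': "h' \<in> HE" "pos h' = Y C (-r)" "lo h' \<le> X C (-1)" "X C 1 \<le> hi h'" using cell_horizontal[OF C mr] .
    \<comment> \<open>General position identifies the horizontal edge at this end with the floor or
      ceiling of \<open>C\<close>, so it runs along the cell.\<close>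
    have hh: "h = h'" using H_unique[OF h(1) h'(1)] h(2) h'(2) nar(2) by simp
    have k: "k = - s"
      using h' h(3,4) e(2) s l unfolding hh by (auto split: if_splits)
    define t where "t = min gap (min (X C 1 - X C (-1)) (Y C 1 - Y C (-1))) / 2"
    have t: "0 < t" "t < gap" "t < X C 1 - X C (-1)" "t < Y C 1 - Y C (-1)" using gap_pos l unfolding t_def by auto
    define z where "z = (pos e - s * t, tip e r + r * t)"
    have "z \<in> orect C" using t s e(2) nar l unfolding z_def orect_def by auto
    then have "z \<in> inn" using cell_orect[OF C] by blast
    moreover have "z \<in> halfV e r" using t s nar(1) unfolding z_def halfV_def by auto
    ultimately have "\<not> halfV e r \<subseteq> out" using inn_out by blast
    then have rf: "reflex e r" using convex_corner(1)[OF e(1) nar(1)] by blast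
    then obtain h2 where h2: "h2 \<in> HE" "pos h2 = tip e r" "tip h2 (sd e) = pos e" unfolding reflex_def by blast
    have "h2 = h" using H_unique[OF h2(1) h(1)] h2(2) h(2) by simp
    then have sde: "sd e = s" using h2(3) h(4) k sd_cases[of e] s H_less[OF h(1)] by auto
    have r0: "r \<noteq> 0" using nar(1) by auto
    have "role C e r" unfolding role_def using C e nar(2) rf r0 sde by simp
    then show thesis by (rule that) (use e(2) sde r0 nar(1) in auto)
  qed
qed

text \<open>At a convex end the horizontal edge leaves into the base cell and must therefore be its
  floor or ceiling.\<close>

lemma base_tip:
  assumes "role C e 0" "r = 1 \<or> r = -1" "\<not> reflex e r"
  shows "Y C r = tip e r"
proof -
  have C: "cell C" "e \<in> VE" "X C (- sd e) = pos e" "Y C (-1) \<le> lo e" "hi e \<le> Y C 1" using assms(1) by (auto simp: role_def)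
  obtain h where h: "h \<in> HE" "pos h = tip e r" "tip h (- sd e) = pos e" using convex_corner(3)[OF C(2) assms(2,3)] by blast
  note l = cell_less[OF C(1)] V_less[OF C(2)] H_less[OF h(1)]
  have "\<not> (Y C (-1) < tip e r \<and> tip e r < Y C 1)"
  proof
    assume y: "Y C (-1) < tip e r \<and> tip e r < Y C 1"
    define t where "t = min (hi h - lo h) (X C 1 - X C (-1)) / 2"
    have t: "0 < t" "t < hi h - lo h" "t < X C 1 - X C (-1)" using l unfolding t_def by auto
    have "(pos e + sd e * t, tip e r) \<in> orect C" using t y C(3) sd_cases[of e] unfolding orect_def by auto
    moreover have "(pos e + sd e * t, tip e r) \<in> bd" unfolding bd_iff using h t sd_cases[of e]
      by (intro disjI2 bexI[of _ h]) auto
    ultimately show False using cell_orect[OF C(1)] inn_bd by blast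
  qed
  then show ?thesis using C(4,5) l assms(2) by auto
qed

text \<open>Cells with the same role share interior points: beside the middle of \<open>e\<close>
  for the base role, diagonally off the reflex end for a narrow one.\<close>

lemma role_unique:
  assumes C: "role C e r" and D: "role D e r" shows "C = D"
proof -
  have c: "cell C" "cell D" "e \<in> VE" using C D by (auto simp: role_def)
  note l = cell_less[OF c(1)] cell_less[OF c(2)] V_less[OF c(3)]
  show ?thesis
  proof (cases "r = 0")
    case True
    define t where "t = min (X C 1 - X C (-1)) (X D 1 - X D (-1)) / 2"
    have t: "0 < t" "t < X C 1 - X C (-1)" "t < X D 1 - X D (-1)" using l unfolding t_def by auto
    have "(pos e + sd e * t, (lo e + hi e) / 2) \<in> orect C" "(pos e + sd e * t, (lo e + hi e) / 2) \<in> orect D"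
      using C D t True l by (auto intro!: base_point simp: role_def)
    then show ?thesis using orect_disjoint[OF c(1,2)] by blast
  next
    case False
    then have r: "reflex e r" "X C (sd e) = pos e" "Y C (-r) = tip e r" "X D (sd e) = pos e" "Y D (-r) = tip e r"
      using C D by (auto simp: role_def)
    define t where "t = Min {X C 1 - X C (-1), X D 1 - X D (-1), Y C 1 - Y C (-1), Y D 1 - Y D (-1)} / 2"
    have t: "0 < t" "t < X C 1 - X C (-1)" "t < X D 1 - X D (-1)" "t < Y C 1 - Y C (-1)" "t < Y D 1 - Y D (-1)"
      using l unfolding t_def by auto
    have "(pos e - sd e * t, tip e r + r * t) \<in> orect C" "(pos e - sd e * t, tip e r + r * t) \<in> orect D"
      using r t sd_cases[of e] reflex_sign[OF r(1)] unfolding orect_def by auto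
    then show ?thesis using orect_disjoint[OF c(1,2)] by blast
  qed
qed

text \<open>The cell around a point within \<open>gap\<close> of the middle of \<open>e\<close> must
  have its side on \<open>e\<close>; a side further away would let \<open>e\<close> run through the
  cell.\<close>

lemma base_exists: assumes e: "e \<in> VE" obtains C where "role C e 0"
proof -
  define z where "z = (pos e + sd e * (gap / 2), (lo e + hi e) / 2)"
  have "z \<in> stripV e (sd e)" unfolding z_def using stripV_nonempty[OF e] sd_cases[of e] by blast
  then have z: "z \<in> inn" using sd_inn[OF e] by blast
  have d: "0 < sd e * (fst z - pos e)" "\<bar>fst z - pos e\<bar> < gap" using sd_cases[of e] gap_pos unfolding z_def by auto
  have nv: "pos f \<noteq> fst z" if "f \<in> VE" for f
    using V_gap[OF that e] d by auto
  obtain C where C: "cell C" "z \<in> orect C" using cell_exists[OF z nv] by blast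
  have s: "- sd e = 1 \<or> - sd e = -1" using sd_cases[of e] by auto
  obtain f r where f: "role C f r" "r = 0 \<or> r = 1 \<or> r = -1" "X C (- sd e) = pos f" "sd f = (if r = 0 then - (- sd e) else - sd e)"
    using side_role[OF C(1) s] by metis
  have fV: "f \<in> VE" using f(1) by (simp add: role_def)
  have "pos f = pos e"
  proof (rule ccontr)
    assume ne: "pos f \<noteq> pos e"
    have a: "sd e * (pos f - fst z) < 0" using C(2) f(3) sd_cases[of e] unfolding orect_def by auto
    have "\<not> \<bar>pos f - pos e\<bar> < gap" using V_gap[OF fV e] ne by blast
    then have "sd e * (pos f - pos e) < 0" using a d sd_cases[of e] by auto
    then have "(pos e, snd z) \<in> orect C" using f(3) d C(2) sd_cases[of e] unfolding orect_def by auto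
    moreover have "(pos e, snd z) \<in> bd" unfolding bd_iff z_def using e V_less[OF e] by auto
    ultimately show False using cell_orect[OF C(1)] inn_bd by blast
  qed
  then have fe: "f = e" using V_unique[OF fV e] by simp
  have "r = 0" using f(4) fe sd_cases[of e] by (auto split: if_splits)
  then show thesis using that f(1) fe by blast
qed

text \<open>Take the cell around a point diagonally off the reflex vertex. Its floor or ceiling has
  to be the horizontal edge at that vertex, and since this edge ends at \<open>e\<close>, the cell
  cannot reach beyond the line of \<open>e\<close>.\<close>

lemma narrow_exists: assumes rf: "reflex e r" obtains C where "role C e r"
proof -
  have r: "r = 1 \<or> r = -1" and e: "e \<in> VE" using reflex_sign[OF rf] reflex_VE[OF rf] by auto
  obtain h where h: "h \<in> HE" "pos h = tip e r" "tip h (sd e) = pos e" using rf unfolding reflex_def by blast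
  define z where "z = (pos e - sd e * (gap / 2), tip e r + r * (gap / 2))"
  have "z \<in> halfV e r" unfolding z_def halfV_def using sd_cases[of e] r gap_pos by auto
  then have z: "z \<in> inn" using reflex_corner(1)[OF rf] by blast
  have d: "sd e * (fst z - pos e) < 0" "\<bar>fst z - pos e\<bar> < gap" "0 < r * (snd z - tip e r)" "\<bar>snd z - tip e r\<bar> < gap"
    using sd_cases[of e] gap_pos r unfolding z_def by auto
  have nv: "pos f \<noteq> fst z" if "f \<in> VE" for f
    using V_gap[OF that e] d by auto
  obtain C where C: "cell C" "z \<in> orect C" using cell_exists[OF z nv] by blast
  have mr: "- r = 1 \<or> - r = -1" using r by auto
  obtain k where k: "k \<in> HE" "pos k = Y C (-r)" "lo k \<le> X C (-1)" "X C 1 \<le> hi k" using cell_horizontal[OF C(1) mr] .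
  have kh: "pos k = pos h"
  proof (rule ccontr)
    assume ne: "pos k \<noteq> pos h"
    have a: "r * (pos k - snd z) < 0" using C(2) k(2) r unfolding orect_def by auto
    have "\<not> \<bar>pos k - pos h\<bar> < gap" using H_gap[OF k(1) h(1)] ne by blast
    then have "r * (pos k - tip e r) < 0" using a d r h(2) by auto
    then have "(fst z, tip e r) \<in> orect C" using k(2) d C(2) r unfolding orect_def by auto
    moreover have "(fst z, tip e r) \<in> bd" unfolding bd_iff using h H_length[OF h(1)] d sd_cases[of e]
      by (intro disjI2 bexI[of _ h]) auto
    ultimately show False using cell_orect[OF C(1)] inn_bd by blast
  qed
  then have kh': "k = h" using H_unique k h by blast
  obtain f where f: "f \<in> VE" "pos f = X C (sd e)" using cell_vertical[OF C(1) sd_cases[of e]] by metis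
  have "pos f = pos e"
  proof (rule ccontr)
    assume ne: "pos f \<noteq> pos e"
    have "\<not> \<bar>pos f - pos e\<bar> < gap" using V_gap[OF f(1) e] ne by blast
    moreover have "sd e * (pos f - fst z) > 0" using C(2) f(2) sd_cases[of e] unfolding orect_def by auto
    ultimately have "0 < sd e * (pos f - pos e)" using d sd_cases[of e] by auto
    then show False using k(3,4) f(2) h(3) sd_cases[of e] unfolding kh' by auto
  qed
  then have "role C e r" using C(1) e rf r f(2) kh k(2) h(2) by (auto simp: role_def)
  then show thesis using that by blast
qed

end

section \<open>Doors between cells\<close>

lemma orect_Times: "orect C = {X C (-1)<..<X C 1} \<times> {Y C (-1)<..<Y C 1}"
  unfolding orect_def by auto

lemma crect_Times: "crect C = {X C (-1)..X C 1} \<times> {Y C (-1)..Y C 1}"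
  unfolding crect_def by auto

lemma open_orect: "open (orect C)" unfolding orect_Times by (simp add: open_Times)

lemma closed_crect: "closed (crect C)" unfolding crect_Times by (simp add: closed_Times)

lemma convex_crect: "convex (crect C)" unfolding crect_Times by (simp add: convex_Times)

lemma closure_orect: "X C (-1) < X C 1 \<Longrightarrow> Y C (-1) < Y C 1 \<Longrightarrow> closure (orect C) = crect C"
  unfolding orect_Times crect_Times by (simp add: closure_Times)

context rectilinear
begin

text \<open>Meaningful for \<open>r = 0\<close> and for reflex ends \<open>r\<close>, where
  existence and uniqueness have been shown.\<close>

definition rc :: "seg \<Rightarrow> real \<Rightarrow> cell" where "rc e r = (THE C. role C e r)"

lemma rc_eq: "role C e r \<Longrightarrow> rc e r = C"
  unfolding rc_def by (rule the_equality) (auto intro: role_unique)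

lemma role_base: assumes "e \<in> VE" shows "role (rc e 0) e 0"
proof -
  obtain C where "role C e 0" using base_exists[OF assms] .
  then show ?thesis using rc_eq by simp
qed

lemma role_narrow: assumes "reflex e r" shows "role (rc e r) e r"
proof -
  obtain C where "role C e r" using narrow_exists[OF assms] .
  then show ?thesis using rc_eq by simp
qed

lemma role_cell: "role C e r \<Longrightarrow> cell C" by (simp add: role_def)

definition door_end :: "seg \<Rightarrow> real \<Rightarrow> real" where "door_end e r = Y (rc e r) r"

definition door :: "seg \<Rightarrow> real \<Rightarrow> pt set" where
  "door e r = {z. fst z = pos e \<and> r * tip e r < r * snd z \<and> r * snd z < r * door_end e r}"

lemma base_facts:
  assumes "e \<in> VE"
  shows "cell (rc e 0)" "X (rc e 0) (- sd e) = pos e" "Y (rc e 0) (-1) \<le> lo e" "hi e \<le> Y (rc e 0) 1"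
  using role_base[OF assms] by (auto simp: role_def)

lemma narrow_facts:
  assumes "reflex e r"
  shows "cell (rc e r)" "X (rc e r) (sd e) = pos e" "Y (rc e r) (- r) = tip e r" "r * tip e r < r * door_end e r"
proof -
  have "role (rc e r) e r" by (rule role_narrow[OF assms])
  moreover have "r \<noteq> 0" using reflex_sign[OF assms] by auto
  ultimately show *: "cell (rc e r)" "X (rc e r) (sd e) = pos e" "Y (rc e r) (- r) = tip e r" by (auto simp: role_def)
  show "r * tip e r < r * door_end e r" using cell_less[OF *(1)] *(3) reflex_sign[OF assms] unfolding door_end_def by auto
qed

text \<open>A horizontal edge ending on the line of \<open>e\<close> would be attached to a vertical
  edge on that line, which is \<open>e\<close> by general position; but its level lies beyond
  \<open>e\<close>.\<close>

lemma end_not_beyond: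
  assumes e: "e \<in> VE" and r: "r = 1 \<or> r = -1" and k: "k \<in> HE" "r * tip e r < r * pos k"
    and c: "lo k \<le> pos e" "pos e \<le> hi k"
  shows "lo k < pos e" "pos e < hi k"
proof -
  have "pos e \<noteq> c" if cc: "c = lo k \<or> c = hi k" for c
  proof
    assume "pos e = c"
    then obtain f where f: "f \<in> VE" "pos f = pos e" "pos k = lo f \<or> pos k = hi f" using HV[OF k(1) cc] by blast
    then have "f = e" using V_unique e by blast
    then show False using f k(2) r V_less[OF e] by auto
  qed
  from this[of "lo k"] this[of "hi k"] show "lo k < pos e" "pos e < hi k" using c by auto
qed

text \<open>No other vertical edge lies on this line, and a horizontal edge meeting the door would
  continue into the narrow cell. The side is decided next to the reflex vertex.\<close>

lemma door_inn: assumes rf: "reflex e r" shows "door e r \<subseteq> inn"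
proof -
  have r: "r = 1 \<or> r = -1" and e: "e \<in> VE" using reflex_sign[OF rf] reflex_VE[OF rf] by auto
  note N = narrow_facts[OF rf]
  note l = cell_less[OF N(1)]
  have "door e r \<inter> bd = {}"
  proof (rule ccontr)
    assume "door e r \<inter> bd \<noteq> {}"
    then obtain z where z: "fst z = pos e" "r * tip e r < r * snd z" "r * snd z < r * door_end e r" "z \<in> bd"
      unfolding door_def by auto
    from z(4) consider f where "f \<in> VE" "fst z = pos f" "lo f \<le> snd z" "snd z \<le> hi f"
      | k where "k \<in> HE" "snd z = pos k" "lo k \<le> fst z" "fst z \<le> hi k" unfolding bd_iff by blast
    then show False
    proof cases
      case 1
      then have "f = e" using V_unique e z by simp
      then show False using 1 z(2) r by auto
    next
      case 2
      have kk: "lo k < pos e" "pos e < hi k" using end_not_beyond[OF e r 2(1)] 2 z by auto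
      define t where "t = Min {pos e - lo k, hi k - pos e, X (rc e r) 1 - X (rc e r) (-1)} / 2"
      have t: "0 < t" "t < pos e - lo k" "t < hi k - pos e" "t < X (rc e r) 1 - X (rc e r) (-1)"
        using kk l unfolding t_def by auto
      have "(pos e - sd e * t, snd z) \<in> bd" unfolding bd_iff using 2(1,2) t sd_cases[of e]
        by (intro disjI2 bexI[of _ k]) auto
      moreover have "(pos e - sd e * t, snd z) \<in> orect (rc e r)"
        using t sd_cases[of e] r z N unfolding orect_def door_end_def by auto
      ultimately show False using cell_orect[OF N(1)] inn_bd by blast
    qed
  qed
  moreover have "connected (door e r)"
  proof -
    have "door e r = {pos e} \<times> {y. r * tip e r < r * y \<and> r * y < r * door_end e r}" unfolding door_def by auto
    moreover have "{y. r * tip e r < r * y \<and> r * y < r * door_end e r} = (if r = 1 then {tip e r<..<door_end e r} else {door_end e r<..<tip e r})"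
      using r by auto
    ultimately show ?thesis by (auto intro!: connected_Times)
  qed
  ultimately have d: "door e r \<subseteq> inn \<or> door e r \<subseteq> out" using connected_dichotomy by blast
  define t where "t = min gap (r * door_end e r - r * tip e r) / 2"
  have t: "0 < t" "t < gap" "t < r * door_end e r - r * tip e r" using gap_pos N(4) unfolding t_def by auto
  have "(pos e, tip e r + r * t) \<in> door e r" "(pos e, tip e r + r * t) \<in> halfV e r"
    using t r unfolding door_def halfV_def by auto
  then show ?thesis using d reflex_corner(1)[OF rf] inn_out by blast
qed

text \<open>Both cells of a door end at the same level. If the base cell ended earlier, its
  horizontal edge would block the door; if the narrow cell did, its edge would pass the line of
  \<open>e\<close> and cut the base cell.\<close>

lemma base_door_end: assumes rf: "reflex e r" shows "Y (rc e 0) r = door_end e r"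
proof -
  have r: "r = 1 \<or> r = -1" and e: "e \<in> VE" using reflex_sign[OF rf] reflex_VE[OF rf] by auto
  note N = narrow_facts[OF rf] and W = base_facts[OF e]
  note l = cell_less[OF N(1)] cell_less[OF W(1)] V_less[OF e]
  obtain h where h: "h \<in> HE" "pos h = tip e r" "tip h (sd e) = pos e" using rf unfolding reflex_def by blast
  obtain k where k: "k \<in> HE" "pos k = Y (rc e 0) r" "lo k \<le> X (rc e 0) (-1)" "X (rc e 0) 1 \<le> hi k"
    using cell_horizontal[OF W(1) r] .
  obtain g where g: "g \<in> HE" "pos g = door_end e r" "lo g \<le> X (rc e r) (-1)" "X (rc e r) 1 \<le> hi g"
    using cell_horizontal[OF N(1) r] unfolding door_end_def .
  have ge: "r * tip e r \<le> r * Y (rc e 0) r" using W r by auto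
  have ne: "Y (rc e 0) r \<noteq> tip e r"
  proof
    assume "Y (rc e 0) r = tip e r"
    then have "k = h" using H_unique k h by simp
    then show False using k h W(2) l sd_cases[of e] by auto
  qed
  have "\<not> r * Y (rc e 0) r < r * door_end e r"
  proof
    assume "r * Y (rc e 0) r < r * door_end e r"
    then have "(pos e, Y (rc e 0) r) \<in> door e r" using ge ne r unfolding door_def by auto
    moreover have "(pos e, Y (rc e 0) r) \<in> bd" unfolding bd_iff using k W(2) l sd_cases[of e]
      by (intro disjI2 bexI[of _ k]) auto
    ultimately show False using door_inn[OF rf] inn_bd by blast
  qed
  moreover have "\<not> r * door_end e r < r * Y (rc e 0) r"
  proof
    assume a: "r * door_end e r < r * Y (rc e 0) r"
    have "lo g \<le> pos e" "pos e \<le> hi g" using g N(2) l sd_cases[of e] by auto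
    then have gg: "lo g < pos e" "pos e < hi g" using end_not_beyond[OF e r g(1)] g(2) N(4) by auto
    define t where "t = Min {pos e - lo g, hi g - pos e, X (rc e 0) 1 - X (rc e 0) (-1)} / 2"
    have t: "0 < t" "t < pos e - lo g" "t < hi g - pos e" "t < X (rc e 0) 1 - X (rc e 0) (-1)"
      using gg l unfolding t_def by auto
    have "(pos e + sd e * t, door_end e r) \<in> bd" unfolding bd_iff using g t sd_cases[of e]
      by (intro disjI2 bexI[of _ g]) auto
    moreover have "(pos e + sd e * t, door_end e r) \<in> orect (rc e 0)"
      using t sd_cases[of e] r W a N(4) l unfolding orect_def by auto
    ultimately show False using cell_orect[OF W(1)] inn_bd by blast
  qed
  ultimately show ?thesis using r by auto
qed

lemma cell_closure: "cell C \<Longrightarrow> closure (orect C) = crect C"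
  using closure_orect cell_less by blast

lemma crect_P: "cell C \<Longrightarrow> crect C \<subseteq> P"
  using cell_closure closure_mono[OF cell_orect] closure_inn by metis

lemma orect_crect: "orect C \<subseteq> crect C" unfolding orect_def crect_def by auto

lemma orect_nonempty: assumes "cell C" shows "orect C \<noteq> {}"
proof -
  have "((X C 1 + X C (-1)) / 2, (Y C 1 + Y C (-1)) / 2) \<in> orect C"
    using cell_less[OF assms] unfolding orect_def by auto
  then show ?thesis by blast
qed

lemma orect_crect_eq:
  assumes "cell C" "cell D" "z \<in> orect C" "z \<in> crect D" shows "C = D"
proof -
  have "z \<in> closure (orect D)" using assms cell_closure by blast
  then have "orect C \<inter> orect D \<noteq> {}" using open_Int_closure_eq_empty[OF open_orect] assms(3) by blast
  then show ?thesis using orect_disjoint[OF assms(1,2)] by blast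
qed

lemma finite_cells: "finite {C. cell C}"
proof (rule finite_subset)
  show "{C. cell C} \<subseteq> (\<lambda>(a,b,c,d). Cell a b c d) ` (pos ` VE \<times> pos ` VE \<times> pos ` HE \<times> pos ` HE)"
  proof
    fix C assume "C \<in> {C. cell C}"
    then have C: "cell C" by simp
    have "X C 1 \<in> pos ` VE" "X C (-1) \<in> pos ` VE" "Y C 1 \<in> pos ` HE" "Y C (-1) \<in> pos ` HE"
      using cell_vertical[OF C, of 1] cell_vertical[OF C, of "-1"] cell_horizontal[OF C, of 1] cell_horizontal[OF C, of "-1"]
      by (metis image_eqI)+
    moreover have "C = (\<lambda>(a,b,c,d). Cell a b c d) (X C (-1), X C 1, Y C (-1), Y C 1)" by (intro cell_eqI) auto
    ultimately show "C \<in> (\<lambda>(a,b,c,d). Cell a b c d) ` (pos ` VE \<times> pos ` VE \<times> pos ` HE \<times> pos ` HE)"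
      by (intro image_eqI[of _ _ "(X C (-1), X C 1, Y C (-1), Y C 1)"]) auto
  qed
qed (use finV finH in auto)

text \<open>The finitely many closed rectangles form a closed set, and it contains all interior
  points off the lines of vertical edges, which are dense.\<close>

lemma cells_cover: assumes "p \<in> P" obtains C where "cell C" "p \<in> crect C"
proof -
  let ?U = "\<Union> (crect ` {C. cell C})"
  have cl: "closed ?U" using finite_cells closed_crect by (intro closed_UN) auto
  have "inn \<subseteq> ?U"
  proof (rule ccontr)
    assume "\<not> inn \<subseteq> ?U"
    then obtain z where z: "z \<in> inn - ?U" by blast
    have "open (inn - ?U)" using open_inn cl by (rule open_Diff)
    then obtain d where d: "d > 0" "ball z d \<subseteq> inn - ?U" using z openE[of "inn - ?U" z] by metis
    have "infinite ({fst z<..<fst z + d} - pos ` VE)" using d(1) finV by (simp add: Diff_infinite_finite)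
    then obtain x where x: "fst z < x" "x < fst z + d" "x \<notin> pos ` VE" using not_finite_existsD by (metis (no_types, lifting) DiffD1 DiffD2 all_not_in_conv finite.emptyI greaterThanLessThan_iff)
    have "(x, snd z) \<in> ball z d" using x by (cases z) (auto simp: dist_Pair_Pair dist_real_def)
    then have xi: "(x, snd z) \<in> inn" "(x, snd z) \<notin> ?U" using d(2) by blast+
    obtain C where "cell C" "(x, snd z) \<in> orect C" using cell_exists[OF xi(1)] x(3) by (metis fst_conv image_eqI)
    then show False using xi(2) orect_crect by blast
  qed
  then have "P \<subseteq> ?U" using closure_minimal[OF _ cl] closure_inn by blast
  then show thesis using that assms by blast
qed

section \<open>The adjacency graph of the cells and its cuts\<close>

definition adj :: "cell \<Rightarrow> cell \<Rightarrow> bool" where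
  "adj C D \<longleftrightarrow> (\<exists>e r. reflex e r \<and> (C = rc e 0 \<and> D = rc e r \<or> C = rc e r \<and> D = rc e 0))"

lemma crect_inn_strict:
  assumes C: "cell C" and z: "z \<in> crect C" "z \<in> inn" shows "Y C (-1) < snd z" "snd z < Y C 1"
proof -
  have "snd z \<noteq> Y C r" if r: "r = 1 \<or> r = -1" for r
  proof
    assume a: "snd z = Y C r"
    obtain h where h: "h \<in> HE" "pos h = Y C r" "lo h \<le> X C (-1)" "X C 1 \<le> hi h" using cell_horizontal[OF C r] .
    have "z \<in> bd" unfolding bd_iff using a h z(1) by (intro disjI2 bexI[of _ h]) (auto simp: crect_def)
    then show False using inn_bd z(2) by blast
  qed
  from this[of 1] this[of "-1"] show "Y C (-1) < snd z" "snd z < Y C 1" using z(1) by (auto simp: crect_def)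
qed

text \<open>A shared interior point lies on a vertical side of each cell, and on opposite ones as
  the cells do not overlap. By general position both sides refer to the same edge \<open>e\<close>;
  since the interior side of \<open>e\<close> is fixed, one cell is its base cell and the other a
  narrow one.\<close>

lemma shared_point_adj:
  assumes C: "cell C" and D: "cell D" and ne: "C \<noteq> D" and z: "z \<in> crect C" "z \<in> crect D" "z \<in> inn"
  shows "adj C D"
proof -
  have side: "\<exists>s. (s = 1 \<or> s = -1) \<and> fst z = X A s" if "cell A" "cell B" "A \<noteq> B" "z \<in> crect A" "z \<in> crect B" for A B
  proof (rule ccontr)
    assume "\<not> ?thesis"
    then have "z \<in> orect A" using crect_inn_strict[OF that(1,4) z(3)] that(4) unfolding orect_def crect_def
      by (metis (mono_tags, lifting) mem_Collect_eq order_le_imp_less_or_eq)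
    then show False using orect_crect_eq[OF that(1,2)] that by blast
  qed
  obtain s where s: "s = 1 \<or> s = -1" "fst z = X C s" using side[OF C D ne z(1,2)] by blast
  obtain s' where s': "s' = 1 \<or> s' = -1" "fst z = X D s'" using side[OF D C ne[symmetric] z(2,1)] by blast
  note st = crect_inn_strict[OF C z(1,3)] crect_inn_strict[OF D z(2,3)] cell_less[OF C] cell_less[OF D]
  have "s \<noteq> s'"
  proof
    assume eq: "s = s'"
    define t where "t = min (X C 1 - X C (-1)) (X D 1 - X D (-1)) / 2"
    have t: "0 < t" "t < X C 1 - X C (-1)" "t < X D 1 - X D (-1)" using st unfolding t_def by auto
    have "(fst z - s * t, snd z) \<in> orect C" "(fst z - s * t, snd z) \<in> orect D"
      using t st s s' eq unfolding orect_def by auto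
    then show False using orect_disjoint[OF C D] ne by blast
  qed
  then have ss: "s' = - s" using s s' by auto
  obtain e r where e: "role C e r" "r = 0 \<or> r = 1 \<or> r = -1" "X C s = pos e" "sd e = (if r = 0 then - s else s)"
    using side_role[OF C s(1)] .
  obtain e' r' where e': "role D e' r'" "r' = 0 \<or> r' = 1 \<or> r' = -1" "X D s' = pos e'" "sd e' = (if r' = 0 then - s' else s')"
    using side_role[OF D s'(1)] .
  have "e \<in> VE" "e' \<in> VE" using e(1) e'(1) by (auto simp: role_def)
  then have ee: "e' = e" using V_unique[of e' e] e(3) e'(3) s(2) s'(2) by simp
  have "(r = 0) \<noteq> (r' = 0)" using e(4) e'(4) ee ss s(1) by (auto split: if_splits)
  then show ?thesis
    unfolding adj_def using e(1) e'(1) ee rc_eq[OF e(1)] rc_eq[OF e'(1)]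
    by (cases "r = 0") (auto simp: role_def)
qed

text \<open>Induction along adjacency. Otherwise the cells inside and outside \<open>A\<close> would
  cover the connected interior by two closed sets without a common interior point.\<close>

lemma cells_connected:
  assumes A: "A \<subseteq> {C. cell C}" "A \<noteq> {}" and cl: "\<And>C D. C \<in> A \<Longrightarrow> cell D \<Longrightarrow> adj C D \<Longrightarrow> D \<in> A"
  shows "A = {C. cell C}"
proof (rule ccontr)
  assume n: "A \<noteq> {C. cell C}"
  define B where "B = {C. cell C} - A"
  let ?U = "\<Union> (crect ` A)" and ?V = "\<Union> (crect ` B)"
  have fin: "finite A" "finite B" using A finite_cells finite_subset unfolding B_def by auto
  have clo: "closed ?U" "closed ?V" using fin closed_crect by (auto intro!: closed_UN)
  have disj: "?U \<inter> ?V \<inter> inn = {}"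
  proof (rule ccontr)
    assume "?U \<inter> ?V \<inter> inn \<noteq> {}"
    then obtain z C D where "z \<in> inn" "C \<in> A" "D \<in> B" "z \<in> crect C" "z \<in> crect D" by blast
    then show False using shared_point_adj[of C D z] cl[of C D] A unfolding B_def by blast
  qed
  have cov: "inn \<subseteq> ?U \<union> ?V"
  proof
    fix z assume "z \<in> inn"
    then obtain C where "cell C" "z \<in> crect C" using cells_cover P_def by blast
    then show "z \<in> ?U \<union> ?V" unfolding B_def by blast
  qed
  have "?U \<inter> inn = {} \<or> ?V \<inter> inn = {}"
    using connected_closedD[OF inn_conn disj cov clo] by blast
  moreover have "\<exists>z. z \<in> crect C \<inter> inn" if "cell C" for C
    using orect_nonempty[OF that] orect_crect cell_orect[OF that] by blast
  ultimately have "A = {} \<or> B = {}" using A unfolding B_def by blast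
  then show False using A n unfolding B_def by blast
qed

lemma door_in_cells:
  assumes rf: "reflex e r" and z: "z \<in> door e r"
  shows "z \<in> crect (rc e 0)" "z \<in> crect (rc e r)"
proof -
  have r: "r = 1 \<or> r = -1" and e: "e \<in> VE" using reflex_sign[OF rf] reflex_VE[OF rf] by auto
  note N = narrow_facts[OF rf] and W = base_facts[OF e] and T = base_door_end[OF rf]
  note l = cell_less[OF N(1)] cell_less[OF W(1)] V_less[OF e]
  have d: "fst z = pos e" "r * tip e r < r * snd z" "r * snd z < r * door_end e r" using z by (auto simp: door_def)
  show "z \<in> crect (rc e 0)" using d T W l r sd_cases[of e] unfolding crect_def by auto
  show "z \<in> crect (rc e r)" using d N l r sd_cases[of e] unfolding crect_def door_end_def by auto
qed

lemma door_nonempty: assumes rf: "reflex e r" shows "(pos e, (tip e r + door_end e r) / 2) \<in> door e r"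
  using narrow_facts(4)[OF rf] reflex_sign[OF rf] unfolding door_def by auto

lemma door_orect: assumes rf: "reflex e r" and C: "cell C" shows "door e r \<inter> orect C = {}"
proof (rule ccontr)
  assume "door e r \<inter> orect C \<noteq> {}"
  then obtain z where z: "z \<in> door e r" "z \<in> orect C" by blast
  have "C = rc e r" using orect_crect_eq[OF C narrow_facts(1)[OF rf] z(2)] door_in_cells[OF rf z(1)] by blast
  then show False using z narrow_facts(2)[OF rf] sd_cases[of e] unfolding door_def orect_def by auto
qed

lemma door_segment: assumes rf: "reflex e r" shows "open_segment (pos e, tip e r) (pos e, door_end e r) = door e r"
proof -
  have r: "r = 1 \<or> r = -1" using reflex_sign[OF rf] by auto
  note N = narrow_facts(4)[OF rf]
  have ne: "(pos e, tip e r) \<noteq> (pos e, door_end e r)" using N by auto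
  show ?thesis
  proof
    show "open_segment (pos e, tip e r) (pos e, door_end e r) \<subseteq> door e r"
    proof
      fix z assume "z \<in> open_segment (pos e, tip e r) (pos e, door_end e r)"
      then obtain u where u: "0 < u" "u < 1" "z = (1 - u) *\<^sub>R (pos e, tip e r) + u *\<^sub>R (pos e, door_end e r)"
        using ne unfolding in_segment by blast
      have "snd z = tip e r + u * (door_end e r - tip e r)" "fst z = pos e" unfolding u(3) by (auto simp: algebra_simps)
      moreover have "0 < u * (r * door_end e r - r * tip e r)" "u * (r * door_end e r - r * tip e r) < r * door_end e r - r * tip e r"
        using u(1,2) N by (auto simp: mult_less_cancel_right1)
      ultimately show "z \<in> door e r" using r unfolding door_def by (auto simp: algebra_simps)
    qed
    show "door e r \<subseteq> open_segment (pos e, tip e r) (pos e, door_end e r)"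
    proof
      fix z assume z: "z \<in> door e r"
      define u where "u = (snd z - tip e r) / (door_end e r - tip e r)"
      have "0 < u" "u < 1" using z N r unfolding u_def door_def by (auto simp: field_simps)
      moreover have "u * (door_end e r - tip e r) = snd z - tip e r" using N unfolding u_def by auto
      then have "z = (1 - u) *\<^sub>R (pos e, tip e r) + u *\<^sub>R (pos e, door_end e r)"
        using z unfolding door_def by (auto simp: prod_eq_iff algebra_simps)
      ultimately show "z \<in> open_segment (pos e, tip e r) (pos e, door_end e r)" using ne unfolding in_segment by blast
    qed
  qed
qed

lemma door_ends_bd: assumes rf: "reflex e r" shows "(pos e, tip e r) \<in> bd" "(pos e, door_end e r) \<in> bd"
proof -
  have r: "r = 1 \<or> r = -1" and e: "e \<in> VE" using reflex_sign[OF rf] reflex_VE[OF rf] by auto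
  show "(pos e, tip e r) \<in> bd" unfolding bd_iff using e V_less[OF e] r by (intro disjI1 bexI[of _ e]) auto
  note N = narrow_facts[OF rf]
  obtain g where g: "g \<in> HE" "pos g = door_end e r" "lo g \<le> X (rc e r) (-1)" "X (rc e r) 1 \<le> hi g"
    using cell_horizontal[OF N(1) r] unfolding door_end_def .
  then show "(pos e, door_end e r) \<in> bd" unfolding bd_iff using N(2) cell_less[OF N(1)] sd_cases[of e]
    by (intro disjI2 bexI[of _ g]) auto
qed

lemma doors_disjoint:
  assumes "reflex e r" "reflex e' r'" "z \<in> door e r" "z \<in> door e' r'" shows "e = e' \<and> r = r'"
proof -
  have "e = e'" using V_unique[of e e'] assms reflex_VE unfolding door_def by auto
  moreover have "r = r'"
    using assms reflex_sign[OF assms(1)] reflex_sign[OF assms(2)] V_less[OF reflex_VE[OF assms(1)]] unfolding \<open>e = e'\<close> door_def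
    by auto
  ultimately show ?thesis by blast
qed

text \<open>Each open cell lies in one of the two parts cut off by the door, which gives the
  colouring. Another door has its midpoint in an open part and in the closure of both its cells, so
  these agree in colour. If the two cells of the given door agreed, the other part could not
  accumulate at the door.\<close>

lemma door_cut:
  assumes rf: "reflex e r"
  shows "\<exists>\<kappa>::cell \<Rightarrow> bool. \<kappa> (rc e 0) \<noteq> \<kappa> (rc e r) \<and>
    (\<forall>e' r'. reflex e' r' \<longrightarrow> (e', r') \<noteq> (e, r) \<longrightarrow> \<kappa> (rc e' 0) = \<kappa> (rc e' r'))"
proof -
  have r: "r = 1 \<or> r = -1" and e: "e \<in> VE" using reflex_sign[OF rf] reflex_VE[OF rf] by auto
  have "(pos e, tip e r) \<noteq> (pos e, door_end e r)" using narrow_facts(4)[OF rf] by auto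
  then obtain A B where AB: "open A" "open B" "A \<inter> B = {}" "A \<union> B = inn - door e r" "door e r \<subseteq> closure A" "door e r \<subseteq> closure B"
    using separates[OF door_ends_bd[OF rf]] door_inn[OF rf] unfolding door_segment[OF rf] by auto
  have side: "orect C \<subseteq> A \<or> orect C \<subseteq> B" if "cell C" for C
  proof -
    have "orect C \<subseteq> A \<union> B" using AB(4) cell_orect[OF that] door_orect[OF rf that] by blast
    then show ?thesis using connectedD[OF connected_orect AB(1,2)] AB(3) by blast
  qed
  note N = narrow_facts[OF rf] and W = base_facts[OF e] and T = base_door_end[OF rf]
  note l = cell_less[OF N(1)] cell_less[OF W(1)] V_less[OF e]
  have both: False if sub: "orect (rc e 0) \<subseteq> Q" "orect (rc e r) \<subseteq> Q" and R: "Q \<inter> R = {}" "door e r \<subseteq> closure R" "R \<inter> door e r = {}" for Q R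
  proof -
    let ?m = "(pos e, (tip e r + door_end e r) / 2)"
    have m: "?m \<in> door e r" by (rule door_nonempty[OF rf])
    \<comment> \<open>Within distance \<open>t\<close> of the midpoint there is nothing but the door
      and its two cells.\<close>
    define t where "t = Min {X (rc e 0) 1 - X (rc e 0) (-1), X (rc e r) 1 - X (rc e r) (-1), r * door_end e r - r * tip e r} / 2"
    have t: "0 < t" "t < X (rc e 0) 1 - X (rc e 0) (-1)" "t < X (rc e r) 1 - X (rc e r) (-1)" "t \<le> (r * door_end e r - r * tip e r) / 2"
      using l N(4) unfolding t_def by auto
    obtain z where z: "z \<in> R" "dist z ?m < t" using R(2) m t(1) unfolding closure_approachable by (meson closure_approachable subsetD)
    have c: "\<bar>fst z - pos e\<bar> < t" "\<bar>snd z - (tip e r + door_end e r) / 2\<bar> < t" using dist_coords[of ?m z t] z(2) by (auto simp: dist_commute)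
    have h: "r * tip e r < r * snd z" "r * snd z < r * door_end e r" using c(2) t(4) r by (auto simp: abs_if field_simps split: if_splits)
    consider "fst z = pos e" | "0 < sd e * (fst z - pos e)" | "sd e * (fst z - pos e) < 0" using sd_cases[of e] by force
    then show False
    proof cases
      case 1
      then have "z \<in> door e r" using h unfolding door_def by auto
      then show False using z(1) R(3) by blast
    next
      case 2
      then have "z \<in> orect (rc e 0)" using h c(1) t T W l r sd_cases[of e] unfolding orect_def by auto
      then show False using z(1) R(1) sub by blast
    next
      case 3
      then have "z \<in> orect (rc e r)" using h c(1) t N l r sd_cases[of e] unfolding orect_def door_end_def by auto
      then show False using z(1) R(1) sub by blast
    qed
  qed
  define \<kappa> where "\<kappa> C \<longleftrightarrow> orect C \<subseteq> A" for C
  show ?thesis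
  proof (intro exI[of _ \<kappa>] conjI allI impI)
    have dA: "A \<inter> door e r = {}" "B \<inter> door e r = {}" using AB(4) by blast+
    have "B \<inter> A = {}" using AB(3) by blast
    then show "\<kappa> (rc e 0) \<noteq> \<kappa> (rc e r)"
      using both[of A B] both[of B A] AB(3,5,6) dA side[OF N(1)] side[OF W(1)] unfolding \<kappa>_def by blast
  next
    fix e' r' assume rf': "reflex e' r'" and ne: "(e', r') \<noteq> (e, r)"
    let ?m = "(pos e', (tip e' r' + door_end e' r') / 2)"
    have m: "?m \<in> door e' r'" by (rule door_nonempty[OF rf'])
    then have "?m \<in> A \<union> B" using AB(4) door_inn[OF rf'] doors_disjoint[OF rf rf'] ne by blast
    have cl: "?m \<in> closure (orect (rc e' 0))" "?m \<in> closure (orect (rc e' r'))"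
      using door_in_cells[OF rf' m] cell_closure[OF base_facts(1)[OF reflex_VE[OF rf']]] cell_closure[OF narrow_facts(1)[OF rf']] by auto
    have meet: "Q \<inter> orect (rc e' 0) \<noteq> {} \<and> Q \<inter> orect (rc e' r') \<noteq> {}" if "open Q" "?m \<in> Q" for Q
      using cl that by (metis closure_iff_nhds_not_empty inf.idem inf_commute order_refl)
    have ss: "orect (rc e' 0) \<subseteq> A \<or> orect (rc e' 0) \<subseteq> B" "orect (rc e' r') \<subseteq> A \<or> orect (rc e' r') \<subseteq> B"
      using side base_facts(1)[OF reflex_VE[OF rf']] narrow_facts(1)[OF rf'] by auto
    show "\<kappa> (rc e' 0) = \<kappa> (rc e' r')"
      unfolding \<kappa>_def using \<open>?m \<in> A \<union> B\<close> meet[OF AB(1)] meet[OF AB(2)] ss AB(3) by blast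
  qed
qed

section \<open>Cells as components of the interior cut along the verticals\<close>

definition RV :: "pt set" where "RV = {(pos e, tip e r) |e r. reflex e r}"

text \<open>To get from its vertex into an open cell, a vertical chord would have to pass through
  the relative interior of the floor or ceiling edge, which has outside points right behind
  it.\<close>

lemma chord_misses_orect:
  assumes rf: "reflex e r" and C: "cell C"
  shows "vertical_chord P (pos e, tip e r) \<inter> orect C = {}"
proof (rule ccontr)
  let ?v = "(pos e, tip e r)"
  let ?K = "vertical_chord P ?v"
  have r: "r = 1 \<or> r = -1" and e: "e \<in> VE" using reflex_sign[OF rf] reflex_VE[OF rf] by auto
  assume "?K \<inter> orect C \<noteq> {}"
  then obtain z where z: "z \<in> ?K" "z \<in> orect C" by blast
  have sub: "?K \<subseteq> {x\<in>P. fst x = pos e}" unfolding vertical_chord_def using connected_component_subset by force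
  have vb: "?v \<in> bd" by (rule door_ends_bd[OF rf])
  have vK: "?v \<in> ?K" unfolding vertical_chord_def using vb P_def by simp
  have con: "connected (snd ` ?K)" unfolding vertical_chord_def
    by (intro connected_continuous_image continuous_intros) simp
  have fz: "fst z = pos e" using z sub by auto
  have "?v \<notin> orect C" using vb inn_bd cell_orect[OF C] by blast
  then have "Y C 1 \<le> tip e r \<or> tip e r \<le> Y C (-1)"
    using z(2) fz unfolding orect_def by (auto simp: not_less)
  then have "\<exists>q. (q = 1 \<or> q = -1) \<and> q * Y C q \<le> q * tip e r"
    by (metis mult_1 mult_minus1 neg_le_iff_le)
  \<comment> \<open>\<open>q\<close> tells whether the ceiling or the floor separates the vertex
    from the cell.\<close>
  then obtain q where q: "q = 1 \<or> q = -1" "q * Y C q \<le> q * tip e r" by blast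
  obtain k where k: "k \<in> HE" "pos k = Y C q" "lo k \<le> X C (-1)" "X C 1 \<le> hi k" using cell_horizontal[OF C q(1)] .
  have ke: "lo k < pos e" "pos e < hi k" using k z(2) fz unfolding orect_def by auto
  have "tip e r \<noteq> Y C q"
  proof
    assume "tip e r = Y C q"
    then have "pos e = lo k \<or> pos e = hi k" using crossing[OF e k(1)] k(2) ke r V_less[OF e] by auto
    then show False using ke by auto
  qed
  then have lt: "q * Y C q < q * tip e r" using q by auto
  note l = cell_less[OF C]
  define t where "t = Min {gap, q * tip e r - q * Y C q, Y C 1 - Y C (-1)} / 2"
  have t: "0 < t" "t < gap" "t < q * tip e r - q * Y C q" "t < Y C 1 - Y C (-1)"
    using lt gap_pos l unfolding t_def by auto
  have "Y C q + q * t \<in> snd ` ?K"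
  proof -
    have 1: "snd z \<in> snd ` ?K" "tip e r \<in> snd ` ?K" using z(1) vK by force+
    have "q * snd z < q * Y C q" using z(2) q(1) unfolding orect_def by auto
    then have "(snd z \<le> Y C q + q * t \<and> Y C q + q * t \<le> tip e r) \<or> (tip e r \<le> Y C q + q * t \<and> Y C q + q * t \<le> snd z)"
      using t(1,3) q(1) by auto
    then show ?thesis using connectedD_interval[OF con 1] connectedD_interval[OF con 1(2,1)] by blast
  qed
  then obtain w where w: "w \<in> ?K" "snd w = Y C q + q * t" by auto
  then have wP: "w \<in> P" "fst w = pos e" using sub by auto
  have "w \<in> stripH k q" using w(2) wP(2) k(2) ke t q(1) unfolding stripH_def by auto
  moreover have "(pos e, Y C q - q * t) \<in> stripH k (- q)" "(pos e, Y C q - q * t) \<in> orect C"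
    using k(2) ke t q(1) z(2) fz unfolding stripH_def orect_def by auto
  then have "\<not> stripH k (-q) \<subseteq> out" using cell_orect[OF C] inn_out by blast
  then have "stripH k q \<subseteq> out" using stripH_sides[OF k(1)] q(1) by auto
  ultimately show False using out_P wP(1) by blast
qed

text \<open>For the base role, an interior point of the side lies beyond an end of \<open>e\<close>,
  which is reflex by \<open>base_tip\<close>; for a narrow role the reflex vertex is a corner of the
  cell. Either way the segment from the vertex to the point stays in the side.\<close>

lemma side_in_chord:
  assumes C: "cell C" and s: "s = 1 \<or> s = -1" and z: "z \<in> inn" "z \<in> crect C" "fst z = X C s"
  shows "\<exists>v\<in>RV. z \<in> vertical_chord P v"
proof -
  note st = crect_inn_strict[OF C z(2,1)]
  obtain e p where e: "role C e p" "p = 0 \<or> p = 1 \<or> p = -1" "X C s = pos e" "sd e = (if p = 0 then - s else s)"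
    using side_role[OF C s] .
  have eV: "e \<in> VE" using e(1) by (simp add: role_def)
  have "\<exists>r. reflex e r \<and> (pos e, tip e r) \<in> crect C"
  proof (cases "p = 0")
    case True
    then have Y: "Y C (-1) \<le> lo e" "hi e \<le> Y C 1" using e(1) by (auto simp: role_def)
    have "\<not> (lo e \<le> snd z \<and> snd z \<le> hi e)" using z e(3) eV inn_bd unfolding bd_iff by metis
    then obtain r where r: "r = 1 \<or> r = -1" "r * tip e r < r * snd z" by (metis mult_1 mult_minus1 neg_less_iff_less not_le tip_simps)
    have "reflex e r"
    proof (rule ccontr)
      assume "\<not> reflex e r"
      then have "Y C r = tip e r" using base_tip e(1) True r(1) by blast
      then show False using r st by auto
    qed
    moreover have "(pos e, tip e r) \<in> crect C" using Y r(1) V_less[OF eV] e(3) s cell_less[OF C] unfolding crect_def by auto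
    ultimately show ?thesis by blast
  next
    case False
    then have "reflex e p" "Y C (-p) = tip e p" using e(1) by (auto simp: role_def)
    moreover have "(pos e, tip e p) \<in> crect C"
      using calculation e(2,3) False s cell_less[OF C] unfolding crect_def by auto
    ultimately show ?thesis by blast
  qed
  then obtain r where r: "reflex e r" "(pos e, tip e r) \<in> crect C" by blast
  let ?v = "(pos e, tip e r)"
  have "closed_segment ?v z \<subseteq> crect C" using convex_crect r(2) z(2) by (simp add: closed_segment_subset)
  moreover have "fst x = pos e" if xs: "x \<in> closed_segment ?v z" for x
  proof -
    obtain u where "x = (1 - u) *\<^sub>R ?v + u *\<^sub>R z" using xs unfolding in_segment by blast
    then show ?thesis using z(3) e(3) by (simp add: algebra_simps)
  qed
  ultimately have seg: "closed_segment ?v z \<subseteq> {x\<in>P. fst x = fst ?v}" using crect_P[OF C] by auto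
  have "connected_component {x\<in>P. fst x = fst ?v} ?v z"
    unfolding connected_component_def
    by (rule exI[of _ "closed_segment ?v z"]) (intro conjI connected_segment seg ends_in_segment)
  then have "z \<in> vertical_chord P ?v" unfolding vertical_chord_def by simp
  then show ?thesis unfolding RV_def using r(1) by blast
qed

text \<open>A larger connected set would contain a frontier point of the rectangle, but such points
  are on the boundary or on a chord.\<close>

lemma orect_component:
  assumes C: "cell C"
  shows "orect C \<in> components (inn - \<Union> (vertical_chord P ` RV))"
proof -
  let ?S = "inn - \<Union> (vertical_chord P ` RV)"
  have sub: "orect C \<subseteq> ?S" using cell_orect[OF C] chord_misses_orect[OF _ C] unfolding RV_def by fastforce
  have side: "z \<notin> ?S" if z: "z \<in> crect C" "z \<notin> orect C" for z
  proof
    assume S: "z \<in> ?S"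
    then have "Y C (-1) < snd z" "snd z < Y C 1" using crect_inn_strict[OF C z(1)] by auto
    then obtain s where "s = 1 \<or> s = -1" "fst z = X C s"
      using z unfolding orect_def crect_def by (metis (mono_tags, lifting) mem_Collect_eq order_le_imp_less_or_eq)
    then show False using side_in_chord[OF C _ _ z(1)] S by blast
  qed
  have "K = orect C" if K: "orect C \<subseteq> K" "K \<subseteq> ?S" "connected K" for K
  proof (rule ccontr)
    assume "K \<noteq> orect C"
    then have "K - orect C \<noteq> {}" "K \<inter> orect C \<noteq> {}" using K(1) orect_nonempty[OF C] by blast+
    then have "K \<inter> frontier (orect C) \<noteq> {}" using connected_Int_frontier[OF K(3)] by blast
    moreover have "frontier (orect C) = crect C - orect C"
      unfolding frontier_def cell_closure[OF C] using open_orect by (simp add: interior_open)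
    ultimately show False using side K(2) by blast
  qed
  then show ?thesis unfolding in_components_maximal using sub connected_orect orect_nonempty[OF C] by blast
qed

end

section \<open>Local moves between cells\<close>

context rectilinear
begin

text \<open>Even at a convex end the exterior side is entirely outside the polygon; only reflex ends
  break the wall.\<close>

lemma vertical_wall:
  assumes e: "e \<in> VE" and x: "fst x = pos e" "lo e \<le> snd x" "snd x \<le> hi e"
    and nr: "\<And>r. reflex e r \<Longrightarrow> snd x \<noteq> tip e r"
  shows "\<exists>\<epsilon>>0. \<forall>z. dist x z < \<epsilon> \<longrightarrow> 0 < - sd e * (fst z - fst x) \<longrightarrow> z \<notin> P"
proof -
  consider r where "r = 1 \<or> r = -1" "snd x = tip e r" | "lo e < snd x" "snd x < hi e"
    using x by (metis order_le_imp_less_or_eq tip_simps)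
  then show ?thesis
  proof cases
    case 1
    then have "halfH e r (- sd e) \<subseteq> out" using convex_corner(2)[OF e] nr by blast
    moreover have "z \<in> halfH e r (- sd e)" if "dist x z < gap" "0 < - sd e * (fst z - fst x)" for z
      using dist_coords[OF that(1)] that(2) 1(2) x(1) sd_cases[of e] unfolding halfH_def by auto
    ultimately show ?thesis using gap_pos out_P by (intro exI[of _ gap]) blast
  next
    case 2
    define \<epsilon> where "\<epsilon> = Min {gap, snd x - lo e, hi e - snd x}"
    have eps: "0 < \<epsilon>" "\<epsilon> \<le> gap" "\<epsilon> \<le> snd x - lo e" "\<epsilon> \<le> hi e - snd x" using 2 gap_pos unfolding \<epsilon>_def by auto
    have "z \<in> stripV e (- sd e)" if "dist x z < \<epsilon>" "0 < - sd e * (fst z - fst x)" for z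
      using dist_coords[OF that(1)] that(2) eps x(1) sd_cases[of e] unfolding stripV_def by auto
    then show ?thesis using eps(1) sd_out[OF e] out_P by (intro exI[of _ \<epsilon>]) blast
  qed
qed

text \<open>The floor of a narrow cell is a wall up to the door. Only its far end is delicate: if
  the floor edge stops there, the vertex must be convex, which is the reason for
  \<open>nb\<close>.\<close>

lemma horizontal_wall:
  assumes rf: "reflex e r" and x: "snd x = tip e r" "sd e * X (rc e r) (- sd e) \<le> sd e * fst x" "sd e * fst x < sd e * pos e"
    and nb: "x \<notin> RV \<or> sd e * X (rc e r) (- sd e) < sd e * fst x"
  shows "x \<in> bd" "\<exists>\<epsilon>>0. \<forall>z. dist x z < \<epsilon> \<longrightarrow> 0 < - r * (snd z - snd x) \<longrightarrow> z \<notin> P"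
proof -
  have r: "r = 1 \<or> r = -1" and e: "e \<in> VE" using reflex_sign[OF rf] reflex_VE[OF rf] by auto
  note N = narrow_facts[OF rf]
  note l = cell_less[OF N(1)]
  have mr: "- r = 1 \<or> - r = -1" using r by auto
  obtain h where h: "h \<in> HE" "pos h = tip e r" "lo h \<le> X (rc e r) (-1)" "X (rc e r) 1 \<le> hi h"
    using cell_horizontal[OF N(1) mr] N(3) by metis
  have hx: "lo h \<le> fst x" "fst x \<le> hi h" using x(2,3) h(3,4) N(2) sd_cases[of e] by auto
  show "x \<in> bd" unfolding bd_iff using h hx x(1) by (intro disjI2 bexI[of _ h]) auto
  define t where "t = Min {gap, X (rc e r) 1 - X (rc e r) (-1), Y (rc e r) 1 - Y (rc e r) (-1)} / 2"
  have t: "0 < t" "t < gap" "t < X (rc e r) 1 - X (rc e r) (-1)" "t < Y (rc e r) 1 - Y (rc e r) (-1)"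
    using l gap_pos unfolding t_def by auto
  show "\<exists>\<epsilon>>0. \<forall>z. dist x z < \<epsilon> \<longrightarrow> 0 < - r * (snd z - snd x) \<longrightarrow> z \<notin> P"
  proof (cases "lo h < fst x \<and> fst x < hi h")
    case True
    define \<epsilon> where "\<epsilon> = Min {gap, fst x - lo h, hi h - fst x}"
    have eps: "0 < \<epsilon>" "\<epsilon> \<le> gap" "\<epsilon> \<le> fst x - lo h" "\<epsilon> \<le> hi h - fst x" using True gap_pos unfolding \<epsilon>_def by auto
    let ?w = "(X (rc e r) (-1) + t, tip e r + r * t)"
    have "?w \<in> orect (rc e r)" using t l N(3) r unfolding orect_def by auto
    then have "?w \<in> inn" using cell_orect[OF N(1)] by blast
    moreover have "?w \<in> stripH h r" using t h l r unfolding stripH_def by auto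
    ultimately have "\<not> stripH h r \<subseteq> out" using inn_out by blast
    then have "stripH h (- r) \<subseteq> out" using stripH_sides[OF h(1)] r by auto
    moreover have "z \<in> stripH h (- r)" if "dist x z < \<epsilon>" "0 < - r * (snd z - snd x)" for z
      using dist_coords[OF that(1)] that(2) eps x(1) h(2) r unfolding stripH_def by auto
    ultimately show ?thesis using eps(1) out_P by (intro exI[of _ \<epsilon>]) blast
  next
    case False
    then have xe: "fst x = lo h \<or> fst x = hi h" using hx by auto
    obtain f where f: "f \<in> VE" "pos f = fst x" "pos h = lo f \<or> pos h = hi f" using HV[OF h(1) xe] by blast
    then obtain q where q: "q = 1 \<or> q = -1" "pos h = tip f q" by (metis tip_simps)
    have eq: "fst x = X (rc e r) (- sd e)" using xe x(2,3) h(3,4) N(2) sd_cases[of e] l by auto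
    have nrf: "\<not> reflex f q"
    proof
      assume "reflex f q"
      moreover have "x = (pos f, tip f q)" using f(2) q(2) h(2) x(1) by (simp add: prod_eq_iff)
      ultimately have "x \<in> RV" unfolding RV_def by blast
      then show False using nb eq by simp
    qed
    have ho: "halfV f q \<subseteq> out" using convex_corner(1)[OF f(1) q(1) nrf] .
    \<comment> \<open>The area beyond the end \<open>q\<close> of \<open>f\<close> is outside, so it
      cannot be the one containing the narrow cell; hence it lies behind the floor.\<close>
    have "q = - r"
    proof (rule ccontr)
      assume "q \<noteq> - r"
      then have qr: "q = r" using q r by auto
      let ?w = "(fst x + sd e * t, tip e r + r * t)"
      have "?w \<in> orect (rc e r)" using t l N(3) r eq sd_cases[of e] unfolding orect_def by auto
      then have "?w \<in> inn" using cell_orect[OF N(1)] by blast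
      moreover have "?w \<in> halfV f q" using t f(2) q(2) h(2) qr r sd_cases[of e] unfolding halfV_def by auto
      ultimately show False using ho inn_out by blast
    qed
    then have "z \<in> halfV f q" if "dist x z < gap" "0 < - r * (snd z - snd x)" for z
      using dist_coords[OF that(1)] that(2) x(1) h(2) q(2) f(2) r unfolding halfV_def by auto
    then show ?thesis using gap_pos ho out_P by (intro exI[of _ gap]) blast
  qed
qed

text \<open>\<open>W1\<close>, \<open>WT\<close>, \<open>U2\<close> and \<open>U1\<close> are the
  extents of the two cells in coordinates centred at the reflex vertex. \<open>WT\<close> serves
  both cells because they end at the same level.\<close>

definition W1 where "W1 e r = r * (Y (rc e 0) (- r) - tip e r)"
definition WT where "WT e r = r * (door_end e r - tip e r)"
definition U2 where "U2 e = X (rc e 0) 1 - X (rc e 0) (-1)"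
definition U1 where "U1 e r = X (rc e r) (-1) - X (rc e r) 1"

lemma crect_base: assumes rf: "reflex e r" shows "crect (rc e 0) = box_at (pos e, tip e r) (sd e) r 0 (U2 e) (W1 e r) (WT e r)"
  using base_facts[OF reflex_VE[OF rf]] base_door_end[OF rf] reflex_sign[OF rf] sd_cases[of e]
  unfolding crect_def box_at_def W1_def WT_def U2_def by (elim disjE) auto

lemma crect_narrow: assumes rf: "reflex e r" shows "crect (rc e r) = box_at (pos e, tip e r) (sd e) r (U1 e r) 0 0 (WT e r)"
  using narrow_facts[OF rf] reflex_sign[OF rf] sd_cases[of e]
  unfolding crect_def box_at_def U1_def WT_def door_end_def by (elim disjE) auto

lemma box_sizes: assumes rf: "reflex e r" shows "U1 e r \<le> 0" "0 \<le> U2 e" "W1 e r \<le> 0" "0 \<le> WT e r"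
  using cell_less[OF narrow_facts(1)[OF rf]] base_facts[OF reflex_VE[OF rf]] cell_less[OF base_facts(1)[OF reflex_VE[OF rf]]]
    reflex_sign[OF rf] narrow_facts(4)[OF rf] V_less[OF reflex_VE[OF rf]]
  unfolding U1_def U2_def W1_def WT_def by auto

text \<open>The three cells may coincide, so shorter moves are covered as well.\<close>

definition loc :: "pt \<Rightarrow> pt \<Rightarrow> bool" where
  "loc p q \<longleftrightarrow> (\<exists>C D E. cell C \<and> cell D \<and> cell E \<and> attracts_within P q p (crect C \<union> crect D \<union> crect E))"

lemma loc_straight:
  assumes "cell C" "cell D" "cell E" "closed_segment p q \<subseteq> crect C \<union> crect D \<union> crect E"
  shows "loc p q"
proof -
  have "closed_segment p q \<subseteq> P" using assms(4) crect_P[OF assms(1)] crect_P[OF assms(2)] crect_P[OF assms(3)] by blast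
  then have "attracts_within P q p (crect C \<union> crect D \<union> crect E)" using assms(4) by (rule attracts_within_straight)
  then show ?thesis unfolding loc_def using assms(1-3) by blast
qed

lemma loc_cell: assumes "cell C" "p \<in> crect C" "q \<in> crect C" shows "loc p q"
proof -
  have "closed_segment p q \<subseteq> crect C" using convex_crect assms(2,3) by (simp add: closed_segment_subset)
  then show ?thesis using loc_straight[OF assms(1) assms(1) assms(1)] by blast
qed

lemma loc_narrow_base:
  assumes rf: "reflex e r" and p: "p \<in> crect (rc e r)" and q: "q \<in> crect (rc e 0)"
    and nb: "\<not> (p \<in> RV \<and> fst p = X (rc e r) (- sd e) \<and> snd p = tip e r)"
  shows "loc p q"
proof -
  have r: "r = 1 \<or> r = -1" and e: "e \<in> VE" using reflex_sign[OF rf] reflex_VE[OF rf] by auto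
  note N = narrow_facts[OF rf] and W = base_facts[OF e]
  have pX: "sd e * X (rc e r) (- sd e) \<le> sd e * fst p" using p N(2) sd_cases[of e] unfolding crect_def by auto
  have "attracts_within P q p (crect (rc e 0) \<union> crect (rc e r))"
    unfolding crect_base[OF rf] crect_narrow[OF rf]
  proof (rule narrow_to_base)
    show "sd e \<in> {1,-1}" "r \<in> {1,-1}" using r sd_cases[of e] by auto
    show "box_at (pos e, tip e r) (sd e) r 0 (U2 e) (W1 e r) (WT e r) \<subseteq> P"
      "box_at (pos e, tip e r) (sd e) r (U1 e r) 0 0 (WT e r) \<subseteq> P"
      using crect_P[OF W(1)] crect_P[OF N(1)] unfolding crect_base[OF rf] crect_narrow[OF rf] by auto
    show "p \<in> box_at (pos e, tip e r) (sd e) r (U1 e r) 0 0 (WT e r)"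
      "q \<in> box_at (pos e, tip e r) (sd e) r 0 (U2 e) (W1 e r) (WT e r)"
      using p q unfolding crect_base[OF rf] crect_narrow[OF rf] by auto
    fix x assume x: "snd x = snd (pos e, tip e r)" "sd e * (fst p - fst (pos e, tip e r)) \<le> sd e * (fst x - fst (pos e, tip e r))"
    have xX: "sd e * X (rc e r) (- sd e) \<le> sd e * fst x" using x(2) pX sd_cases[of e] by auto
    {
      assume x3: "sd e * (fst x - fst (pos e, tip e r)) \<le> 0"
      show "x \<in> frontier P"
      proof (cases "fst x = pos e")
        case True
        then have "x = (pos e, tip e r)" using x(1) by (simp add: prod_eq_iff)
        then show ?thesis using door_ends_bd(1)[OF rf] frontier_P by simp
      next
        case False
        have mr: "- r = 1 \<or> - r = -1" using r by auto
        obtain h where h: "h \<in> HE" "pos h = tip e r" "lo h \<le> X (rc e r) (-1)" "X (rc e r) 1 \<le> hi h"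
          using cell_horizontal[OF N(1) mr] N(3) by metis
        have "lo h \<le> fst x" "fst x \<le> hi h" using xX x3 h(3,4) N(2) sd_cases[of e] by auto
        then show ?thesis unfolding frontier_P bd_iff using h x(1) by (intro disjI2 bexI[of _ h]) auto
      qed
    next
      assume x3: "sd e * (fst x - fst (pos e, tip e r)) < 0"
        and x4: "x = p \<or> sd e * (fst p - fst (pos e, tip e r)) < sd e * (fst x - fst (pos e, tip e r))"
      have "x \<notin> RV \<or> sd e * X (rc e r) (- sd e) < sd e * fst x"
      proof (cases "x = p")
        case True
        then show ?thesis using nb x(1) xX sd_cases[of e] by auto
      next
        case False
        then show ?thesis using x4 pX sd_cases[of e] by auto
      qed
      then show "\<exists>\<epsilon>>0. \<forall>z. dist x z < \<epsilon> \<longrightarrow> 0 < - r * (snd z - snd x) \<longrightarrow> z \<notin> P"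
        using horizontal_wall(2)[OF rf _ xX] x(1) x3 sd_cases[of e] by auto
    }
  qed (use closed_P box_sizes[OF rf] in auto)
  then show ?thesis unfolding loc_def using N(1) W(1) by (metis Un_absorb sup_assoc)
qed

text \<open>If the opposite end of \<open>e\<close> is reflex too, the line must meet the wall
  strictly before that end, lest the robot slip through the other door or halt at the other reflex
  vertex; this is \<open>oth\<close>. At a convex end the base cell stops by itself.\<close>

lemma loc_base_narrow:
  assumes rf: "reflex e r" and p: "p \<in> crect (rc e 0)" and q: "q \<in> crect (rc e r)"
    and oth: "\<And>h. reflex e (- r) \<Longrightarrow> h \<in> closed_segment p q \<Longrightarrow> fst h = pos e \<Longrightarrow> r * tip e (- r) < r * snd h"
  shows "loc p q"
proof -
  have r: "r = 1 \<or> r = -1" and e: "e \<in> VE" using reflex_sign[OF rf] reflex_VE[OF rf] by auto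
  note N = narrow_facts[OF rf] and W = base_facts[OF e]
  have low: "r * tip e (- r) \<le> r * snd h"
    if hs: "h \<in> closed_segment p q" "fst h = pos e" "W1 e r \<le> r * (snd h - tip e r)" for h
  proof (cases "reflex e (- r)")
    case True
    then show ?thesis using oth hs by fastforce
  next
    case False
    have "- r = 1 \<or> - r = -1" using r by auto
    then have "Y (rc e 0) (- r) = tip e (- r)" using base_tip[OF role_base[OF e]] False by blast
    then show ?thesis using hs(3) r unfolding W1_def by auto
  qed
  have "attracts_within P q p (crect (rc e 0) \<union> crect (rc e r))"
    unfolding crect_base[OF rf] crect_narrow[OF rf]
  proof (rule base_to_narrow)
    show "sd e \<in> {1,-1}" "r \<in> {1,-1}" using r sd_cases[of e] by auto
    show "box_at (pos e, tip e r) (sd e) r 0 (U2 e) (W1 e r) (WT e r) \<subseteq> P"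
      "box_at (pos e, tip e r) (sd e) r (U1 e r) 0 0 (WT e r) \<subseteq> P"
      using crect_P[OF W(1)] crect_P[OF N(1)] unfolding crect_base[OF rf] crect_narrow[OF rf] by auto
    show "q \<in> box_at (pos e, tip e r) (sd e) r (U1 e r) 0 0 (WT e r)"
      "p \<in> box_at (pos e, tip e r) (sd e) r 0 (U2 e) (W1 e r) (WT e r)"
      using p q unfolding crect_base[OF rf] crect_narrow[OF rf] by auto
    fix h x assume h: "h \<in> closed_segment p q" "fst h = fst (pos e, tip e r)" "W1 e r \<le> r * (snd h - snd (pos e, tip e r))"
      and x: "fst x = fst (pos e, tip e r)" "r * (snd h - snd (pos e, tip e r)) \<le> r * (snd x - snd (pos e, tip e r))"
    have hl: "r * tip e (- r) \<le> r * snd h" using low h by simp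
    {
      assume x3: "r * (snd x - snd (pos e, tip e r)) \<le> 0"
      have "lo e \<le> snd x" "snd x \<le> hi e" using hl x(2) x3 r by auto
      then show "x \<in> frontier P" unfolding frontier_P bd_iff using e x(1) by (intro disjI1 bexI[of _ e]) auto
    next
      assume x3: "r * (snd x - snd (pos e, tip e r)) < 0"
      have 1: "lo e \<le> snd x" "snd x \<le> hi e" using hl x(2) x3 r by auto
      have "snd x \<noteq> tip e q" if "reflex e q" for q
      proof (cases "q = r")
        case True
        then show ?thesis using x3 r by auto
      next
        case False
        then have "q = - r" using reflex_sign[OF that] r by auto
        then have "r * tip e (- r) < r * snd h" using oth that h by auto
        then show ?thesis using \<open>q = - r\<close> x(2) r by auto
      qed
      then show "\<exists>\<epsilon>>0. \<forall>z. dist x z < \<epsilon> \<longrightarrow> 0 < - sd e * (fst z - fst x) \<longrightarrow> z \<notin> P"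
        using vertical_wall[OF e _ 1] x(1) by simp
    }
  qed (use closed_P box_sizes[OF rf] in auto)
  then show ?thesis unfolding loc_def using N(1) W(1) by (metis Un_absorb sup_assoc)
qed

text \<open>A point of the base cell slightly beyond the level of the reflex end \<open>r\<close>: it sees the narrow cell at that
  end, yet every line from it to the narrow cell at the other end still hits the wall between the two.\<close>

definition favouring :: "seg \<Rightarrow> real \<Rightarrow> pt \<Rightarrow> bool" where
  "favouring e r b \<longleftrightarrow> b \<in> crect (rc e 0) \<and> 0 < sd e * (fst b - pos e) \<and>
     r * tip e r < r * snd b \<and> r * snd b < r * door_end e r \<and>
     (\<forall>q\<in>crect (rc e (- r)). \<forall>h\<in>closed_segment b q. fst h = pos e \<longrightarrow> r * snd h < r * tip e r)"

text \<open>The beacon is at distance \<open>a\<close> from the wall and \<epsilon> beyond the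
  reflex end. A target in the other narrow cell is at most \<open>B\<close> behind the wall and at
  least the edge length \<open>g\<close> below that end, so on reaching the wall the line has
  covered a fraction of at least \<open>a / (a + B)\<close> and is too low once \<epsilon> is less
  than \<open>a * g / (a + B)\<close>.\<close>

lemma favouring_exists:
  assumes rf: "reflex e r" and rf': "reflex e (- r)"
  shows "\<exists>b. favouring e r b"
proof -
  have r: "r = 1 \<or> r = -1" and e: "e \<in> VE" using reflex_sign[OF rf] reflex_VE[OF rf] by auto
  note N = narrow_facts[OF rf] and N' = narrow_facts[OF rf'] and W = base_facts[OF e] and T = base_door_end[OF rf]
  note l = cell_less[OF N(1)] cell_less[OF N'(1)] cell_less[OF W(1)] V_less[OF e]
  define a where "a = (X (rc e 0) 1 - X (rc e 0) (-1)) / 2"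
  define B where "B = X (rc e (- r)) 1 - X (rc e (- r)) (-1)"
  define g where "g = hi e - lo e"
  have pos: "0 < a" "0 < B" "0 < g" using l unfolding a_def B_def g_def by auto
  define K where "K = a * g / (a + B)"
  have K: "0 < K" using pos unfolding K_def by simp
  define \<epsilon> where "\<epsilon> = min K (r * door_end e r - r * tip e r) / 2"
  have "0 < \<epsilon> \<and> \<epsilon> < K \<and> \<epsilon> < r * door_end e r - r * tip e r" using K N(4) unfolding \<epsilon>_def by auto
  then have eps: "0 < \<epsilon>" "\<epsilon> < a * g / (a + B)" "\<epsilon> < r * door_end e r - r * tip e r" unfolding K_def by auto
  define b where "b = (pos e + sd e * a, tip e r + r * \<epsilon>)"
  have aW: "a < X (rc e 0) 1 - X (rc e 0) (-1)" using l unfolding a_def by auto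
  have b1: "b \<in> crect (rc e 0)"
    using eps(1,3) pos(1) aW W T r sd_cases[of e] l(7) unfolding b_def crect_def by auto
  have b2: "0 < sd e * (fst b - pos e)" "r * tip e r < r * snd b" "r * snd b < r * door_end e r"
    using eps pos r sd_cases[of e] unfolding b_def by (auto simp: algebra_simps)
  have b3: "r * snd h < r * tip e r" if q: "q \<in> crect (rc e (- r))" and h: "h \<in> closed_segment b q" "fst h = pos e" for q h
  proof -
    obtain t where t: "0 \<le> t" "t \<le> 1" "h = (1 - t) *\<^sub>R b + t *\<^sub>R q" using h(1) unfolding in_segment by blast
    define \<beta> where "\<beta> = - (sd e * (fst q - pos e))"
    have be: "\<beta> \<le> B" using q N'(2) sd_cases[of e] unfolding \<beta>_def B_def crect_def by auto
    have qy: "r * snd q \<le> r * tip e r - g" using q N'(3) r unfolding crect_def g_def by auto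
    have "sd e * (fst h - pos e) = (1 - t) * (sd e * (fst b - pos e)) + t * (sd e * (fst q - pos e))"
      unfolding t(3) by (simp add: algebra_simps)
    moreover have "sd e * (fst b - pos e) = a" using sd_cases[of e] unfolding b_def by auto
    ultimately have "0 = (1 - t) * a - t * \<beta>" using h(2) unfolding \<beta>_def by simp
    then have "a = t * (a + \<beta>)" by (simp add: algebra_simps)
    also have "\<dots> \<le> t * (a + B)" using be t by (intro mult_left_mono) auto
    finally have tb: "a / (a + B) \<le> t" using pos by (simp add: field_simps)
    have "r * snd h = (1 - t) * (r * snd b) + t * (r * snd q)" unfolding t(3) by (simp add: algebra_simps)
    also have "\<dots> \<le> (1 - t) * (r * tip e r + \<epsilon>) + t * (r * tip e r - g)"
      using t qy r unfolding b_def by (intro add_mono mult_left_mono) (auto simp: algebra_simps)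
    also have "\<dots> = r * tip e r + \<epsilon> - t * \<epsilon> - t * g" by (simp add: algebra_simps)
    also have "\<dots> \<le> r * tip e r + \<epsilon> - t * g" using t eps by simp
    also have "\<dots> \<le> r * tip e r + \<epsilon> - a / (a + B) * g" using mult_right_mono[OF tb, of g] pos by linarith
    also have "\<dots> < r * tip e r" using eps(2) by simp
    finally show ?thesis .
  qed
  show ?thesis unfolding favouring_def using b1 b2 b3 by blast
qed

lemma favouring_heights:
  assumes rf: "reflex e r" and b: "favouring e r b"
  shows "Y (rc e r) (-1) < snd b" "snd b < Y (rc e r) 1"
  using b narrow_facts(3)[OF rf] reflex_sign[OF rf] unfolding favouring_def door_end_def by auto

lemma beyond_side_in_base:
  assumes rf: "reflex e r" and b: "favouring e r b"
    and z: "Y (rc e r) (-1) \<le> snd z" "snd z \<le> Y (rc e r) 1" "sd e * pos e \<le> sd e * fst z" "sd e * fst z \<le> sd e * fst b"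
  shows "z \<in> crect (rc e 0)"
  using z b base_facts[OF reflex_VE[OF rf]] base_door_end[OF rf] narrow_facts(3)[OF rf] reflex_sign[OF rf] sd_cases[of e]
    V_less[OF reflex_VE[OF rf]]
  unfolding favouring_def crect_def door_end_def by auto

text \<open>The beacon is within the height range of the narrow cell, whose whole side is the door,
  so the straight segment passes through the door.\<close>

lemma loc_favoured:
  assumes rf: "reflex e r" and b: "favouring e r b" and p: "p \<in> crect (rc e r)"
  shows "loc p b" "loc b p"
proof -
  note N = narrow_facts[OF rf] and W = base_facts[OF reflex_VE[OF rf]]
  have "closed_segment p b \<subseteq> crect (rc e 0) \<union> crect (rc e r)"
  proof
    fix z assume z: "z \<in> closed_segment p b"
    have 1: "(1::real) \<in> {1,-1}" by simp
    have h: "Y (rc e r) (-1) \<le> snd z" "snd z \<le> Y (rc e r) 1"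
      using segment_coordinate_between(3)[OF z 1, of "Y (rc e r) (-1)" 0] segment_coordinate_between(4)[OF z 1, of 0 "Y (rc e r) 1"]
        favouring_heights[OF rf b] p unfolding crect_def by auto
    have s: "sd e \<in> {1,-1}" using sd_cases[of e] by auto
    have pb: "sd e * fst p \<le> sd e * pos e" "sd e * X (rc e r) (- sd e) \<le> sd e * fst p" "sd e * pos e \<le> sd e * fst b"
      using p b N(2) sd_cases[of e] unfolding crect_def favouring_def by auto
    have x: "sd e * X (rc e r) (- sd e) \<le> sd e * fst z" "sd e * fst z \<le> sd e * fst b"
      using segment_coordinate_between(1)[OF z s, of "sd e * X (rc e r) (- sd e)" 0]
        segment_coordinate_between(2)[OF z s, of 0 "sd e * fst b"] pb by auto
    show "z \<in> crect (rc e 0) \<union> crect (rc e r)"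
    proof (cases "sd e * pos e \<le> sd e * fst z")
      case True
      then show ?thesis using beyond_side_in_base[OF rf b h _ x(2)] by blast
    next
      case False
      then have "z \<in> crect (rc e r)" using h x(1) N(2) sd_cases[of e] unfolding crect_def by auto
      then show ?thesis by blast
    qed
  qed
  then show "loc p b" "loc b p"
    using loc_straight[OF W(1) W(1) N(1), of p b] loc_straight[OF W(1) W(1) N(1), of b p] by (auto simp: closed_segment_commute)
qed

text \<open>The chords lie on opposite sides of the common narrow cell and both beacons are within
  its height range: the segment runs through one base cell, the common cell and the other base
  cell.\<close>

lemma loc_favoured_both:
  assumes rf: "reflex e r" and b: "favouring e r b" and rf': "reflex f q" and b': "favouring f q b'"
    and eq: "rc e r = rc f q" and ne: "e \<noteq> f"
  shows "loc b b'"
proof -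
  note N = narrow_facts[OF rf] and N' = narrow_facts[OF rf']
  note W = base_facts[OF reflex_VE[OF rf]] and W' = base_facts[OF reflex_VE[OF rf']]
  have "sd e \<noteq> sd f" using N(2) N'(2) eq ne V_unique[of e f] reflex_VE[OF rf] reflex_VE[OF rf'] by auto
  then have sf: "sd f = - sd e" using sd_cases[of e] sd_cases[of f] by auto
  have "closed_segment b b' \<subseteq> crect (rc e 0) \<union> crect (rc e r) \<union> crect (rc f 0)"
  proof
    fix z assume z: "z \<in> closed_segment b b'"
    have 1: "(1::real) \<in> {1,-1}" by simp
    have h: "Y (rc e r) (-1) \<le> snd z" "snd z \<le> Y (rc e r) 1"
      using segment_coordinate_between(3)[OF z 1, of "Y (rc e r) (-1)" 0] segment_coordinate_between(4)[OF z 1, of 0 "Y (rc e r) 1"]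
        favouring_heights[OF rf b] favouring_heights[OF rf' b'] unfolding eq by auto
    have s: "sd e \<in> {1,-1}" using sd_cases[of e] by auto
    have pf: "sd e * pos f < sd e * pos e" using N(2) N'(2) cell_less[OF N(1)] sd_cases[of e] unfolding sf eq by auto
    have pb: "sd e * pos e < sd e * fst b" "sd e * fst b' < sd e * pos f"
      using b b' sf sd_cases[of e] unfolding favouring_def by auto
    have x: "sd e * fst b' \<le> sd e * fst z" "sd e * fst z \<le> sd e * fst b"
      using segment_coordinate_between(1)[OF z s, of "sd e * fst b'" 0]
        segment_coordinate_between(2)[OF z s, of 0 "sd e * fst b"] pb pf by auto
    consider "sd e * pos e \<le> sd e * fst z" | "sd e * fst z \<le> sd e * pos f" | "sd e * pos f \<le> sd e * fst z" "sd e * fst z \<le> sd e * pos e"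
      by linarith
    then show "z \<in> crect (rc e 0) \<union> crect (rc e r) \<union> crect (rc f 0)"
    proof cases
      case 1
      then show ?thesis using beyond_side_in_base[OF rf b h _ x(2)] by blast
    next
      case 2
      then have "z \<in> crect (rc f 0)" using beyond_side_in_base[OF rf' b', of z] h x(1) sf unfolding eq by auto
      then show ?thesis by blast
    next
      case 3
      then have "z \<in> crect (rc e r)" using h N(2) N'(2) sd_cases[of e] unfolding crect_def sf eq by auto
      then show ?thesis by blast
    qed
  qed
  then show ?thesis using loc_straight[OF W(1) N(1) W'(1)] by blast
qed

end

section \<open>The beacon network\<close>

context rectilinear
begin

definition reflex_ends :: "(seg \<times> real) set" where "reflex_ends = {(e, r). reflex e r}"

lemma finite_reflex_ends: "finite reflex_ends"
proof (rule finite_subset)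
  show "reflex_ends \<subseteq> VE \<times> {1, -1}" unfolding reflex_ends_def using reflex_VE reflex_sign by auto
qed (simp add: finV)

lemma cells_nonempty: "{C. cell C} \<noteq> {}"
  using inn_ne cells_cover P_def by blast

lemma card_reflex_ends_cells: "card reflex_ends < card {C. cell C}"
proof (rule card_edges_less_card_vertices[where a = "\<lambda>(e,r). rc e 0" and b = "\<lambda>(e,r). rc e r"])
  show "(\<lambda>(e,r). rc e 0) ` reflex_ends \<subseteq> {C. cell C}" "(\<lambda>(e,r). rc e r) ` reflex_ends \<subseteq> {C. cell C}"
    unfolding reflex_ends_def using base_facts(1) narrow_facts(1) reflex_VE by auto
  fix x assume "x \<in> reflex_ends"
  then obtain e r where x: "x = (e, r)" "reflex e r" unfolding reflex_ends_def by auto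
  obtain \<kappa> :: "cell \<Rightarrow> bool" where k: "\<kappa> (rc e 0) \<noteq> \<kappa> (rc e r)"
    "\<And>e' r'. reflex e' r' \<Longrightarrow> (e', r') \<noteq> (e, r) \<Longrightarrow> \<kappa> (rc e' 0) = \<kappa> (rc e' r')"
    using door_cut[OF x(2)] by blast
  show "\<exists>\<kappa>::cell \<Rightarrow> bool. \<kappa> (case x of (e, r) \<Rightarrow> rc e 0) \<noteq> \<kappa> (case x of (e, r) \<Rightarrow> rc e r) \<and>
     (\<forall>f\<in>reflex_ends. f \<noteq> x \<longrightarrow> \<kappa> (case f of (e, r) \<Rightarrow> rc e 0) = \<kappa> (case f of (e, r) \<Rightarrow> rc e r))"
    using k unfolding x(1) reflex_ends_def by (intro exI[of _ \<kappa>]) auto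
qed (use finite_cells cells_nonempty finite_reflex_ends in auto)

text \<open>Each of the two vertical sides of a cell stems from a role, and a role determines its
  cell and side. There is one base role per vertical edge and one narrow role per reflex
  end.\<close>

lemma card_cells: "2 * card {C. cell C} \<le> card VE + card reflex_ends"
proof -
  let ?f = "\<lambda>(e, r). (rc e r, if r = 0 then - sd e else sd e)"
  let ?S = "VE \<times> {0} \<union> reflex_ends"
  have fin: "finite ?S" using finV finite_reflex_ends by simp
  have "{C. cell C} \<times> {1, -1} \<subseteq> ?f ` ?S"
  proof
    fix x assume "x \<in> {C. cell C} \<times> {1, -1::real}"
    then obtain C s where x: "x = (C, s)" "cell C" "s = 1 \<or> s = -1" by auto
    obtain e r where e: "role C e r" "r = 0 \<or> r = 1 \<or> r = -1" "X C s = pos e" "sd e = (if r = 0 then - s else s)"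
      using side_role[OF x(2,3)] .
    have "(e, r) \<in> ?S" using e(1) unfolding role_def reflex_ends_def by (auto split: if_splits)
    moreover have "?f (e, r) = x" using rc_eq[OF e(1)] e(4) x(1) by auto
    ultimately show "x \<in> ?f ` ?S" by (rule rev_image_eqI[OF _ sym])
  qed
  then have "card ({C. cell C} \<times> {1, -1::real}) \<le> card ?S" using surj_card_le[OF fin] by blast
  also have "\<dots> \<le> card (VE \<times> {0::real}) + card reflex_ends" by (rule card_Un_le)
  finally show ?thesis by (simp add: card_cartesian_product)
qed

text \<open>With at least one more cell than doors, counting sides gives
  \<open>2 * (card reflex_ends + 1) \<le> card VE + card reflex_ends\<close>.\<close>

lemma card_reflex_ends: "card reflex_ends + 2 \<le> card VE"
  using card_cells card_reflex_ends_cells by linarith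

definition dbl :: "seg \<Rightarrow> bool" where "dbl e \<longleftrightarrow> reflex e 1 \<and> reflex e (-1)"
definition items :: "seg set" where "items = {e. \<exists>r. reflex e r}"
definition only_end :: "seg \<Rightarrow> real" where "only_end e = (if reflex e 1 then 1 else -1)"

text \<open>The chord of a vertical edge with two reflex ends links the two narrow cells; the base cell takes no part,
  since it always contains the beacons of that chord.\<close>

definition endA :: "seg \<Rightarrow> cell" where "endA e = (if dbl e then rc e 1 else rc e 0)"
definition endB :: "seg \<Rightarrow> cell" where "endB e = (if dbl e then rc e (-1) else rc e (only_end e))"

lemma items_VE: "e \<in> items \<Longrightarrow> e \<in> VE" unfolding items_def using reflex_VE by blast

lemma finite_items: "finite items" using finV items_VE by (metis finite_subset subsetI)

lemma reflex_only_end: "e \<in> items \<Longrightarrow> reflex e (only_end e)"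
  unfolding items_def only_end_def using reflex_sign by force

lemma only_end_eq: "reflex e r \<Longrightarrow> \<not> dbl e \<Longrightarrow> only_end e = r"
  unfolding dbl_def only_end_def using reflex_sign[of e r] by auto

lemma narrow_end: assumes "reflex e r" shows "rc e r \<in> {endA e, endB e}"
  using assms reflex_sign[OF assms] only_end_eq[OF assms] unfolding endA_def endB_def by auto

lemma base_end: "\<not> dbl e \<Longrightarrow> rc e 0 \<in> {endA e, endB e}" unfolding endA_def by simp

lemma end_role: assumes "e \<in> items" "v \<in> {endA e, endB e}" shows "\<exists>r. role v e r"
  using assms role_base[OF items_VE[OF assms(1)]] role_narrow reflex_only_end[OF assms(1)]
  unfolding endA_def endB_def dbl_def by (auto split: if_splits)

text \<open>The cut at one door of the item also serves its link of two narrow cells, since the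
  other door keeps equal colours. For any other item, a link through two doors keeps equal colours
  at each.\<close>

lemma item_cut:
  assumes e: "e \<in> items"
  shows "\<exists>\<kappa>::cell \<Rightarrow> bool. \<kappa> (endA e) \<noteq> \<kappa> (endB e) \<and> (\<forall>f\<in>items. f \<noteq> e \<longrightarrow> \<kappa> (endA f) = \<kappa> (endB f))"
proof -
  obtain \<kappa> :: "cell \<Rightarrow> bool" where k: "\<kappa> (rc e 0) \<noteq> \<kappa> (rc e (only_end e))"
    "\<And>e' r'. reflex e' r' \<Longrightarrow> (e', r') \<noteq> (e, only_end e) \<Longrightarrow> \<kappa> (rc e' 0) = \<kappa> (rc e' r')"
    using door_cut[OF reflex_only_end[OF e]] by blast
  have "\<kappa> (endA e) \<noteq> \<kappa> (endB e)"
    using k(1) k(2)[of e "-1"] unfolding endA_def endB_def dbl_def only_end_def by auto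
  moreover have "\<kappa> (endA f) = \<kappa> (endB f)" if "f \<in> items" "f \<noteq> e" for f
    using k(2)[of f 1] k(2)[of f "-1"] k(2)[of f "only_end f"] reflex_only_end[OF that(1)] that(2)
    unfolding endA_def endB_def dbl_def by auto
  ultimately show ?thesis by blast
qed

lemma ends_distinct: "e \<in> items \<Longrightarrow> endA e \<noteq> endB e" using item_cut by metis

lemma role_side: "role C e r \<Longrightarrow> X C (if r = 0 then - sd e else sd e) = pos e" by (auto simp: role_def)

lemma role_same_side:
  assumes "role C e r" "role C f q" "(if r = 0 then - sd e else sd e) = (if q = 0 then - sd f else sd f)"
  shows "e = f"
  using role_side[OF assms(1)] role_side[OF assms(2)] assms V_unique[of e f] by (simp add: role_def)

text \<open>A cell has only two vertical sides, and by general position the edge responsible for a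
  side is unique.\<close>

lemma item_degree:
  assumes "i \<in> items" "j \<in> items" "k \<in> items" "v \<in> {endA i, endB i}" "v \<in> {endA j, endB j}" "v \<in> {endA k, endB k}"
  shows "i = j \<or> i = k \<or> j = k"
proof -
  define s where "s e r = (if r = 0 then - sd e else sd e)" for e and r :: real
  have s: "s e r = 1 \<or> s e r = -1" for e r using sd_cases[of e] unfolding s_def by auto
  obtain r1 r2 r3 where r: "role v i r1" "role v j r2" "role v k r3" using end_role assms by meson
  have "s i r1 = s j r2 \<or> s i r1 = s k r3 \<or> s j r2 = s k r3" using s[of i r1] s[of j r2] s[of k r3] by auto
  then show ?thesis using role_same_side[OF r(1,2)] role_same_side[OF r(1,3)] role_same_side[OF r(2,3)] unfolding s_def by blast
qed

lemma reflex_ends_of: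
  assumes "e \<in> items" shows "{r. reflex e r} = (if dbl e then {1,-1} else {only_end e})"
proof (cases "dbl e")
  case True
  then have "reflex e 1" "reflex e (-1)" unfolding dbl_def by auto
  moreover have "{r. reflex e r} \<subseteq> {1,-1}" using reflex_sign by blast
  ultimately show ?thesis using True by auto
next
  case False
  then have "{r. reflex e r} \<subseteq> {only_end e}" using only_end_eq by blast
  then show ?thesis using False reflex_only_end[OF assms] by auto
qed

lemma card_reflex_ends_items: "(\<Sum>e\<in>items. if dbl e then 2 else (1::nat)) = card reflex_ends"
proof -
  note R = reflex_ends_of
  have "reflex_ends = Sigma items (\<lambda>e. {r. reflex e r})" unfolding reflex_ends_def items_def by auto
  then have "card reflex_ends = (\<Sum>e\<in>items. card {r. reflex e r})"
    using finite_items R by (simp add: card_SigmaI)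
  also have "\<dots> = (\<Sum>e\<in>items. if dbl e then 2 else 1)" using R by (intro sum.cong) auto
  finally show ?thesis by simp
qed

lemma exists_status:
  obtains st where "admissible endA endB dbl items st" "3 * (\<Sum>e\<in>items. cost (dbl e) (st e)) \<le> 2 * card reflex_ends"
  using exists_admissible[OF finite_items ends_distinct item_cut, of dbl] item_degree unfolding card_reflex_ends_items by meson

definition mid :: "seg \<Rightarrow> real \<Rightarrow> pt" where "mid e r = (pos e, (tip e r + door_end e r) / 2)"

definition fav :: "seg \<Rightarrow> real \<Rightarrow> pt" where "fav e r = (SOME b. favouring e r b)"

lemma favouring_fav: assumes "dbl e" "r = 1 \<or> r = -1" shows "favouring e r (fav e r)"
  unfolding fav_def using someI_ex[OF favouring_exists[of e r]] assms unfolding dbl_def by auto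

lemma mid_door: "reflex e r \<Longrightarrow> mid e r \<in> door e r" unfolding mid_def by (rule door_nonempty)

lemma mid_cells: assumes "reflex e r" shows "mid e r \<in> crect (rc e 0)" "mid e r \<in> crect (rc e r)"
  using door_in_cells[OF assms mid_door[OF assms]] by auto

end

locale rectilinear_status = rectilinear +
  fixes st :: "seg \<Rightarrow> cell status"
  assumes adm: "admissible endA endB dbl items st"
begin

lemma st_Skip: "e \<in> items \<Longrightarrow> st e = Skip \<Longrightarrow> \<not> dbl e"
  using adm unfolding admissible_def by blast

lemma st_Fav: assumes "e \<in> items" "st e = Fav v" obtains r where "dbl e" "r = 1 \<or> r = -1" "v = rc e r" "reflex e r" "reflex e (- r)"
proof -
  have d: "dbl e" "v \<in> {endA e, endB e}" using adm assms unfolding admissible_def by blast+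
  then have "v = rc e 1 \<or> v = rc e (-1)" unfolding endA_def endB_def by auto
  then show thesis using that[of 1] that[of "-1"] d(1) unfolding dbl_def by auto
qed

lemma st_conflict: "e \<in> items \<Longrightarrow> f \<in> items \<Longrightarrow> e \<noteq> f \<Longrightarrow> v \<in> {endA e, endB e} \<Longrightarrow> v \<in> {endA f, endB f} \<Longrightarrow>
    st e = Full \<or> st f = Full \<or> (st e = Fav v \<and> st f = Fav v)"
  using adm unfolding admissible_def by blast

text \<open>The favoured end is recovered from the favoured cell; this is unambiguous because the
  two narrow cells of a doubly reflex edge are distinct.\<close>

definition beac :: "seg \<Rightarrow> pt set" where
  "beac e = (case st e of Skip \<Rightarrow> {} | Full \<Rightarrow> mid e ` {r. reflex e r} | Fav v \<Rightarrow> {fav e (if v = rc e 1 then 1 else -1)})"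

definition B :: "pt set" where "B = (\<Union>e\<in>items. beac e)"

lemma beac_Full: "st e = Full \<Longrightarrow> beac e = mid e ` {r. reflex e r}" by (simp add: beac_def)

lemma beac_Fav: assumes e: "e \<in> items" and f: "st e = Fav (rc e r)" and r: "r = 1 \<or> r = -1" shows "beac e = {fav e r}"
proof -
  have "dbl e" using st_Fav[OF e f] by blast
  then have "rc e 1 \<noteq> rc e (-1)" using ends_distinct[OF e] unfolding endA_def endB_def by simp
  then show ?thesis using f r unfolding beac_def by auto
qed

lemma card_beac: assumes e: "e \<in> items" shows "finite (beac e)" "card (beac e) \<le> cost (dbl e) (st e)"
proof -
  note R = reflex_ends_of[OF e]
  have "finite (beac e) \<and> card (beac e) \<le> cost (dbl e) (st e)"
  proof (cases "st e")
    case Full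
    have "card (mid e ` {r. reflex e r}) \<le> card {r. reflex e r}" unfolding R by (intro card_image_le) auto
    then show ?thesis using Full R unfolding beac_def by auto
  qed (auto simp: beac_def)
  then show "finite (beac e)" "card (beac e) \<le> cost (dbl e) (st e)" by auto
qed

lemma card_B: "finite B" "card B \<le> (\<Sum>e\<in>items. cost (dbl e) (st e))"
proof -
  show "finite B" unfolding B_def using finite_items card_beac by auto
  have "card B \<le> (\<Sum>e\<in>items. card (beac e))" unfolding B_def by (rule card_UN_le[OF finite_items])
  also have "\<dots> \<le> (\<Sum>e\<in>items. cost (dbl e) (st e))" by (intro sum_mono card_beac)
  finally show "card B \<le> (\<Sum>e\<in>items. cost (dbl e) (st e))" .
qed

lemma beac_base: assumes e: "e \<in> items" and b: "b \<in> beac e" shows "b \<in> crect (rc e 0)"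
proof (cases "st e")
  case Skip then show ?thesis using b unfolding beac_def by simp
next
  case Full
  then show ?thesis using b mid_cells(1) unfolding beac_Full[OF Full] by auto
next
  case (Fav v)
  then obtain r where r: "dbl e" "r = 1 \<or> r = -1" "v = rc e r" using st_Fav[OF e] by metis
  then have "b = fav e r" using b beac_Fav[OF e _ r(2)] Fav by auto
  then show ?thesis using favouring_fav[OF r(1,2)] unfolding favouring_def by simp
qed

lemma B_P: "B \<subseteq> P"
  unfolding B_def using beac_base crect_P base_facts(1) items_VE by blast

section \<open>Local routes among points and beacons near a common cell\<close>

inductive route :: "pt \<Rightarrow> pt \<Rightarrow> bool" where
  direct: "loc p q \<Longrightarrow> route p q"
| via: "loc p b \<Longrightarrow> b \<in> B \<Longrightarrow> route b q \<Longrightarrow> route p q"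

lemma route_trans: "route p b \<Longrightarrow> b \<in> B \<Longrightarrow> route b q \<Longrightarrow> route p q"
  by (induction rule: route.induct) (auto intro: route.intros)

text \<open>A beacon of a chord serves all cells of that chord, except that a \<open>Full\<close>
  chord assigns to a narrow cell only the beacon in its own door.\<close>

definition attached :: "cell \<Rightarrow> pt \<Rightarrow> bool" where
  "attached C b \<longleftrightarrow> (\<exists>e r. e \<in> items \<and> role C e r \<and> b \<in> beac e \<and> (st e = Full \<longrightarrow> r = 0 \<or> b = mid e r))"

lemma attached_B: "attached C b \<Longrightarrow> b \<in> B" unfolding attached_def B_def by blast

lemma narrow_role_reflex: "role C e r \<Longrightarrow> r \<noteq> 0 \<Longrightarrow> reflex e r \<and> C = rc e r"
  using rc_eq[of C e r] by (auto simp: role_def)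

text \<open>A reflex corner of a narrow cell on its far side belongs to an item sharing that cell, which must be
  \<^const>\<open>Full\<close>; its beacon lets the robot leave the indeterminate position.\<close>

lemma far_corner_beacon:
  assumes rf: "reflex e r" and p: "p \<in> RV" "fst p = X (rc e r) (- sd e)" "snd p = tip e r"
    and st: "st e \<noteq> Full" "st e \<noteq> Fav (rc e r)"
  obtains m where "m \<in> B" "m \<in> crect (rc e r)" "snd m \<noteq> tip e r"
proof -
  have r: "r = 1 \<or> r = -1" and e: "e \<in> VE" using reflex_sign[OF rf] reflex_VE[OF rf] by auto
  note N = narrow_facts[OF rf]
  have s: "- sd e = 1 \<or> - sd e = -1" using sd_cases[of e] by auto
  obtain f q where f: "role (rc e r) f q" "q = 0 \<or> q = 1 \<or> q = -1" "X (rc e r) (- sd e) = pos f" "sd f = (if q = 0 then - (- sd e) else - sd e)"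
    using side_role[OF N(1) s] .
  have fV: "f \<in> VE" using f(1) by (simp add: role_def)
  obtain g k where g: "p = (pos g, tip g k)" "reflex g k" using p(1) unfolding RV_def by blast
  have gf: "g = f" using V_unique[OF reflex_VE[OF g(2)] fV] g(1) p(2) f(3) by simp
  have k: "k = 1 \<or> k = -1" using reflex_sign[OF g(2)] .
  have tipk: "tip f k = tip e r" "Y (rc e r) (- r) = tip e r" using g(1) gf p(3) N(3) by auto
  \<comment> \<open>The cell cannot be the base cell of \<open>f\<close>: a base cell extends past
    each reflex end of its edge, while here that end is level with a corner of the cell.\<close>
  have q0: "q \<noteq> 0"
  proof
    assume q: "q = 0"
    then have C: "rc f 0 = rc e r" using rc_eq f(1) by simp
    have "Y (rc f 0) k = door_end f k" using base_door_end g(2) gf by blast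
    moreover have "k * tip f k < k * door_end f k" using narrow_facts(4) g(2) gf by blast
    ultimately have "k \<noteq> - r" using tipk C by auto
    then have "k = r" using k r by auto
    then show False using base_facts[OF fV] tipk C V_less[OF fV] r by auto
  qed
  have fq: "reflex f q" "rc f q = rc e r" using narrow_role_reflex[OF f(1) q0] by auto
  have ne: "f \<noteq> e" using f(4) q0 sd_cases[of e] by auto
  have it: "e \<in> items" "f \<in> items" using rf fq(1) unfolding items_def by auto
  have "st f = Full"
    using st_conflict[OF it ne[symmetric] narrow_end[OF rf]] narrow_end[OF fq(1)] st unfolding fq(2) by auto
  then have "mid f q \<in> B" unfolding B_def using beac_Full it(2) fq(1) by blast
  moreover have mc: "mid f q \<in> crect (rc e r)" using mid_cells(2)[OF fq(1)] fq(2) by simp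
  moreover have "snd (mid f q) \<noteq> tip e r"
  proof -
    have "mid f q \<in> inn" using mid_door[OF fq(1)] door_inn[OF fq(1)] by blast
    then show ?thesis using crect_inn_strict[OF N(1) mc] tipk(2) r by auto
  qed
  ultimately show thesis using that by blast
qed

text \<open>From the one bad corner the robot visits a beacon of the same cell off the floor level,
  from which the direct move works.\<close>

lemma route_narrow_base:
  assumes rf: "reflex e r" and st: "st e \<noteq> Full" "st e \<noteq> Fav (rc e r)"
    and p: "p \<in> crect (rc e r)" and q: "q \<in> crect (rc e 0)"
  shows "route p q"
proof (cases "p \<in> RV \<and> fst p = X (rc e r) (- sd e) \<and> snd p = tip e r")
  case False
  then show ?thesis using loc_narrow_base[OF rf p q] by (intro route.direct) blast
next
  case True
  then obtain m where m: "m \<in> B" "m \<in> crect (rc e r)" "snd m \<noteq> tip e r" using far_corner_beacon[OF rf _ _ _ st] by blast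
  have "loc p m" using loc_cell[OF narrow_facts(1)[OF rf] p m(2)] .
  moreover have "loc m q" using loc_narrow_base[OF rf m(2) q] m(3) by blast
  ultimately show ?thesis using m(1) by (intro route.via[of p m] route.direct)
qed

lemma attached_cases:
  assumes "attached C b"
  obtains "b \<in> crect C" "cell C"
  | e r where "e \<in> items" "dbl e" "r = 1 \<or> r = -1" "reflex e r" "reflex e (-r)" "st e = Fav (rc e r)" "b = fav e r" "C = rc e r"
  | e r where "e \<in> items" "dbl e" "r = 1 \<or> r = -1" "reflex e r" "reflex e (-r)" "st e = Fav (rc e r)" "b = fav e r" "C = rc e (-r)"
proof -
  obtain e q where e: "e \<in> items" "role C e q" "b \<in> beac e" "st e = Full \<longrightarrow> q = 0 \<or> b = mid e q"
    using assms attached_def by blast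
  show thesis
  proof (cases "q = 0")
    case True
    then have "C = rc e 0" using rc_eq e(2) by blast
    then show thesis using that(1) beac_base[OF e(1,3)] role_cell[OF e(2)] by blast
  next
    case False
    have n: "reflex e q" "C = rc e q" using narrow_role_reflex[OF e(2) False] by auto
    show thesis
    proof (cases "st e")
      case Skip
      then show thesis using e(3) unfolding beac_def by simp
    next
      case Full
      then have "b = mid e q" using e(4) False by blast
      then show thesis using that(1) mid_cells(2)[OF n(1)] n(2) role_cell[OF e(2)] by blast
    next
      case (Fav v)
      then obtain r where r: "dbl e" "r = 1 \<or> r = -1" "v = rc e r" "reflex e r" "reflex e (- r)" using st_Fav[OF e(1)] by metis
      have b: "b = fav e r" using e(3) beac_Fav[OF e(1) _ r(2)] Fav r(3) by auto
      have "q = r \<or> q = - r" using reflex_sign[OF n(1)] r(2) by auto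
      then show thesis using that(2)[of e r] that(3)[of e r] e(1) r Fav b n(2) by blast
    qed
  qed
qed

text \<open>Only a beacon favouring the opposite narrow cell is delicate. It attracts points of the
  cell by way of \<open>route_narrow_base\<close>, and by the choice of its position the way back
  hits the wall, as \<open>loc_base_narrow\<close> demands.\<close>

lemma attached_route:
  assumes at: "attached C b" and p: "p \<in> crect C"
  shows "route p b" "route b p"
proof -
  have "route p b \<and> route b p"
    using at
  proof (cases rule: attached_cases)
    case 1
    then show ?thesis using loc_cell[OF 1(2)] p route.direct by blast
  next
    case (2 e r)
    then show ?thesis using loc_favoured[OF 2(4) favouring_fav[OF 2(2,3)]] p route.direct unfolding 2(7,8) by blast
  next
    case (3 e r)
    have F: "favouring e r b" using favouring_fav[OF 3(2,3)] 3(7) by simp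
    have b0: "b \<in> crect (rc e 0)" using F unfolding favouring_def by simp
    have "loc b p"
    proof (rule loc_base_narrow[OF 3(5) b0])
      show "p \<in> crect (rc e (- r))" using p 3(8) by simp
      show "- r * tip e (- (- r)) < - r * snd h" if "h \<in> closed_segment b p" "fst h = pos e" for h
        using F that p 3(8) unfolding favouring_def by auto
    qed
    moreover have "rc e r \<noteq> rc e (- r)"
      using ends_distinct[OF 3(1)] 3(2,3) unfolding endA_def endB_def by auto
    then have "route p b" using route_narrow_base[OF 3(5) _ _ _ b0] p 3(6,8) by auto
    ultimately show ?thesis using route.direct by blast
  qed
  then show "route p b" "route b p" by auto
qed

text \<open>If neither beacon lies in the cell, both stem from \<open>Fav\<close> chords having it
  as a narrow cell. The chords then coincide, or compatibility makes both favour this cell.\<close>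

lemma attached_attached:
  assumes b: "attached C b" and b': "attached C b'"
  shows "route b b'"
proof (cases "b \<in> crect C \<or> b' \<in> crect C")
  case True
  then show ?thesis using attached_route[OF b, of b'] attached_route[OF b', of b] by blast
next
  case False
  have fv: "\<exists>e r. e \<in> items \<and> reflex e r \<and> C = rc e r \<and> (\<exists>k v. (k = 1 \<or> k = -1) \<and> st e = Fav v \<and> v = rc e k \<and> dbl e \<and> x = fav e k)"
    if x: "attached C x" "x \<notin> crect C" for x
    using x(1)
  proof (cases rule: attached_cases)
    case 1 then show ?thesis using x(2) by blast
  qed blast+
  obtain e r k where e: "e \<in> items" "reflex e r" "C = rc e r" "k = 1 \<or> k = -1" "st e = Fav (rc e k)" "dbl e" "b = fav e k"
    using fv[OF b] False by blast
  obtain f q l where f: "f \<in> items" "reflex f q" "C = rc f q" "l = 1 \<or> l = -1" "st f = Fav (rc f l)" "dbl f" "b' = fav f l"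
    using fv[OF b'] False by blast
  show ?thesis
  proof (cases "e = f")
    case True
    have "rc e 1 \<noteq> rc e (-1)" using ends_distinct[OF e(1)] e(6) unfolding endA_def endB_def by auto
    then have "k = l" using e(4,5) f(4,5) True by auto
    then have "b' = b" using e(7) f(7) True by simp
    moreover have "b \<in> crect (rc e 0)" using favouring_fav[OF e(6,4)] e(7) unfolding favouring_def by simp
    ultimately show ?thesis using loc_cell[OF base_facts(1)[OF items_VE[OF e(1)]]] route.direct by blast
  next
    case False
    have "C \<in> {endA e, endB e}" "C \<in> {endA f, endB f}" using narrow_end[OF e(2)] narrow_end[OF f(2)] e(3) f(3) by auto
    then have "st e = Fav C" "st f = Fav C" using st_conflict[OF e(1) f(1) False] e(5) f(5) by auto
    then have C: "rc e k = C" "rc f l = C" using e(5) f(5) by auto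
    have "reflex e k" "reflex f l" using e(4,6) f(4,6) unfolding dbl_def by auto
    then have "loc b b'"
      using loc_favoured_both[OF _ favouring_fav[OF e(6,4)] _ favouring_fav[OF f(6,4)] _ False] C e(7) f(7) by simp
    then show ?thesis by (rule route.direct)
  qed
qed

lemma door_beacon:
  assumes rf: "reflex e r" and ns: "st e \<noteq> Skip"
  shows "\<exists>b. attached (rc e 0) b \<and> attached (rc e r) b"
proof -
  have e: "e \<in> items" using rf unfolding items_def by blast
  note ro = role_base[OF items_VE[OF e]] role_narrow[OF rf]
  show ?thesis
  proof (cases "st e = Full")
    case True
    then have "mid e r \<in> beac e" using beac_Full rf by blast
    then show ?thesis unfolding attached_def using ro e by blast
  next
    case False
    then obtain b where "b \<in> beac e" using ns unfolding beac_def by (cases "st e") auto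
    then show ?thesis unfolding attached_def using ro e False by blast
  qed
qed

section \<open>Chords without beacons\<close>

definition partner :: "cell \<Rightarrow> cell \<Rightarrow> bool" where
  "partner C D \<longleftrightarrow> (\<exists>e r. reflex e r \<and> st e = Skip \<and> (C = rc e 0 \<and> D = rc e r \<or> C = rc e r \<and> D = rc e 0))"

lemma partner_sym: "partner C D \<Longrightarrow> partner D C" unfolding partner_def by blast

lemma partner_end:
  assumes "reflex e r" "st e = Skip" shows "e \<in> items" "rc e 0 \<in> {endA e, endB e}" "rc e r \<in> {endA e, endB e}"
    "rc e 0 \<noteq> rc e r"
proof -
  show it: "e \<in> items" using assms items_def by blast
  then have nd: "\<not> dbl e" using st_Skip assms(2) by blast
  show "rc e 0 \<in> {endA e, endB e}" "rc e r \<in> {endA e, endB e}" using base_end[OF nd] narrow_end[OF assms(1)] by auto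
  show "rc e 0 \<noteq> rc e r" using ends_distinct[OF it] nd only_end_eq[OF assms(1) nd] unfolding endA_def endB_def by simp
qed

text \<open>Two chords with status \<open>Skip\<close> at a common cell are incompatible.\<close>

lemma partner_unique: assumes "partner C D" "partner C D'" shows "D = D'"
proof -
  obtain e r where e: "reflex e r" "st e = Skip" "C = rc e 0 \<and> D = rc e r \<or> C = rc e r \<and> D = rc e 0"
    using assms(1) partner_def by blast
  obtain f q where f: "reflex f q" "st f = Skip" "C = rc f 0 \<and> D' = rc f q \<or> C = rc f q \<and> D' = rc f 0"
    using assms(2) partner_def by blast
  note E = partner_end[OF e(1,2)] and F = partner_end[OF f(1,2)]
  have "C \<in> {endA e, endB e}" "C \<in> {endA f, endB f}" using e(3) f(3) E F by auto
  then have ef: "e = f" using st_conflict[OF E(1) F(1)] e(2) f(2) by auto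
  have nd: "\<not> dbl e" using st_Skip[OF E(1) e(2)] .
  have "r = q" using only_end_eq[OF e(1) nd] only_end_eq[of f q] f(1) nd ef by simp
  then show ?thesis using e(3) f(3) ef E(4) by auto
qed

text \<open>A skipped chord has only one reflex end, so its two cells form an L and no second door
  can divert the robot.\<close>

lemma partner_route:
  assumes "partner C D" "p \<in> crect C" "q \<in> crect D" shows "route p q"
proof -
  obtain e r where e: "reflex e r" "st e = Skip" "C = rc e 0 \<and> D = rc e r \<or> C = rc e r \<and> D = rc e 0"
    using assms(1) partner_def by blast
  have nd: "\<not> dbl e" using st_Skip partner_end(1)[OF e(1,2)] e(2) by blast
  have "\<not> reflex e (- r)" using nd e(1) reflex_sign[OF e(1)] unfolding dbl_def by auto
  then have "route p q" if "p \<in> crect (rc e 0)" "q \<in> crect (rc e r)" for p q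
    using loc_base_narrow[OF e(1) that] by (auto intro: route.direct)
  moreover have "route p q" if "p \<in> crect (rc e r)" "q \<in> crect (rc e 0)" for p q
    using route_narrow_base[OF e(1) _ _ that] e(2) by auto
  ultimately show ?thesis using e(3) assms(2,3) by blast
qed

text \<open>Next to a skipped chord, compatibility rules out a \<open>Fav\<close> chord having
  \<open>C\<close> as a narrow cell, and any other attached beacon lies in the cell itself.\<close>

lemma partner_attached:
  assumes "partner C D" "attached C b" shows "b \<in> crect C"
proof -
  obtain e r where e: "reflex e r" "st e = Skip" "C = rc e 0 \<or> C = rc e r"
    using assms(1) partner_def by blast
  note E = partner_end[OF e(1,2)]
  have Ce: "C \<in> {endA e, endB e}" using e(3) E by auto
  have no: False if "f \<in> items" "st f = Fav (rc f k)" "C = rc f q" "reflex f q" for f k q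
  proof -
    have "C \<in> {endA f, endB f}" using narrow_end that by blast
    moreover have "f \<noteq> e" using that(2) e(2) by auto
    ultimately show False using st_conflict[OF E(1) that(1) _ Ce] e(2) that(2) by auto
  qed
  show ?thesis
    using assms(2)
  proof (cases rule: attached_cases)
    case (2 f k)
    then show ?thesis using no[of f k k] by blast
  next
    case (3 f k)
    then show ?thesis using no[of f k "-k"] by blast
  qed
qed

text \<open>Partner cells share their beacons, so that a skipped chord acts as if it joined its
  cells into one.\<close>

definition near :: "cell \<Rightarrow> pt \<Rightarrow> bool" where
  "near C b \<longleftrightarrow> attached C b \<or> (\<exists>D. partner C D \<and> attached D b)"

lemma near_B: "near C b \<Longrightarrow> b \<in> B" unfolding near_def using attached_B by blast

lemma near_route:
  assumes n: "near C b" and p: "p \<in> crect C"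
  shows "route p b" "route b p"
proof -
  have "route p b \<and> route b p"
  proof (cases "attached C b")
    case True
    then show ?thesis using attached_route p by blast
  next
    case False
    then obtain D where D: "partner C D" "attached D b" using n near_def by blast
    have "b \<in> crect D" using partner_attached[OF partner_sym[OF D(1)] D(2)] .
    then show ?thesis using partner_route[OF D(1) p] partner_route[OF partner_sym[OF D(1)] _ p] by blast
  qed
  then show "route p b" "route b p" by auto
qed

lemma near_near: assumes b: "near C b" and b': "near C b'" shows "route b b'"
proof -
  obtain D where D: "D = C \<or> partner C D" "attached D b" using b near_def by blast
  obtain D' where D': "D' = C \<or> partner C D'" "attached D' b'" using b' near_def by blast
  show ?thesis
  proof (cases "D = D'")
    case True
    then show ?thesis using attached_attached D D' by blast
  next
    case False
    then have "partner D D'" using D(1) D'(1) partner_unique partner_sym by blast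
    then show ?thesis
      using partner_route partner_attached[OF _ D(2)] partner_attached[OF partner_sym D'(2)] by blast
  qed
qed

lemma near_adj: assumes "adj C D" shows "partner C D \<or> (\<exists>b. near C b \<and> near D b)"
proof -
  obtain e r where e: "reflex e r" "C = rc e 0 \<and> D = rc e r \<or> C = rc e r \<and> D = rc e 0"
    using assms adj_def by blast
  show ?thesis
  proof (cases "st e = Skip")
    case True
    then show ?thesis unfolding partner_def using e by blast
  next
    case False
    then show ?thesis using door_beacon[OF e(1)] e(2) unfolding near_def by blast
  qed
qed

lemma near_partner: assumes "partner C D" shows "near C b \<longleftrightarrow> near D b"
  unfolding near_def using assms partner_sym partner_unique by blast

theorem route_all: assumes p: "p \<in> P" and q: "q \<in> P" shows "route p q"
proof -
  obtain C where C: "cell C" "p \<in> crect C" using cells_cover[OF p] .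
  obtain D where D: "cell D" "q \<in> crect D" using cells_cover[OF q] .
  show ?thesis
  proof (cases "\<exists>A b. cell A \<and> near A b")
    case True
    then obtain A0 b0 where b0: "cell A0" "near A0 b0" by blast
    \<comment> \<open>Existence of a near beacon is part of the invariant; it propagates because
      adjacent cells are partners or share a near beacon.\<close>
    define S where "S = {A. cell A \<and> (\<exists>b. near A b) \<and> (\<forall>b. near A b \<longrightarrow> route b b0 \<and> route b0 b)}"
    have "S = {C. cell C}"
    proof (rule cells_connected)
      show "S \<subseteq> {C. cell C}" unfolding S_def by blast
      show "S \<noteq> {}" unfolding S_def using b0 near_near by blast
      fix E F assume E: "E \<in> S" and F: "cell F" "adj E F"
      from near_adj[OF F(2)] show "F \<in> S"
      proof
        assume "partner E F"
        then show "F \<in> S" using E F(1) near_partner unfolding S_def by blast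
      next
        assume "\<exists>b. near E b \<and> near F b"
        then obtain b where b: "near E b" "near F b" by blast
        have bb: "route b b0" "route b0 b" using E b(1) unfolding S_def by blast+
        have "route b' b0 \<and> route b0 b'" if "near F b'" for b'
          using route_trans[OF near_near[OF that b(2)] near_B[OF b(1)] bb(1)]
            route_trans[OF bb(2) near_B[OF b(1)] near_near[OF b(2) that]] by blast
        then show "F \<in> S" unfolding S_def using F(1) b(2) by blast
      qed
    qed
    then have "C \<in> S" "D \<in> S" using C D by auto
    then obtain b b' where b: "near C b" "near D b'" "route b b0" "route b0 b'" unfolding S_def by blast
    have "route b b'" using route_trans[OF b(3) near_B[OF b0(2)] b(4)] .
    then have "route b q" using route_trans[OF _ near_B[OF b(2)] near_route(2)[OF b(2) D(2)]] by blast
    then show ?thesis using route_trans[OF near_route(1)[OF b(1) C(2)] near_B[OF b(1)]] by blast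
  next
    case False
    \<comment> \<open>Without beacons near any cell, all adjacent cells are partners; by uniqueness
      there are at most two cells.\<close>
    define S where "S = {A. cell A \<and> (A = C \<or> partner C A)}"
    have "S = {C. cell C}"
    proof (rule cells_connected)
      show "S \<subseteq> {C. cell C}" "S \<noteq> {}" unfolding S_def using C by auto
      fix E F assume E: "E \<in> S" and F: "cell F" "adj E F"
      have "partner E F" using near_adj[OF F(2)] False F(1) by blast
      then show "F \<in> S" using E F(1) partner_unique partner_sym unfolding S_def by blast
    qed
    then have "D = C \<or> partner C D" using D(1) unfolding S_def by blast
    then show ?thesis using partner_route C D loc_cell route.direct by metis
  qed
qed

end

section \<open>Orthogonal polygons\<close>

context rectilinear
begin

lemma card_reflex_directions:
  assumes rf: "reflex e r" and t: "0 < t" "t < gap"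
  shows "card {d \<in> {(1,1), (1,-1), (-1,1), (-1,-1)}. (pos e, tip e r) + t *\<^sub>R d \<in> inn} = 3"
proof -
  have r: "r = 1 \<or> r = -1" and e: "e \<in> VE" using reflex_sign[OF rf] reflex_VE[OF rf] by auto
  let ?p = "\<lambda>d. (pos e, tip e r) + t *\<^sub>R d"
  have "?p (sd e, r) \<in> halfV e r" "?p (- sd e, r) \<in> halfV e r" "?p (sd e, - r) \<in> halfH e r (sd e)"
    using t r sd_cases[of e] unfolding halfV_def halfH_def by auto
  then have i: "?p (sd e, r) \<in> inn" "?p (- sd e, r) \<in> inn" "?p (sd e, - r) \<in> inn" using reflex_corner[OF rf] by blast+
  have "?p (- sd e, - r) \<in> stripV e (- sd e)"
    using t r sd_cases[of e] V_length[OF e] unfolding stripV_def by auto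
  then have o: "?p (- sd e, - r) \<notin> inn" using sd_out[OF e] inn_out by blast
  have "{d \<in> {(1,1), (1,-1), (-1,1), (-1,-1)}. ?p d \<in> inn} = {(sd e, r), (- sd e, r), (sd e, - r)}"
    using i o r sd_cases[of e] by auto
  then show ?thesis using r sd_cases[of e] by auto
qed

text \<open>At a convex end both quadrants beyond the edge are outside, leaving at most two inner
  directions.\<close>

lemma card_convex_directions:
  assumes e: "e \<in> VE" and r: "r = 1 \<or> r = -1" and nr: "\<not> reflex e r" and t: "0 < t" "t < gap"
  shows "card {d \<in> {(1,1), (1,-1), (-1,1), (-1,-1)}. (pos e, tip e r) + t *\<^sub>R d \<in> inn} < 3"
proof -
  let ?p = "\<lambda>d. (pos e, tip e r) + t *\<^sub>R d"
  have "?p (1, r) \<in> halfV e r" "?p (-1, r) \<in> halfV e r" using t r unfolding halfV_def by auto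
  then have o: "?p (1, r) \<notin> inn" "?p (-1, r) \<notin> inn" using convex_corner(1)[OF e r nr] inn_out by blast+
  have "{d \<in> {(1,1), (1,-1), (-1,1), (-1,-1)}. ?p d \<in> inn} \<subseteq> {(1::real, - r), (-1, - r)}"
    using o r by auto
  then have "card {d \<in> {(1,1), (1,-1), (-1,1), (-1,-1)}. ?p d \<in> inn} \<le> card {(1::real, - r), (-1, - r)}"
    by (rule card_mono[rotated]) simp
  also have "\<dots> < 3" by (simp add: card_insert_if)
  finally show ?thesis .
qed

lemma loc_attraction_seq:
  assumes "loc p q"
  shows "\<exists>xs R. attraction_seq P q p xs \<and> R \<subseteq> crect ` {C. cell C} \<and> finite R \<and> card R \<le> 3 \<and> path_points xs \<subseteq> \<Union> R"
proof -
  obtain C D E xs where c: "cell C" "cell D" "cell E" "attraction_seq P q p xs" "path_points xs \<subseteq> crect C \<union> crect D \<union> crect E"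
    using assms unfolding loc_def attracts_within_def by blast
  have "card {crect C, crect D, crect E} \<le> 3" by (simp add: card_insert_if)
  then show ?thesis using c by (intro exI[of _ xs] exI[of _ "{crect C, crect D, crect E}"]) auto
qed

end

lemma (in rectilinear_status) route_sequence:
  assumes "route p q"
  shows "\<exists>bs. set bs \<subseteq> B \<and> (\<forall>i. Suc i < length (p # bs @ [q]) \<longrightarrow> loc ((p # bs @ [q]) ! i) ((p # bs @ [q]) ! Suc i))"
  using assms
proof induction
  case (direct p q)
  then show ?case by (intro exI[of _ "[]"]) (auto simp: less_Suc_eq)
next
  case (via p b q)
  then obtain bs where bs: "set bs \<subseteq> B" "\<And>i. Suc i < length (b # bs @ [q]) \<Longrightarrow> loc ((b # bs @ [q]) ! i) ((b # bs @ [q]) ! Suc i)"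
    by blast
  have "loc ((p # (b # bs) @ [q]) ! i) ((p # (b # bs) @ [q]) ! Suc i)" if "Suc i < length (p # (b # bs) @ [q])" for i
  proof (cases i)
    case 0
    then show ?thesis using via.hyps by simp
  next
    case (Suc j)
    then show ?thesis using bs(2)[of j] that by simp
  qed
  then show ?case using bs(1) via.hyps by (intro exI[of _ "b # bs"]) auto
qed

lemma vertical_segment_iff:
  fixes v w z :: pt
  assumes "fst v = fst w"
  shows "z \<in> closed_segment v w \<longleftrightarrow> fst z = fst v \<and> min (snd v) (snd w) \<le> snd z \<and> snd z \<le> max (snd v) (snd w)"
proof -
  have "z \<in> closed_segment v w \<longleftrightarrow> fst z = fst v \<and> snd z \<in> closed_segment (snd v) (snd w)"
  proof
    assume "z \<in> closed_segment v w"
    then obtain u where u: "0 \<le> u" "u \<le> 1" "z = (1 - u) *\<^sub>R v + u *\<^sub>R w" unfolding in_segment by blast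
    have "fst z = fst v" "snd z = (1 - u) *\<^sub>R snd v + u *\<^sub>R snd w" unfolding u(3) using assms by (auto simp: algebra_simps)
    then show "fst z = fst v \<and> snd z \<in> closed_segment (snd v) (snd w)"
      unfolding in_segment using u(1,2) by blast
  next
    assume "fst z = fst v \<and> snd z \<in> closed_segment (snd v) (snd w)"
    then obtain u where u: "0 \<le> u" "u \<le> 1" "snd z = (1 - u) *\<^sub>R snd v + u *\<^sub>R snd w" "fst z = fst v" unfolding in_segment by blast
    then have "z = (1 - u) *\<^sub>R v + u *\<^sub>R w" using assms by (simp add: prod_eq_iff algebra_simps)
    then show "z \<in> closed_segment v w" unfolding in_segment using u by blast
  qed
  then show ?thesis by (auto simp: closed_segment_eq_real_ivl split: if_splits)
qed

lemma horizontal_segment_iff: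
  fixes v w z :: pt
  assumes "snd v = snd w"
  shows "z \<in> closed_segment v w \<longleftrightarrow> snd z = snd v \<and> min (fst v) (fst w) \<le> fst z \<and> fst z \<le> max (fst v) (fst w)"
proof -
  have "z \<in> closed_segment v w \<longleftrightarrow> snd z = snd v \<and> fst z \<in> closed_segment (fst v) (fst w)"
  proof
    assume "z \<in> closed_segment v w"
    then obtain u where u: "0 \<le> u" "u \<le> 1" "z = (1 - u) *\<^sub>R v + u *\<^sub>R w" unfolding in_segment by blast
    have "snd z = snd v" "fst z = (1 - u) *\<^sub>R fst v + u *\<^sub>R fst w" unfolding u(3) using assms by (auto simp: algebra_simps)
    then show "snd z = snd v \<and> fst z \<in> closed_segment (fst v) (fst w)"
      unfolding in_segment using u(1,2) by blast
  next
    assume "snd z = snd v \<and> fst z \<in> closed_segment (fst v) (fst w)"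
    then obtain u where u: "0 \<le> u" "u \<le> 1" "fst z = (1 - u) *\<^sub>R fst v + u *\<^sub>R fst w" "snd z = snd v" unfolding in_segment by blast
    then have "z = (1 - u) *\<^sub>R v + u *\<^sub>R w" using assms by (simp add: prod_eq_iff algebra_simps)
    then show "z \<in> closed_segment v w" unfolding in_segment using u by blast
  qed
  then show ?thesis by (auto simp: closed_segment_eq_real_ivl split: if_splits)
qed

section \<open>From a vertex list to the horizontal and vertical edges\<close>

locale orthogonal_general =
  fixes vs :: "pt list"
  assumes op: "orthogonal_polygon vs" and gp: "general_position vs"
begin

abbreviation "n \<equiv> length vs"
abbreviation nx :: "nat \<Rightarrow> nat" where "nx i \<equiv> Suc i mod n"

lemma n3: "3 \<le> n" using op by (simp add: orthogonal_polygon_def)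

lemma nx_less: "i < n \<Longrightarrow> nx i < n" by (intro mod_less_divisor) linarith

lemma nx_ne: assumes "i < n" shows "nx i \<noteq> i" using assms n3 by (cases "Suc i = n") auto

lemma nx_pred: assumes "i < n" obtains j where "j < n" "nx j = i"
proof (cases i)
  case 0
  have "Suc (n - 1) = n" "n - 1 < n" using n3 by linarith+
  then show thesis using that[of "n - 1"] 0 by simp
next
  case (Suc k)
  then show thesis using that[of k] assms by simp
qed

lemma vertex_ne: assumes "i < n" shows "vs ! i \<noteq> vs ! nx i"
  using op nx_ne[OF assms] nx_less[OF assms] assms by (simp add: orthogonal_polygon_def nth_eq_iff_index_eq)

lemma vert_or_horiz: "i < n \<Longrightarrow> vert_edge vs i \<or> horiz_edge vs i" using op by (simp add: orthogonal_polygon_def)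

lemma not_both: "i < n \<Longrightarrow> vert_edge vs i \<Longrightarrow> \<not> horiz_edge vs i"
  using vertex_ne[of i] unfolding vert_edge_def horiz_edge_def by (auto simp: prod_eq_iff)

lemma vert_inj: "i < n \<Longrightarrow> j < n \<Longrightarrow> vert_edge vs i \<Longrightarrow> vert_edge vs j \<Longrightarrow> fst (vs ! i) = fst (vs ! j) \<Longrightarrow> i = j"
  using gp unfolding general_position_def by blast

lemma horiz_inj: "i < n \<Longrightarrow> j < n \<Longrightarrow> horiz_edge vs i \<Longrightarrow> horiz_edge vs j \<Longrightarrow> snd (vs ! i) = snd (vs ! j) \<Longrightarrow> i = j"
  using gp unfolding general_position_def by blast

text \<open>Two consecutive edges of the same direction would lie on one line, which general
  position excludes.\<close>

lemma vert_nx: assumes "i < n" shows "vert_edge vs (nx i) \<longleftrightarrow> \<not> vert_edge vs i"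
proof
  assume v: "vert_edge vs (nx i)"
  show "\<not> vert_edge vs i"
  proof
    assume "vert_edge vs i"
    then have "i = nx i" using vert_inj[OF assms nx_less[OF assms] _ v] by (simp add: vert_edge_def)
    then show False using nx_ne[OF assms] by simp
  qed
next
  assume "\<not> vert_edge vs i"
  then have h: "horiz_edge vs i" using vert_or_horiz[OF assms] by blast
  show "vert_edge vs (nx i)"
  proof (rule ccontr)
    assume "\<not> vert_edge vs (nx i)"
    then have h': "horiz_edge vs (nx i)" using vert_or_horiz[OF nx_less[OF assms]] by blast
    then have "i = nx i" using horiz_inj[OF assms nx_less[OF assms] h h'] h by (simp add: horiz_edge_def)
    then show False using nx_ne[OF assms] by simp
  qed
qed

lemma horiz_iff: "i < n \<Longrightarrow> horiz_edge vs i \<longleftrightarrow> \<not> vert_edge vs i" using not_both vert_or_horiz by blast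

definition vseg where "vseg i = Seg (fst (vs ! i)) (min (snd (vs ! i)) (snd (vs ! nx i))) (max (snd (vs ! i)) (snd (vs ! nx i)))"
definition hseg where "hseg i = Seg (snd (vs ! i)) (min (fst (vs ! i)) (fst (vs ! nx i))) (max (fst (vs ! i)) (fst (vs ! nx i)))"

definition VE where "VE = vseg ` {i. i < n \<and> vert_edge vs i}"
definition HE where "HE = hseg ` {i. i < n \<and> horiz_edge vs i}"

lemma vseg_edge: assumes "vert_edge vs i"
  shows "z \<in> edge vs i \<longleftrightarrow> fst z = pos (vseg i) \<and> lo (vseg i) \<le> snd z \<and> snd z \<le> hi (vseg i)"
  using vertical_segment_iff[of "vs ! i" "vs ! nx i"] assms unfolding edge_def vert_edge_def vseg_def by simp

lemma hseg_edge: assumes "horiz_edge vs i"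
  shows "z \<in> edge vs i \<longleftrightarrow> snd z = pos (hseg i) \<and> lo (hseg i) \<le> fst z \<and> fst z \<le> hi (hseg i)"
  using horizontal_segment_iff[of "vs ! i" "vs ! nx i"] assms unfolding edge_def horiz_edge_def hseg_def by simp

text \<open>Edges alternate in direction, so the cyclic successor maps the vertical edges
  bijectively onto the horizontal ones.\<close>

lemma card_VE: "2 * card VE = n"
proof -
  let ?V = "{i. i < n \<and> vert_edge vs i}" and ?H = "{i. i < n \<and> \<not> vert_edge vs i}"
  have "inj_on vseg ?V" unfolding inj_on_def vseg_def using vert_inj by auto
  then have c: "card VE = card ?V" unfolding VE_def by (rule card_image)
  have inj: "inj_on nx {..<n}"
  proof (rule eq_card_imp_inj_on)
    have "{..<n} \<subseteq> nx ` {..<n}"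
    proof
      fix i assume "i \<in> {..<n}"
      then obtain j where "j < n" "nx j = i" using nx_pred by blast
      then show "i \<in> nx ` {..<n}" by blast
    qed
    then have "nx ` {..<n} = {..<n}" using nx_less by blast
    then show "card (nx ` {..<n}) = card {..<n}" by simp
  qed simp
  have "card ?V = card (nx ` ?V)" by (rule card_image[symmetric]) (use inj in \<open>auto intro: inj_on_subset\<close>)
  also have "nx ` ?V = ?H"
  proof
    show "nx ` ?V \<subseteq> ?H" using vert_nx nx_less by auto
    show "?H \<subseteq> nx ` ?V"
    proof
      fix i assume i: "i \<in> ?H"
      then obtain j where "j < n" "nx j = i" using nx_pred by blast
      then show "i \<in> nx ` ?V" using vert_nx[of j] i by blast
    qed
  qed
  finally have "card ?V = card ?H" .
  moreover have "card ?V + card ?H = card (?V \<union> ?H)" by (subst card_Un_disjoint) auto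
  moreover have "?V \<union> ?H = {..<n}" by auto
  ultimately show ?thesis using c by simp
qed

lemma VH_end:
  assumes i: "i < n" "vert_edge vs i" and y: "y = lo (vseg i) \<or> y = hi (vseg i)"
  shows "\<exists>h\<in>HE. pos h = y \<and> (pos (vseg i) = lo h \<or> pos (vseg i) = hi h)"
proof -
  obtain j where j: "j < n" "nx j = i" using nx_pred[OF i(1)] .
  have h: "horiz_edge vs (nx i)" "horiz_edge vs j"
    using vert_nx[OF i(1)] vert_nx[OF j(1)] horiz_iff nx_less[OF i(1)] i j by auto
  then have "hseg (nx i) \<in> HE" "hseg j \<in> HE" unfolding HE_def using i(1) j(1) nx_less by auto
  moreover have "y = snd (vs ! i) \<or> y = snd (vs ! nx i)" using y unfolding vseg_def by (auto simp: min_def max_def split: if_splits)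
  moreover have "pos (hseg j) = snd (vs ! i) \<and> (pos (vseg i) = lo (hseg j) \<or> pos (vseg i) = hi (hseg j))"
    using h(2) j(2) unfolding hseg_def vseg_def horiz_edge_def by (auto simp: min_def max_def)
  moreover have "pos (hseg (nx i)) = snd (vs ! nx i) \<and> (pos (vseg i) = lo (hseg (nx i)) \<or> pos (vseg i) = hi (hseg (nx i)))"
    using i(2) unfolding hseg_def vseg_def vert_edge_def by (auto simp: min_def max_def)
  ultimately show ?thesis by metis
qed

lemma HV_end:
  assumes i: "i < n" "horiz_edge vs i" and y: "c = lo (hseg i) \<or> c = hi (hseg i)"
  shows "\<exists>e\<in>VE. pos e = c \<and> (pos (hseg i) = lo e \<or> pos (hseg i) = hi e)"
proof -
  obtain j where j: "j < n" "nx j = i" using nx_pred[OF i(1)] .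
  have h: "vert_edge vs (nx i)" "vert_edge vs j"
    using vert_nx[OF i(1)] vert_nx[OF j(1)] horiz_iff[OF i(1)] i j by auto
  then have "vseg (nx i) \<in> VE" "vseg j \<in> VE" unfolding VE_def using i(1) j(1) nx_less by auto
  moreover have "c = fst (vs ! i) \<or> c = fst (vs ! nx i)" using y unfolding hseg_def by (auto simp: min_def max_def split: if_splits)
  moreover have "pos (vseg j) = fst (vs ! i) \<and> (pos (hseg i) = lo (vseg j) \<or> pos (hseg i) = hi (vseg j))"
    using h(2) j(2) unfolding hseg_def vseg_def vert_edge_def by (auto simp: min_def max_def)
  moreover have "pos (vseg (nx i)) = fst (vs ! nx i) \<and> (pos (hseg i) = lo (vseg (nx i)) \<or> pos (hseg i) = hi (vseg (nx i)))"
    using i(2) unfolding hseg_def vseg_def horiz_edge_def by (auto simp: min_def max_def)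
  ultimately show ?thesis by metis
qed

lemma crossing_end:
  assumes i: "i < n" "vert_edge vs i" and j: "j < n" "horiz_edge vs j"
    and c: "lo (hseg j) \<le> pos (vseg i)" "pos (vseg i) \<le> hi (hseg j)" "lo (vseg i) \<le> pos (hseg j)" "pos (hseg j) \<le> hi (vseg i)"
  shows "(pos (vseg i) = lo (hseg j) \<or> pos (vseg i) = hi (hseg j)) \<and> (pos (hseg j) = lo (vseg i) \<or> pos (hseg j) = hi (vseg i))"
proof -
  let ?z = "(pos (vseg i), pos (hseg j))"
  have "?z \<in> edge vs i" "?z \<in> edge vs j" using vseg_edge[OF i(2), of ?z] hseg_edge[OF j(2), of ?z] c by auto
  moreover have "i \<noteq> j" using not_both i j by blast
  ultimately have z: "?z \<in> {vs ! i, vs ! nx i}" "?z \<in> {vs ! j, vs ! nx j}"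
    using op i(1) j(1) unfolding orthogonal_polygon_def by blast+
  have "pos (hseg j) = snd (vs ! i) \<or> pos (hseg j) = snd (vs ! nx i)" using z(1) by (metis insertE singletonD snd_conv)
  moreover have "pos (vseg i) = fst (vs ! j) \<or> pos (vseg i) = fst (vs ! nx j)" using z(2) by (metis insertE singletonD fst_conv)
  ultimately show ?thesis unfolding vseg_def hseg_def by (auto simp: min_def max_def)
qed

sublocale R: rectilinear VE HE "poly_boundary vs"
proof -
  obtain g where g: "simple_path g" "pathfinish g = pathstart g" "path_image g = poly_boundary vs"
    using polygon_boundary_simple_path[OF op] by blast
  note J = Jordan_inside_outside_plane[OF g(1,2), unfolded g(3)]
  show "rectilinear VE HE (poly_boundary vs)"
  proof
    show "finite VE" "finite HE" unfolding VE_def HE_def by auto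
    show "lo e < hi e" if eV: "e \<in> VE" for e
    proof -
      obtain i where i: "i < n" "vert_edge vs i" "e = vseg i" using eV VE_def by auto
      then have "snd (vs ! i) \<noteq> snd (vs ! nx i)" using vertex_ne[OF i(1)] by (auto simp: vert_edge_def prod_eq_iff)
      then show ?thesis using i(3) by (auto simp: vseg_def)
    qed
    show "lo e < hi e" if eH: "e \<in> HE" for e
    proof -
      obtain i where i: "i < n" "horiz_edge vs i" "e = hseg i" using eH HE_def by auto
      then have "fst (vs ! i) \<noteq> fst (vs ! nx i)" using vertex_ne[OF i(1)] by (auto simp: horiz_edge_def prod_eq_iff)
      then show ?thesis using i(3) by (auto simp: hseg_def)
    qed
    show "e = f" if ef: "e \<in> VE" "f \<in> VE" "pos e = pos f" for e f
    proof -
      obtain i j where i: "i < n" "vert_edge vs i" "e = vseg i" "j < n" "vert_edge vs j" "f = vseg j" using ef VE_def by auto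
      then have "i = j" using vert_inj[of i j] ef(3) by (simp add: vseg_def)
      then show ?thesis using i by simp
    qed
    show "e = f" if ef: "e \<in> HE" "f \<in> HE" "pos e = pos f" for e f
    proof -
      obtain i j where i: "i < n" "horiz_edge vs i" "e = hseg i" "j < n" "horiz_edge vs j" "f = hseg j" using ef HE_def by auto
      then have "i = j" using horiz_inj[of i j] ef(3) by (simp add: hseg_def)
      then show ?thesis using i by simp
    qed
    show "\<exists>h\<in>HE. pos h = y \<and> (pos e = lo h \<or> pos e = hi h)" if "e \<in> VE" "y = lo e \<or> y = hi e" for e y
      using that VH_end unfolding VE_def by blast
    show "\<exists>e\<in>VE. pos e = c \<and> (pos h = lo e \<or> pos h = hi e)" if "h \<in> HE" "c = lo h \<or> c = hi h" for h c
      using that HV_end unfolding HE_def by blast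
    show "(pos e = lo h \<or> pos e = hi h) \<and> (pos h = lo e \<or> pos h = hi e)"
      if "e \<in> VE" "h \<in> HE" "lo h \<le> pos e" "pos e \<le> hi h" "lo e \<le> pos h" "pos h \<le> hi e" for e h
      using that crossing_end unfolding VE_def HE_def by blast
    show "z \<in> poly_boundary vs \<longleftrightarrow> (\<exists>e\<in>VE. fst z = pos e \<and> lo e \<le> snd z \<and> snd z \<le> hi e) \<or>
                            (\<exists>h\<in>HE. snd z = pos h \<and> lo h \<le> fst z \<and> fst z \<le> hi h)" for z
    proof -
      have "z \<in> poly_boundary vs \<longleftrightarrow> (\<exists>i<n. vert_edge vs i \<and> z \<in> edge vs i) \<or> (\<exists>i<n. horiz_edge vs i \<and> z \<in> edge vs i)"
        unfolding poly_boundary_def using vert_or_horiz by blast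
      then show ?thesis unfolding VE_def HE_def using vseg_edge hseg_edge by blast
    qed
    show "closed (poly_boundary vs)" using closed_simple_path_image[OF g(1)] g(3) by simp
    show "inside (poly_boundary vs) \<noteq> {}" "connected (inside (poly_boundary vs))" "bounded (inside (poly_boundary vs))"
      "frontier (inside (poly_boundary vs)) = poly_boundary vs" "frontier (outside (poly_boundary vs)) = poly_boundary vs"
      using J by auto
    show "\<exists>A B. open A \<and> open B \<and> A \<inter> B = {} \<and> A \<union> B = inside (poly_boundary vs) - open_segment a b \<and>
       open_segment a b \<subseteq> closure A \<and> open_segment a b \<subseteq> closure B"
      if "a \<in> poly_boundary vs" "b \<in> poly_boundary vs" "a \<noteq> b" "open_segment a b \<subseteq> inside (poly_boundary vs)" for a b
      using chord_separates[OF g(1,2), unfolded g(3), OF that] .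
  qed
qed

lemma P_eq: "R.P = poly_region vs" unfolding R.P_def poly_region_def ..

text \<open>One of the two edges at a vertex is vertical.\<close>

lemma vertex_is_tip: assumes "v \<in> set vs" obtains e r where "e \<in> VE" "r = 1 \<or> r = -1" "v = (pos e, tip e r)"
proof -
  obtain i where i: "i < n" "v = vs ! i" using assms by (metis in_set_conv_nth)
  obtain j where j: "j < n" "nx j = i" using nx_pred[OF i(1)] .
  obtain k where k: "k < n" "vert_edge vs k" "v = vs ! k \<or> v = vs ! nx k"
    using vert_nx[OF j(1)] i j by metis
  have e: "vseg k \<in> VE" unfolding VE_def using k by blast
  have "fst v = pos (vseg k)" using k(2,3) unfolding vseg_def vert_edge_def by auto
  moreover have "snd v = lo (vseg k) \<or> snd v = hi (vseg k)" using k(3) unfolding vseg_def by (auto simp: min_def max_def)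
  ultimately have "v = (pos (vseg k), tip (vseg k) (-1)) \<or> v = (pos (vseg k), tip (vseg k) 1)" by (auto simp: prod_eq_iff)
  then show thesis using that e by blast
qed

lemma tip_is_vertex: assumes "e \<in> VE" "r = 1 \<or> r = -1" shows "(pos e, tip e r) \<in> set vs"
proof -
  obtain k where k: "k < n" "vert_edge vs k" "e = vseg k" using assms(1) VE_def by auto
  have "(pos e, tip e r) = vs ! k \<or> (pos e, tip e r) = vs ! nx k"
    using k(2) assms(2) unfolding k(3) vseg_def vert_edge_def by (auto simp: prod_eq_iff min_def max_def)
  then show ?thesis using k(1) nx_less nth_mem by metis
qed

lemma reflex_vertices: "{v. reflex_vertex vs v} = R.RV"
proof -
  have int: "interior (poly_region vs) = inside (poly_boundary vs)" using R.interior_P P_eq by simp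
  show ?thesis
  proof
    show "R.RV \<subseteq> {v. reflex_vertex vs v}"
    proof
      fix v assume "v \<in> R.RV"
      then obtain e r where v: "v = (pos e, tip e r)" "R.reflex e r" unfolding R.RV_def by blast
      then show "v \<in> {v. reflex_vertex vs v}"
        unfolding reflex_vertex_def int mem_Collect_eq
        using tip_is_vertex[OF R.reflex_VE R.reflex_sign] R.card_reflex_directions[OF v(2)] R.gap_pos by blast
    qed
    show "{v. reflex_vertex vs v} \<subseteq> R.RV"
    proof
      fix v assume "v \<in> {v. reflex_vertex vs v}"
      then obtain d where d: "v \<in> set vs" "d > 0"
        "\<And>t. 0 < t \<Longrightarrow> t < d \<Longrightarrow> card {d \<in> {(1,1), (1,-1), (-1,1), (-1,-1)}. v + t *\<^sub>R d \<in> inside (poly_boundary vs)} = 3"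
        unfolding reflex_vertex_def int by auto
      obtain e r where e: "e \<in> VE" "r = 1 \<or> r = -1" "v = (pos e, tip e r)" using vertex_is_tip[OF d(1)] .
      \<comment> \<open>Small enough for the quadrant count of the given reflex vertex and for the
        corner analysis at the same time.\<close>
      define t where "t = min d R.gap / 2"
      have t: "0 < t" "t < d" "t < R.gap" using d(2) R.gap_pos unfolding t_def by auto
      have "R.reflex e r"
        using R.card_convex_directions[OF e(1,2) _ t(1,3)] d(3)[OF t(1,2)] unfolding e(3) by auto
      then show "v \<in> R.RV" unfolding R.RV_def using e(3) by blast
    qed
  qed
qed

lemma cell_decomp: assumes "R.cell C" shows "crect C \<in> decomp_cells vs"
proof -
  have "closure (orect C) \<in> decomp_cells vs"
    unfolding decomp_cells_def reflex_vertices P_eq[symmetric] R.interior_P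
    using R.orect_component[OF assms] by (rule imageI)
  then show ?thesis using R.cell_closure[OF assms] by simp
qed

lemma exists_local_routing_set: "\<exists>B. local_routing_set vs B \<and> card B \<le> (n - 4) div 3"
proof -
  obtain st where st: "admissible R.endA R.endB R.dbl R.items st"
    "3 * (\<Sum>e\<in>R.items. cost (R.dbl e) (st e)) \<le> 2 * card R.reflex_ends" using R.exists_status .
  interpret S: rectilinear_status VE HE "poly_boundary vs" st by unfold_locales (rule st(1))
  have "local_beacon_routing vs S.B p q" if p: "p \<in> poly_region vs" and q: "q \<in> poly_region vs" for p q
  proof -
    obtain bs where bs: "set bs \<subseteq> S.B"
      "\<And>i. Suc i < length (p # bs @ [q]) \<Longrightarrow> R.loc ((p # bs @ [q]) ! i) ((p # bs @ [q]) ! Suc i)"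
      using S.route_sequence[OF S.route_all] p q P_eq by blast
    have "\<exists>xs. attraction_seq (poly_region vs) y x xs \<and> local_set vs (path_points xs)" if xy: "R.loc x y" for x y
    proof -
      obtain xs Q where "attraction_seq R.P y x xs" "Q \<subseteq> crect ` {C. R.cell C}" "finite Q" "card Q \<le> 3" "path_points xs \<subseteq> \<Union> Q"
        using R.loc_attraction_seq[OF xy] by blast
      moreover from this have "Q \<subseteq> decomp_cells vs" using cell_decomp by blast
      ultimately show ?thesis unfolding local_set_def P_eq by blast
    qed
    then show ?thesis unfolding local_beacon_routing_def Let_def using bs by blast
  qed
  then have "local_routing_set vs S.B" unfolding local_routing_set_def using S.card_B(1) S.B_P P_eq by blast
  \<comment> \<open>With \<open>2 * card VE = n\<close> the number of reflex ends is at most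
    \<open>n / 2 - 2\<close>, and three times the number of beacons is at most twice that, which is
    \<open>n - 4\<close>.\<close>
  moreover have "card S.B \<le> (n - 4) div 3"
    using S.card_B(2) st(2) R.card_reflex_ends card_VE by linarith
  ultimately show ?thesis by blast
qed

end

theorem theorem2:
  fixes vs :: "pt list"
  assumes "orthogonal_polygon vs" and "general_position vs"
  shows "\<exists>B. local_routing_set vs B \<and> card B \<le> (length vs - 4) div 3"
proof -
  interpret orthogonal_general vs by unfold_locales (use assms in auto)
  show ?thesis by (rule exists_local_routing_set)
qed

end
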